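(* Let $d\in\{1,2\}$, let $L^d$ be a symmetric link function satisfying Property B, suppose the input variables satisfy Assumption I, and for $t\ge 0$ let $A_n(t)=n^{-1/2}((S^{(n)}_{L^d(i,j)}(t)))_{1\le i,j\le n}$. Assume that $\lim_{n\to\infty}\#\Pi(w)/n^{1+m}$ exists for all $w\in\mathcal P_2(2m)$, $m\ge1$. Then for every $l\ge1$, $$\mathbb E\Big(n^{-1}\mathrm{Trace}(n^{-1/2}A_n(t))^l-\mathbb E\,n^{-1}\mathrm{Trace}(n^{-1/2}A_n(t))^l\Big)^4=t^{2l}\,O(n^{-2})\quad (n\to\infty).$$ Thus the empirical spectral distribution of $n^{-1/2}A_n(t)$ converges weakly almost surely to the unique probability law whose odd moments are zero and whose $2m$th moment, $m\ge1$, is $$t^m\sum_{w\in\mathcal P_2(2m)}\lim_{n\to\infty}\frac{\#\Pi(w)}{n^{1+m}}.$$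
   Context: All random variables live on one probability space. $[x]$ is the greatest integer $\le x$. Assumption I: $\{X_{i,j,k},X_{i,k}: i,j\ge0,\ k\ge1\}$ are independent real random variables with mean zero and variance one, and for each $l\ge3$, $\sup_{i,j,k}\mathbb E[|X_{i,j,k}|^l+|X_{i,k}|^l]<\infty$. Random walks: $S^{(n)}_{i,j}(t)=\sum_{k=1}^{[nt]}X_{i,j,k}$ and $S^{(n)}_i(t)=\sum_{k=1}^{[nt]}X_{i,k}$ (empty sums are $0$). Link function: for $d\in\{1,2\}$, a sequence of functions $L^d=L^d_n:\{1,\dots,n\}^2\to\mathbb Z^d$ (with values in the index set of the input variables). It is symmetric if $L^d(i,j)=L^d(j,i)$ for all $i,j$. Property B: $\sup_n\sup_{r\in\mathbb Z_+^d}\sup_{1\le i\le n}\#\{j:1\le j\le n,\ L^d(i,j)=r\}<\infty$. The matrix uses the walks $S^{(n)}_{i,j}$ if $d=2$ and $S^{(n)}_i$ if $d=1$. Circuits and words: a circuit of length $l$ is a function $\pi:\{0,1,\dots,l\}\to\{1,\dots,n\}$ with $\pi(0)=\pi(l)$. A word of length $l$ is a sequence of $l$ letters whose first occurrences are in alphabetical order (equivalently a partition of $\{1,\dots,l\}$); $w(i)$ is its $i$th letter. $\Pi(w)$ (depending on $n$) is the set of circuits $\pi$ of length $l$ such that $w(i)=w(j)$ if and only if $L^d(\pi(i-1),\pi(i))=L^d(\pi(j-1),\pi(j))$. A word is pair-matched if each letter appears exactly twice; $\mathcal P_2(2m)$ is the set of pair-matched words of length $2m$. The empirical spectral distribution of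 a real symmetric $n\times n$ matrix with eigenvalues $\lambda_1,\dots,\lambda_n$ is $F(x)=n^{-1}\sum_{k}\mathbb I(\lambda_k\le x)$. Weak a.s. convergence to a non-random $F$ means that, with probability one, the ESDs converge to $F$ at all continuity points of $F$. *)

theory Defs
  imports "HOL-Probability.Probability" "Jordan_Normal_Form.Char_Poly"
begin

text \<open>A point of $Z_+^d$ is a list of \<open>d\<close> natural numbers. The input variable $X_{i,j,k}$ is
  \<open>X [i, j] k\<close> and $X_{i,k}$ is \<open>X [i] k\<close>.\<close>

definition Zplus :: "nat \<Rightarrow> nat list set" where
  "Zplus d = {r. length r = d}"

definition assumption_I :: "'a measure \<Rightarrow> (nat list \<Rightarrow> nat \<Rightarrow> 'a \<Rightarrow> real) \<Rightarrow> bool" where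
  "assumption_I M X \<longleftrightarrow>
     prob_space.indep_vars M (\<lambda>_. borel) (\<lambda>(r, k). X r k) ((Zplus 1 \<union> Zplus 2) \<times> {1..}) \<and>
     (\<forall>r\<in>Zplus 1 \<union> Zplus 2. \<forall>k\<ge>1.
        integrable M (X r k) \<and> integrable M (\<lambda>\<omega>. (X r k \<omega>)\<^sup>2) \<and>
        prob_space.expectation M (X r k) = 0 \<and> prob_space.variance M (X r k) = 1) \<and>
     (\<forall>l\<ge>3. (SUP (i, j, k)\<in>UNIV \<times> UNIV \<times> {1..}.
        \<integral>\<^sup>+\<omega>. ennreal (\<bar>X [i, j] k \<omega>\<bar> ^ l + \<bar>X [i] k \<omega>\<bar> ^ l) \<partial>M) < \<infinity>)"

definition walk :: "(nat list \<Rightarrow> nat \<Rightarrow> 'a \<Rightarrow> real) \<Rightarrow> nat \<Rightarrow> nat list \<Rightarrow> real \<Rightarrow> 'a \<Rightarrow> real" where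
  "walk X n r t \<omega> = (\<Sum>k = 1..nat \<lfloor>real n * t\<rfloor>. X r k \<omega>)"

text \<open>A link function \<open>L\<close> is a sequence in \<open>n\<close>; only the values \<open>L n i j\<close> with
  \<open>i\<close> and \<open>j\<close> in \<open>{1..n}\<close> are meaningful.\<close>

definition link_function :: "nat \<Rightarrow> (nat \<Rightarrow> nat \<Rightarrow> nat \<Rightarrow> nat list) \<Rightarrow> bool" where
  "link_function d L \<longleftrightarrow> (\<forall>n. \<forall>i\<in>{1..n}. \<forall>j\<in>{1..n}. L n i j \<in> Zplus d)"

definition symmetric_link :: "(nat \<Rightarrow> nat \<Rightarrow> nat \<Rightarrow> nat list) \<Rightarrow> bool" where
  "symmetric_link L \<longleftrightarrow> (\<forall>n. \<forall>i\<in>{1..n}. \<forall>j\<in>{1..n}. L n i j = L n j i)"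

definition property_B :: "nat \<Rightarrow> (nat \<Rightarrow> nat \<Rightarrow> nat \<Rightarrow> nat list) \<Rightarrow> bool" where
  "property_B d L \<longleftrightarrow>
     (\<exists>C. \<forall>n. \<forall>r\<in>Zplus d. \<forall>i\<in>{1..n}. card {j \<in> {1..n}. L n i j = r} \<le> C)"

text \<open>Matrices are indexed from 0, link functions from 1.\<close>

definition walk_matrix ::
  "(nat list \<Rightarrow> nat \<Rightarrow> 'a \<Rightarrow> real) \<Rightarrow> (nat \<Rightarrow> nat \<Rightarrow> nat \<Rightarrow> nat list) \<Rightarrow> nat \<Rightarrow> real \<Rightarrow> 'a \<Rightarrow> real mat"
where
  "walk_matrix X L n t \<omega> =
     (real n powr (-1/2)) \<cdot>\<^sub>m mat n n (\<lambda>(i, j). walk X n (L n (Suc i) (Suc j)) t \<omega>)"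

definition mat_trace :: "'b::comm_monoid_add mat \<Rightarrow> 'b" where
  "mat_trace A = (\<Sum>i<dim_row A. A $$ (i, i))"

text \<open>\<open>proots (char_poly A)\<close> lists the real eigenvalues with algebraic multiplicity; a real
  symmetric matrix of dimension \<open>n\<close> has \<open>n\<close> of them.\<close>

definition esd :: "real mat \<Rightarrow> real \<Rightarrow> real" where
  "esd A x = real (size (filter_mset (\<lambda>ev. ev \<le> x) (proots (char_poly A)))) / real (dim_row A)"

text \<open>The letters a, b, c, ... are 0, 1, 2, ...; at each position the letter either occurs earlier
  or is the first letter not used so far.\<close>

definition is_word :: "nat list \<Rightarrow> bool" where
  "is_word w \<longleftrightarrow>
     (\<forall>i<length w. w ! i \<in> set (take i w) \<or> w ! i = card (set (take i w)))"

definition pair_matched_words :: "nat \<Rightarrow> nat list set" where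
  "pair_matched_words l =
     {w. is_word w \<and> length w = l \<and> (\<forall>a\<in>set w. count_list w a = 2)}"

definition circuits :: "nat \<Rightarrow> nat \<Rightarrow> (nat \<Rightarrow> nat) set" where
  "circuits n l = {\<pi> \<in> {0..l} \<rightarrow>\<^sub>E {1..n}. \<pi> 0 = \<pi> l}"

text \<open>The \<open>i\<close>th letter of \<open>w\<close>, counted from 1, is \<open>w ! (i - 1)\<close>.\<close>

definition word_circuits ::
  "(nat \<Rightarrow> nat \<Rightarrow> nat \<Rightarrow> nat list) \<Rightarrow> nat \<Rightarrow> nat list \<Rightarrow> (nat \<Rightarrow> nat) set" where
  "word_circuits L n w = {\<pi> \<in> circuits n (length w).
     \<forall>i\<in>{1..length w}. \<forall>j\<in>{1..length w}.
       w ! (i - 1) = w ! (j - 1) \<longleftrightarrow> L n (\<pi> (i - 1)) (\<pi> i) = L n (\<pi> (j - 1)) (\<pi> j)}"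

definition word_ratio :: "(nat \<Rightarrow> nat \<Rightarrow> nat \<Rightarrow> nat list) \<Rightarrow> nat \<Rightarrow> nat list \<Rightarrow> nat \<Rightarrow> real" where
  "word_ratio L m w n = real (card (word_circuits L n w)) / real n ^ (1 + m)"

definition has_moment :: "real measure \<Rightarrow> nat \<Rightarrow> real \<Rightarrow> bool" where
  "has_moment \<mu> k c \<longleftrightarrow> integrable \<mu> (\<lambda>x. x ^ k) \<and> (LINT x|\<mu>. x ^ k) = c"

definition limit_law :: "(nat \<Rightarrow> nat \<Rightarrow> nat \<Rightarrow> nat list) \<Rightarrow> real \<Rightarrow> real measure \<Rightarrow> bool" where
  "limit_law L t \<mu> \<longleftrightarrow> real_distribution \<mu> \<and>
     (\<forall>k. odd k \<longrightarrow> has_moment \<mu> k 0) \<and>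
     (\<forall>m\<ge>1. has_moment \<mu> (2 * m)
        (t ^ m * (\<Sum>w\<in>pair_matched_words (2 * m). lim (word_ratio L m w))))"

end

theory Submission
  imports Defs "Jordan_Normal_Form.Schur_Decomposition"
begin

text \<open>The trace of the \<open>l\<close>th power of the matrix is a sum over circuits of products of independent
  centred walks, and a product in which some letter occurs exactly once has expectation zero. By
  Property B a circuit with \<open>u\<close> distinct letters allows for at most \<open>O(n^(u + 1))\<close> choices, so in the
  mean only the circuits in which every letter occurs exactly twice survive, and these are classified
  by the pair-matched words.

  A product of four centred products has nonzero expectation only if every letter occurs at least twice
  and every circuit shares a letter with another one. Run through the four circuits in some order: an
  edge whose letter is new and unique in its circuit can be traversed last and then costs no free
  choice. In one of the two orders \<open>1, 2, 3, 4\<close> and \<open>4, 3, 2, 1\<close> this saves enough to leave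
  \<open>O(n^(2 l + 2))\<close> quadruples of circuits, which gives the bound \<open>O(n^(-2))\<close>. Since it is summable, the
  traces converge almost surely.

  The limit moments satisfy \<open>c (2 m) \<le> (2 m)! K^m / m!\<close>, whence the Taylor expansion of the
  characteristic function converges on the whole real line; so the moments determine the law, and
  convergence of moments implies weak convergence.\<close>

subsection \<open>The method of moments\<close>

text \<open>Why two orders: a labelling of a quadruple with \<open>u\<close> letters and
  \<open>s\<close> savings is realized by \<open>O(n^(4 + u - s))\<close> quadruples. If every
  letter occurs exactly twice, then \<open>u = 2 l\<close>, and \<open>s >= 2\<close> is required.
  Suppose that circuit 1 shares one letter with each of the circuits 2, 3, 4, while all other
  letters are paired inside one circuit. Then the order \<open>1, 2, 3, 4\<close> saves only once,
  the reversed order three times. Only the sum of the savings of both orders has a lower bound;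
  where it is small, letters occurring more than twice make up for it by reducing \<open>u\<close>.

  One constant serves all times: the counting constants depend on \<open>l\<close> and Property B
  alone, and a walk enters only through moments that scale as powers of \<open>sqrt (n t)\<close>.

  The limit law is not constructed from its moments. It appears as a weak limit of spectral
  distributions at a single sample point where all traces converge.\<close>

definition clamp :: "real \<Rightarrow> real \<Rightarrow> real" where
  "clamp T x = max (- T) (min T x)"

lemma abs_clamp_le: "0 \<le> T \<Longrightarrow> \<bar>clamp T x\<bar> \<le> T" "0 \<le> T \<Longrightarrow> \<bar>clamp T x\<bar> \<le> \<bar>x\<bar>"
  by (auto simp: clamp_def)

lemma clamp_measurable [measurable]: "clamp T \<in> borel_measurable borel"
  unfolding clamp_def by measurable

lemma isCont_clamp_power: "isCont (\<lambda>x. clamp T x ^ k) x"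
  unfolding clamp_def by (intro continuous_intros)

text \<open>Truncation acts only where \<open>abs x > T\<close>; there
  \<open>(abs x / T) ^ k\<close> is at least one and turns an error of order
  \<open>abs x ^ k\<close> into a \<open>2 k\<close>th power over \<open>T ^ k\<close>.\<close>

lemma abs_power_diff_clamp_le:
  assumes "0 < T"
  shows "\<bar>x ^ k - clamp T x ^ k\<bar> \<le> 2 / T ^ k * x ^ (2 * k)"
proof (cases "\<bar>x\<bar> \<le> T")
  case True
  then have "clamp T x = x" by (auto simp: clamp_def)
  then show ?thesis using assms by (simp add: power_mult)
next
  case False
  have "\<bar>x ^ k - clamp T x ^ k\<bar> \<le> \<bar>x\<bar> ^ k + \<bar>clamp T x\<bar> ^ k"
    by (metis abs_triangle_ineq4 power_abs)
  also have "\<dots> \<le> 2 * \<bar>x\<bar> ^ k"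
    using power_mono[OF abs_clamp_le(2)[of T x], of k] assms by simp
  also have "\<dots> \<le> 2 * \<bar>x\<bar> ^ k * (\<bar>x\<bar> ^ k / T ^ k)"
    using power_mono[of T "\<bar>x\<bar>" k] False assms by (simp add: divide_simps mult_left_mono)
  also have "\<dots> = 2 / T ^ k * x ^ (2 * k)"
  proof -
    have "\<bar>x\<bar> ^ k * \<bar>x\<bar> ^ k = x ^ (2 * k)"
      by (metis power_mult_distrib abs_mult_self_eq power2_eq_square power_mult)
    then show ?thesis by (simp add: field_simps)
  qed
  finally show ?thesis .
qed

context real_distribution
begin

lemma integrable_clamp_power: "0 \<le> T \<Longrightarrow> integrable M (\<lambda>x. clamp T x ^ k)"
  by (rule integrable_const_bound[where B = "T ^ k"])
    (auto simp: power_abs intro!: power_mono abs_clamp_le AE_I2)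

lemma integrable_power_if_even:
  assumes "integrable M (\<lambda>x. x ^ (2 * k))"
  shows "integrable M (\<lambda>x. x ^ k)"
proof (rule Bochner_Integration.integrable_bound)
  show "integrable M (\<lambda>x. 1 + x ^ (2 * k))" using assms by simp
  show "AE x in M. norm (x ^ k) \<le> norm (1 + x ^ (2 * k))"
  proof (rule AE_I2)
    fix x :: real
    have "\<bar>x ^ k\<bar> \<le> 1 + (x ^ k) ^ 2"
      using zero_le_power2[of "\<bar>x ^ k\<bar> - 1"] unfolding power2_diff power2_abs by simp
    moreover have "(x ^ k)\<^sup>2 = x ^ (2 * k)" by (simp add: power_mult[symmetric] mult.commute)
    ultimately have "\<bar>x ^ k\<bar> \<le> 1 + x ^ (2 * k)" by simp
    then show "norm (x ^ k) \<le> norm (1 + x ^ (2 * k))" unfolding real_norm_def by linarith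
  qed
qed simp

text \<open>The bound depends on the law only through its \<open>2 k\<close>th moment, so it is
  uniform along a sequence with bounded moments. This permits letting \<open>n\<close> tend to
  infinity before \<open>T\<close>.\<close>

lemma moment_clamp_error:
  assumes "0 < T" "integrable M (\<lambda>x. x ^ (2 * k))"
  shows "\<bar>expectation (\<lambda>x. x ^ k) - expectation (\<lambda>x. clamp T x ^ k)\<bar>
    \<le> 2 / T ^ k * expectation (\<lambda>x. x ^ (2 * k))"
proof -
  have "\<bar>expectation (\<lambda>x. x ^ k) - expectation (\<lambda>x. clamp T x ^ k)\<bar>
    = \<bar>expectation (\<lambda>x. x ^ k - clamp T x ^ k)\<bar>"
    using integrable_power_if_even[OF assms(2)] integrable_clamp_power[of T k] assms(1) by simp
  also have "\<dots> \<le> expectation (\<lambda>x. \<bar>x ^ k - clamp T x ^ k\<bar>)"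
    by (rule integral_abs_bound)
  also have "\<dots> \<le> expectation (\<lambda>x. 2 / T ^ k * x ^ (2 * k))"
    using integrable_power_if_even[OF assms(2)] integrable_clamp_power[of T k] assms
    by (intro integral_mono abs_power_diff_clamp_le integrable_abs
         Bochner_Integration.integrable_diff integrable_mult_right) auto
  finally show ?thesis by simp
qed

end

text \<open>Weak convergence handles only bounded continuous test functions, so powers are truncated
  first. The truncated even moments of the limit stay below \<open>c (2 * k)\<close>, whence the
  even moments are finite by monotone convergence; domination gives the other ones. The truncation
  error is then removed by letting \<open>T\<close> grow.\<close>

lemma moments_of_weak_limit:
  assumes \<mu>: "\<And>n. real_distribution (\<mu> n)" and M: "real_distribution M"
    and conv: "weak_conv_m \<mu> M"
    and int: "\<And>n k. integrable (\<mu> n) (\<lambda>x. x ^ k)"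
    and lim: "\<And>k. (\<lambda>n. LINT x|\<mu> n. x ^ k) \<longlonglongrightarrow> c k"
  shows "has_moment M k (c k)"
proof -
  interpret \<mu>: real_distribution "\<mu> n" for n by (rule \<mu>)
  interpret M: real_distribution M by (rule M)
  have clamp_lim: "(\<lambda>n. LINT x|\<mu> n. clamp T x ^ k) \<longlonglongrightarrow> (LINT x|M. clamp T x ^ k)"
    if "0 \<le> T" for T k
    using \<mu> M conv isCont_clamp_power
    by (rule weak_conv_imp_integral_bdd_continuous_conv[where B = "T ^ k"])
      (use that in \<open>auto simp: power_abs intro!: power_mono abs_clamp_le\<close>)
  have mono_pt: "clamp (real i) x ^ (2 * k) \<le> clamp (real j) x ^ (2 * k)" if "i \<le> j" for i j k and x :: real
  proof -
    have "\<bar>clamp (real i) x\<bar> ^ (2 * k) \<le> \<bar>clamp (real j) x\<bar> ^ (2 * k)"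
      using that by (intro power_mono) (auto simp: clamp_def)
    then show ?thesis by (simp only: power_even_abs even_mult_iff even_numeral simp_thms)
  qed
  have le_pt: "clamp T x ^ (2 * k) \<le> x ^ (2 * k)" if "0 \<le> T" for T k and x :: real
    using power_mono[OF abs_clamp_le(2)[OF that, of x], of "2 * k"]
    by (simp only: power_even_abs even_mult_iff even_numeral simp_thms)
  have even_int: "integrable M (\<lambda>x. x ^ (2 * k))" for k
  proof -
    let ?a = "\<lambda>i. LINT x|M. clamp (real i) x ^ (2 * k)"
    have "?a i \<le> c (2 * k)" for i
      using clamp_lim[of "real i" "2 * k"] lim[of "2 * k"]
      by (rule LIMSEQ_le) (auto intro!: exI[of _ 0] integral_mono \<mu>.integrable_clamp_power int le_pt)
    moreover have "incseq ?a"
      by (auto simp: incseq_def intro!: integral_mono M.integrable_clamp_power mono_pt)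
    ultimately obtain l where l: "?a \<longlonglongrightarrow> l"
      using incseq_convergent[of ?a "c (2 * k)"] by blast
    show ?thesis
    proof (rule integrable_monotone_convergence[OF _ _ _ l])
      show "AE x in M. (\<lambda>i. clamp (real i) x ^ (2 * k)) \<longlonglongrightarrow> x ^ (2 * k)"
      proof (rule AE_I2)
        fix x
        have "\<forall>\<^sub>F i in sequentially. clamp (real i) x ^ (2 * k) = x ^ (2 * k)"
        proof (rule eventually_sequentiallyI[of "nat \<lceil>\<bar>x\<bar>\<rceil>"])
          fix i assume "nat \<lceil>\<bar>x\<bar>\<rceil> \<le> i"
          then have "\<bar>x\<bar> \<le> real i" by linarith
          then have "clamp (real i) x = x" by (auto simp: clamp_def)
          then show "clamp (real i) x ^ (2 * k) = x ^ (2 * k)" by simp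
        qed
        then show "(\<lambda>i. clamp (real i) x ^ (2 * k)) \<longlonglongrightarrow> x ^ (2 * k)"
          by (rule tendsto_eventually)
      qed
    qed (auto simp: mono_def intro!: M.integrable_clamp_power mono_pt)
  qed
  have k_int: "integrable M (\<lambda>x. x ^ k)" for k
    using even_int by (rule M.integrable_power_if_even)
  have "(LINT x|M. x ^ k) = c k"
  \<comment> \<open>The error bound \<open>?D / T ^ k\<close> below vanishes for large
    \<open>T\<close> only if \<open>k > 0\<close>.\<close>
  proof (cases "k = 0")
    case True
    have "(\<lambda>n. LINT x|\<mu> n. x ^ 0) = (\<lambda>n. 1)" using \<mu>.prob_space by simp
    then have "c 0 = 1" using lim[of 0] LIMSEQ_unique[OF tendsto_const[of 1]] by auto
    with True show ?thesis using M.prob_space by simp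
  next
    case False
    let ?D = "2 * (LINT x|M. x ^ (2 * k)) + 2 * c (2 * k)"
    have bound: "\<bar>(LINT x|M. x ^ k) - c k\<bar> \<le> ?D / T ^ k" if T: "0 < T" for T
    proof -
      have 1: "\<bar>(LINT x|M. x ^ k) - (LINT x|M. clamp T x ^ k)\<bar> \<le> 2 / T ^ k * (LINT x|M. x ^ (2 * k))"
        by (rule M.moment_clamp_error[OF T even_int])
      have 2: "\<bar>c k - (LINT x|M. clamp T x ^ k)\<bar> \<le> 2 / T ^ k * c (2 * k)"
      proof (rule LIMSEQ_le)
        show "(\<lambda>n. \<bar>(LINT x|\<mu> n. x ^ k) - (LINT x|\<mu> n. clamp T x ^ k)\<bar>)
          \<longlonglongrightarrow> \<bar>c k - (LINT x|M. clamp T x ^ k)\<bar>"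
          using T by (intro tendsto_intros lim clamp_lim) auto
        show "(\<lambda>n. 2 / T ^ k * (LINT x|\<mu> n. x ^ (2 * k))) \<longlonglongrightarrow> 2 / T ^ k * c (2 * k)"
          by (intro tendsto_intros lim)
      qed (use \<mu>.moment_clamp_error[OF T int] in blast)
      have "\<bar>(LINT x|M. x ^ k) - c k\<bar> \<le> 2 / T ^ k * (LINT x|M. x ^ (2 * k)) + 2 / T ^ k * c (2 * k)"
        using 1 2 by linarith
      then show ?thesis by (simp add: add_divide_distrib)
    qed
    have "\<bar>(LINT x|M. x ^ k) - c k\<bar> \<le> 0"
    proof (rule tendsto_lowerbound[where F = sequentially])
      show "(\<lambda>n. ?D / real (Suc n) ^ k) \<longlonglongrightarrow> 0"
        using False
        by (intro real_tendsto_divide_at_top tendsto_const filterlim_pow_at_top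
            filterlim_compose[OF filterlim_real_sequentially filterlim_Suc]) auto
      show "\<forall>\<^sub>F n in sequentially. \<bar>(LINT x|M. x ^ k) - c k\<bar> \<le> ?D / real (Suc n) ^ k"
        by (intro always_eventually allI bound) simp
    qed simp
    then show ?thesis by simp
  qed
  with k_int show ?thesis by (simp add: has_moment_def)
qed

text \<open>The growth condition is shaped to cancel the \<open>fact (2 * m)\<close> in the Taylor
  remainder of the characteristic function. What remains is a term of the exponential series at
  \<open>t\<^sup>2 * K\<close>, which tends to 0 for every \<open>t\<close>.\<close>

lemma real_distribution_eq_if_moments_eq:
  assumes M1: "real_distribution M1" and M2: "real_distribution M2"
    and m1: "\<And>k. has_moment M1 k (c k)" and m2: "\<And>k. has_moment M2 k (c k)"
    and growth: "\<And>m. c (2 * m) \<le> fact (2 * m) / fact m * K ^ m"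
  shows "M1 = M2"
proof (rule Levy_uniqueness[OF M1 M2], rule ext)
  fix t :: real
  \<comment> \<open>Only even orders are used: the remainder contains the absolute moment of the
    last order, which is one of the \<open>c k\<close> for even order.\<close>
  let ?s = "\<lambda>m. \<Sum>k\<le>2 * m. (\<i> * complex_of_real t) ^ k / fact k * complex_of_real (c k)"
  have "?s \<longlonglongrightarrow> char M t" if M: "real_distribution M" and m: "\<And>k. has_moment M k (c k)" for M
  proof -
    interpret real_distribution M by (rule M)
    have mom: "integrable M (\<lambda>x. x ^ k)" "expectation (\<lambda>x. x ^ k) = c k" for k
      using m[of k] by (auto simp: has_moment_def)
    have "cmod (char M t - ?s m) \<le> 2 * ((t\<^sup>2 * K) ^ m / fact m)" for m
    proof -
      have "cmod (char M t - ?s m) \<le> 2 * \<bar>t\<bar> ^ (2 * m) / fact (2 * m) * expectation (\<lambda>x. \<bar>x\<bar> ^ (2 * m))"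
        using char_approx1[of "2 * m" t] mom by simp
      also have "expectation (\<lambda>x. \<bar>x\<bar> ^ (2 * m)) = c (2 * m)"
        by (simp add: mom power_even_abs)
      also have "2 * \<bar>t\<bar> ^ (2 * m) / fact (2 * m) * c (2 * m)
        \<le> 2 * \<bar>t\<bar> ^ (2 * m) / fact (2 * m) * (fact (2 * m) / fact m * K ^ m)"
        by (intro mult_left_mono growth) auto
      also have "\<dots> = 2 * ((t\<^sup>2 * K) ^ m / fact m)"
        by (simp add: power_mult power_mult_distrib)
      finally show ?thesis .
    qed
    moreover have "(\<lambda>m. 2 * ((t\<^sup>2 * K) ^ m / fact m)) \<longlonglongrightarrow> 0"
      using tendsto_mult_right_zero[OF summable_LIMSEQ_zero[OF summable_exp[of "t\<^sup>2 * K"]], of 2]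
      unfolding divide_inverse by (simp only: mult.commute[of "inverse _"])
    ultimately have "(\<lambda>m. char M t - ?s m) \<longlonglongrightarrow> 0"
      by (rule Lim_null_comparison[OF always_eventually[OF allI]])
    from tendsto_diff[OF tendsto_const[of "char M t"] this] show ?thesis by simp
  qed
  from this[OF M1 m1] this[OF M2 m2] show "char M1 t = char M2 t"
    by (rule LIMSEQ_unique)
qed

lemma tight_if_bounded_second_moments:
  assumes \<mu>: "\<And>n. real_distribution (\<mu> n)"
    and int: "\<And>n. integrable (\<mu> n) (\<lambda>x. x ^ 2)" and bdd: "\<And>n. (LINT x|\<mu> n. x ^ 2) \<le> B"
  shows "tight \<mu>"
  unfolding tight_def
proof (intro conjI allI impI \<mu>)
  fix \<epsilon> :: real assume \<epsilon>: "0 < \<epsilon>"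
  interpret \<mu>: real_distribution "\<mu> n" for n by (rule \<mu>)
  \<comment> \<open>The summand 1 in \<open>\<bar>B\<bar> + 1\<close> makes Chebyshev's bound
    \<open>B / T\<^sup>2\<close> strictly smaller than \<open>\<epsilon>\<close>.\<close>
  define T where "T = sqrt ((\<bar>B\<bar> + 1) / \<epsilon>) + 1"
  have T: "0 < T" unfolding T_def using \<epsilon> by (intro add_nonneg_pos) auto
  have T2: "B / T\<^sup>2 < \<epsilon>"
  proof -
    have "(sqrt ((\<bar>B\<bar> + 1) / \<epsilon>))\<^sup>2 \<le> T\<^sup>2" unfolding T_def using \<epsilon> by (intro power_mono) auto
    then have "(\<bar>B\<bar> + 1) / \<epsilon> \<le> T\<^sup>2" using \<epsilon> by simp
    then have "\<bar>B\<bar> + 1 \<le> T\<^sup>2 * \<epsilon>" using \<epsilon> by (simp add: field_simps)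
    then have "B < \<epsilon> * T\<^sup>2" by (simp add: mult.commute)
    then show ?thesis using T by (simp add: divide_simps)
  qed
  have "measure (\<mu> n) {-T<..T} > 1 - \<epsilon>" for n
  proof -
    have "measure (\<mu> n) {x \<in> space (\<mu> n). x\<^sup>2 \<ge> T\<^sup>2} \<le> (LINT x|\<mu> n. x ^ 2) / T\<^sup>2"
      using int T by (intro integral_Markov_inequality_measure[where A = "{}"]) auto
    also have "\<dots> \<le> B / T\<^sup>2" using bdd by (intro divide_right_mono) auto
    also note T2
    finally have small: "measure (\<mu> n) {x. x\<^sup>2 \<ge> T\<^sup>2} < \<epsilon>" by simp
    have "UNIV = {-T<..T} \<union> {x::real. x\<^sup>2 \<ge> T\<^sup>2}"
      using T by (auto simp: abs_le_square_iff[symmetric])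
    then have "1 = measure (\<mu> n) ({-T<..T} \<union> {x::real. x\<^sup>2 \<ge> T\<^sup>2})"
      using \<mu>.prob_space by simp
    also have "\<dots> \<le> measure (\<mu> n) {-T<..T} + measure (\<mu> n) {x. x\<^sup>2 \<ge> T\<^sup>2}"
      by (intro measure_Un_le) auto
    finally show ?thesis using small by linarith
  qed
  moreover have "-T < T" using T by simp
  ultimately show "\<exists>a b. a < b \<and> (\<forall>n. measure (\<mu> n) {a<..b} > 1 - \<epsilon>)" by blast
qed

text \<open>Bounded second moments give tightness, and tightness a first subsequential limit
  \<open>\<nu>\<close>. Every other subsequential limit has the same moments and therefore equals
  \<open>\<nu>\<close>, so the whole sequence converges. The limit need not be known
  beforehand.\<close>

theorem method_of_moments:
  assumes \<mu>: "\<And>n. real_distribution (\<mu> n)"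
    and int: "\<And>n k. integrable (\<mu> n) (\<lambda>x. x ^ k)"
    and lim: "\<And>k. (\<lambda>n. LINT x|\<mu> n. x ^ k) \<longlonglongrightarrow> c k"
    and growth: "\<And>m. c (2 * m) \<le> fact (2 * m) / fact m * K ^ m"
  shows "\<exists>\<nu>. real_distribution \<nu> \<and> (\<forall>k. has_moment \<nu> k (c k)) \<and> weak_conv_m \<mu> \<nu>"
proof -
  have "Bseq (\<lambda>n. LINT x|\<mu> n. x ^ 2)" using lim[of 2] by (intro convergent_imp_Bseq) (auto simp: convergent_def)
  then obtain B where "\<And>n. \<bar>LINT x|\<mu> n. x ^ 2\<bar> \<le> B" by (auto simp: Bseq_def)
  then have tight: "tight \<mu>"
    by (intro tight_if_bounded_second_moments[where B = B] \<mu> int) (metis abs_le_D1)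
  have sub: "has_moment \<nu> k (c k)"
    if "strict_mono s" "real_distribution \<nu>" "weak_conv_m (\<mu> \<circ> s) \<nu>" for s \<nu> k
    using that \<mu> int LIMSEQ_subseq_LIMSEQ[OF lim \<open>strict_mono s\<close>]
    by (intro moments_of_weak_limit[of "\<mu> \<circ> s"]) (auto simp: o_def)
  obtain r \<nu> where r: "strict_mono r" and \<nu>: "real_distribution \<nu>" "weak_conv_m (\<mu> \<circ> id \<circ> r) \<nu>"
    using tight_imp_convergent_subsubsequence[OF tight strict_mono_id] by blast
  have \<nu>_mom: "has_moment \<nu> k (c k)" for k
    using sub[OF r] \<nu> by simp
  have "weak_conv_m \<mu> \<nu>"
  proof (rule tight_subseq_weak_converge[OF \<mu> \<nu>(1) tight])
    fix s \<nu>' assume s: "strict_mono s" "real_distribution \<nu>'" "weak_conv_m (\<mu> \<circ> s) \<nu>'"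
    have "\<nu>' = \<nu>"
      using s(2) \<nu>(1) sub[OF s] \<nu>_mom growth by (rule real_distribution_eq_if_moments_eq)
    with s(3) show "weak_conv_m (\<mu> \<circ> s) \<nu>" by simp
  qed
  with \<nu>(1) \<nu>_mom show ?thesis by blast
qed

subsection \<open>Traces of powers of a real symmetric matrix\<close>

text \<open>For an eigenvector \<open>v\<close> the sesquilinear form \<open>q\<close> is invariant
  under conjugation by symmetry of \<open>A\<close>, and it equals \<open>a\<close> times the
  positive real number \<open>s\<close>.\<close>

lemma real_eigenvalue_if_real_symmetric:
  fixes A :: "real mat"
  assumes A: "A \<in> carrier_mat n n" and sym: "\<And>i j. i < n \<Longrightarrow> j < n \<Longrightarrow> A $$ (i, j) = A $$ (j, i)"
    and ev: "eigenvalue (map_mat complex_of_real A) a"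
  shows "a \<in> \<real>"
proof -
  let ?A = "map_mat complex_of_real A"
  obtain v where v: "v \<in> carrier_vec n" "v \<noteq> 0\<^sub>v n" "?A *\<^sub>v v = a \<cdot>\<^sub>v v"
    using ev A unfolding eigenvalue_def eigenvector_def by auto
  have Av: "(\<Sum>j<n. of_real (A $$ (i, j)) * v $ j) = a * v $ i" if "i < n" for i
  proof -
    have "(?A *\<^sub>v v) $ i = a * v $ i" using v that by simp
    then show ?thesis
      using that A v(1) by (simp add: scalar_prod_def lessThan_atLeast0)
  qed
  define s where "s = (\<Sum>i<n. cnj (v $ i) * v $ i)"
  define q where "q = (\<Sum>i<n. \<Sum>j<n. cnj (v $ i) * (of_real (A $$ (i, j)) * v $ j))"
  have "cnj q = (\<Sum>i<n. \<Sum>j<n. v $ i * (of_real (A $$ (i, j)) * cnj (v $ j)))"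
    by (simp add: q_def)
  also have "\<dots> = (\<Sum>j<n. \<Sum>i<n. v $ i * (of_real (A $$ (i, j)) * cnj (v $ j)))"
    by (rule sum.swap)
  also have "\<dots> = q"
    unfolding q_def by (intro sum.cong refl) (simp add: sym mult_ac)
  finally have "q \<in> \<real>" by (simp add: Reals_cnj_iff)
  moreover have "q = a * s"
  proof -
    have "q = (\<Sum>i<n. cnj (v $ i) * (a * v $ i))"
      unfolding q_def sum_distrib_left[symmetric] by (intro sum.cong refl) (simp add: Av)
    then show ?thesis unfolding s_def by (simp add: sum_distrib_left mult_ac)
  qed
  moreover have s: "s = of_real (\<Sum>i<n. (cmod (v $ i))\<^sup>2)"
    by (simp add: s_def complex_norm_square mult.commute del: of_real_power)
  moreover have "(\<Sum>i<n. (cmod (v $ i))\<^sup>2) \<noteq> 0"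
    using v(1,2) by (auto simp: sum_nonneg_eq_0_iff intro!: eq_vecI)
  ultimately show ?thesis
    by (metis Reals_divide Reals_of_real nonzero_mult_div_cancel_right of_real_eq_0_iff)
qed

text \<open>The characteristic polynomial splits over the complex numbers with real roots only;
  injectivity of the embedding of real polynomials carries the factorization back.\<close>

lemma real_symmetric_char_poly_splits:
  fixes A :: "real mat"
  assumes A: "A \<in> carrier_mat n n" and sym: "\<And>i j. i < n \<Longrightarrow> j < n \<Longrightarrow> A $$ (i, j) = A $$ (j, i)"
  shows "\<exists>es. char_poly A = (\<Prod>e\<leftarrow>es. [:- e, 1:]) \<and> length es = n"
proof -
  let ?A = "map_mat complex_of_real A"
  have Ac: "?A \<in> carrier_mat n n" using A by simp
  from char_poly_factorized[OF Ac]
  obtain as where as: "char_poly ?A = (\<Prod>a\<leftarrow>as. [:- a, 1:])" "length as = n" by blast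
  have "a \<in> \<real>" if "a \<in> set as" for a
  proof -
    have "poly (char_poly ?A) a = 0"
      using that by (auto simp: as poly_prod_list prod_list_zero_iff image_iff intro!: bexI[of _ a])
    then show ?thesis
      using eigenvalue_root_char_poly[OF Ac] real_eigenvalue_if_real_symmetric[OF A sym] by blast
  qed
  then have as_Re: "as = map complex_of_real (map Re as)"
    by (simp add: map_idI)
  have "map_poly complex_of_real (char_poly A) = map_poly complex_of_real (\<Prod>e\<leftarrow>map Re as. [:- e, 1:])"
  proof -
    have "map_poly complex_of_real (char_poly A) = char_poly ?A"
      by (rule of_real_hom.char_poly_hom[OF A, symmetric])
    also have "\<dots> = (\<Prod>a\<leftarrow>map complex_of_real (map Re as). [:- a, 1:])"
      using as as_Re by metis
    also have "\<dots> = map_poly complex_of_real (\<Prod>e\<leftarrow>map Re as. [:- e, 1:])"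
    proof -
      interpret h: map_poly_inj_idom_hom complex_of_real ..
      show ?thesis by (simp add: h.hom_prod_list o_def)
    qed
    finally show ?thesis .
  qed
  then have "char_poly A = (\<Prod>e\<leftarrow>map Re as. [:- e, 1:])"
  proof -
    interpret h: map_poly_inj_idom_hom complex_of_real ..
    assume "map_poly complex_of_real (char_poly A) = map_poly complex_of_real (\<Prod>e\<leftarrow>map Re as. [:- e, 1:])"
    then show ?thesis by (rule h.injectivity)
  qed
  with as(2) show ?thesis by (intro exI[of _ "map Re as"]) simp
qed

lemma upper_triangular_pow:
  fixes B :: "real mat"
  assumes B: "B \<in> carrier_mat n n" and ut: "upper_triangular B"
  shows "upper_triangular (B ^\<^sub>m k) \<and> (\<forall>i<n. (B ^\<^sub>m k) $$ (i, i) = (B $$ (i, i)) ^ k)"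
proof (induction k)
  case 0
  then show ?case using B by simp
next
  case (Suc k)
  have Bk: "B ^\<^sub>m k \<in> carrier_mat n n" using B by simp
  have entry: "(B ^\<^sub>m Suc k) $$ (i, j) = (\<Sum>l\<in>{0..<n}. (B ^\<^sub>m k) $$ (i, l) * B $$ (l, j))"
    if "i < n" "j < n" for i j
    using that B Bk by (simp add: scalar_prod_def)
  \<comment> \<open>On and below the diagonal, triangularity of both factors leaves at most the
    summand \<open>l = i = j\<close>.\<close>
  have zero: "(B ^\<^sub>m k) $$ (i, l) * B $$ (l, j) = 0" if "i < n" "l < n" "j \<le> i" "l \<noteq> i \<or> j \<noteq> i" for i l j
  proof (cases "l < i")
    case True
    then show ?thesis using Suc.IH that Bk by (auto dest: upper_triangularD)
  next
    case False
    then have "j < l" using that by auto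
    then show ?thesis using ut that B by (auto dest: upper_triangularD)
  qed
  show ?case
  proof (intro conjI allI impI)
    show "upper_triangular (B ^\<^sub>m Suc k)"
    proof (rule upper_triangularI)
      fix i j assume "j < i" "i < dim_row (B ^\<^sub>m Suc k)"
      then have ij: "i < n" "j < n" "j \<le> i" "j \<noteq> i" using B by auto
      show "(B ^\<^sub>m Suc k) $$ (i, j) = 0"
        unfolding entry[OF ij(1,2)] using zero ij by (intro sum.neutral) auto
    qed
    fix i assume i: "i < n"
    have "(B ^\<^sub>m Suc k) $$ (i, i) = (\<Sum>l\<in>{i}. (B ^\<^sub>m k) $$ (i, l) * B $$ (l, i))"
      unfolding entry[OF i i] using i zero by (intro sum.mono_neutral_right) auto
    then show "(B ^\<^sub>m Suc k) $$ (i, i) = B $$ (i, i) ^ Suc k"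
      using Suc.IH i by simp
  qed
qed

lemma mat_trace_mult_commute:
  fixes A B :: "real mat"
  assumes "A \<in> carrier_mat n n" "B \<in> carrier_mat n n"
  shows "mat_trace (A * B) = mat_trace (B * A)"
proof -
  have "mat_trace (A * B) = (\<Sum>i<n. \<Sum>j<n. A $$ (i, j) * B $$ (j, i))"
    using assms by (simp add: mat_trace_def scalar_prod_def lessThan_atLeast0)
  also have "\<dots> = (\<Sum>j<n. \<Sum>i<n. A $$ (i, j) * B $$ (j, i))" by (rule sum.swap)
  also have "\<dots> = mat_trace (B * A)"
    using assms by (simp add: mat_trace_def scalar_prod_def lessThan_atLeast0 mult.commute)
  finally show ?thesis .
qed

text \<open>In Schur form the \<open>k\<close>th power has the \<open>k\<close>th powers of the
  eigenvalues on its diagonal, and the trace is invariant under similarity.\<close>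

lemma mat_trace_pow_eq_eigenvalue_sum:
  fixes A :: "real mat"
  assumes A: "A \<in> carrier_mat n n" and es: "char_poly A = (\<Prod>e\<leftarrow>es. [:- e, 1:])"
  shows "mat_trace (A ^\<^sub>m k) = (\<Sum>e\<leftarrow>es. e ^ k)"
proof -
  obtain B P Q where BPQ: "schur_decomposition A es = (B, P, Q)" by (cases "schur_decomposition A es")
  from schur_decomposition[OF A es this]
  have sim: "similar_mat_wit A B P Q" and ut: "upper_triangular B" and diag: "diag_mat B = es" by auto
  note wit = similar_mat_witD2[OF A sim]
  have B: "B \<in> carrier_mat n n" and P: "P \<in> carrier_mat n n" and Q: "Q \<in> carrier_mat n n"
    and QP: "Q * P = 1\<^sub>m n" using wit by auto
  have Bk: "B ^\<^sub>m k \<in> carrier_mat n n" using B by simp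
  have "mat_trace (A ^\<^sub>m k) = mat_trace (P * B ^\<^sub>m k * Q)"
    using similar_mat_wit_pow_id[OF sim] by simp
  also have "\<dots> = mat_trace (Q * (P * B ^\<^sub>m k))"
    using P Q Bk by (intro mat_trace_mult_commute) auto
  also have "Q * (P * B ^\<^sub>m k) = B ^\<^sub>m k"
    using assoc_mult_mat[OF Q P Bk] QP left_mult_one_mat[OF Bk] by metis
  also have "mat_trace (B ^\<^sub>m k) = (\<Sum>i<n. (B $$ (i, i)) ^ k)"
    using upper_triangular_pow[OF B ut, of k] B by (simp add: mat_trace_def)
  also have "\<dots> = (\<Sum>e\<leftarrow>es. e ^ k)"
    using B by (simp add: diag[symmetric] diag_mat_def o_def interv_sum_list_conv_sum_set_nat lessThan_atLeast0)
  finally show ?thesis .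
qed

lemma proots_prod_list_linear:
  "proots (\<Prod>e\<leftarrow>es. [:- e, 1:]) = mset (es :: real list)"
proof (induction es)
  case (Cons e es)
  have "(\<Prod>e\<leftarrow>es. [:- e, 1:]) \<noteq> (0 :: real poly)" by (auto simp: prod_list_zero_iff)
  then have "proots ([:- e, 1:] * (\<Prod>e\<leftarrow>es. [:- e, 1:])) = proots [:- e, 1:] + proots (\<Prod>e\<leftarrow>es. [:- e, 1:])"
    by (intro proots_mult) auto
  then show ?case using Cons by (simp del: mult_pCons_left)
qed simp

text \<open>The bridge from matrices to the method of moments: traces of powers become moments of a
  law whose distribution function is \<open>esd A\<close>.\<close>

theorem real_symmetric_spectral_law:
  fixes A :: "real mat"
  assumes A: "A \<in> carrier_mat n n" and n: "0 < n"
    and sym: "\<And>i j. i < n \<Longrightarrow> j < n \<Longrightarrow> A $$ (i, j) = A $$ (j, i)"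
  shows "\<exists>\<mu>. real_distribution \<mu> \<and> cdf \<mu> = esd A
    \<and> (\<forall>k. has_moment \<mu> k (1 / real n * mat_trace (A ^\<^sub>m k)))"
proof -
  obtain es where es: "char_poly A = (\<Prod>e\<leftarrow>es. [:- e, 1:])" "length es = n"
    using real_symmetric_char_poly_splits[OF A sym] by blast
  let ?p = "measure_pmf (pmf_of_set {..<n})"
  have ne: "{..<n} \<noteq> {}" "finite {..<n}" using n by auto
  \<comment> \<open>The law of an eigenvalue with uniformly chosen index in the list; repeated
    eigenvalues thus receive their multiplicity.\<close>
  define \<mu> where "\<mu> = distr ?p borel (\<lambda>i. es ! i)"
  have rd: "real_distribution \<mu>"
    unfolding \<mu>_def by (intro prob_space.real_distribution_distr prob_space_measure_pmf) simp
  have "cdf \<mu> = esd A"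
  proof
    fix x
    have "cdf \<mu> x = measure ?p {i. es ! i \<le> x}"
      by (simp add: \<mu>_def cdf_def measure_distr vimage_def)
    also have "\<dots> = real (card {i. i < n \<and> es ! i \<le> x}) / real n"
      using ne by (simp add: measure_pmf_of_set) (auto intro!: arg_cong[where f = card])
    also have "\<dots> = esd A x"
      using A es by (simp add: esd_def proots_prod_list_linear length_filter_conv_card flip: mset_filter)
    finally show "cdf \<mu> x = esd A x" .
  qed
  moreover have "has_moment \<mu> k (1 / real n * mat_trace (A ^\<^sub>m k))" for k
  proof -
    have "integrable \<mu> (\<lambda>x. x ^ k)"
      unfolding \<mu>_def using ne
      by (subst integrable_distr_eq) (auto intro!: integrable_measure_pmf_finite simp: set_pmf_of_set[OF ne])
    moreover have "(LINT x|\<mu>. x ^ k) = (\<Sum>i<n. es ! i ^ k) / real n"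
      unfolding \<mu>_def using ne by (subst integral_distr) (auto simp: integral_pmf_of_set)
    moreover have "mat_trace (A ^\<^sub>m k) = (\<Sum>i<n. es ! i ^ k)"
      using es(2) by (simp add: mat_trace_pow_eq_eigenvalue_sum[OF A es(1)] sum_list_sum_nth lessThan_atLeast0)
    ultimately show ?thesis by (simp add: has_moment_def)
  qed
  ultimately show ?thesis using rd by blast
qed

section \<open>Powers of a matrix as sums over paths, traces as sums over circuits\<close>

abbreviation paths :: "nat \<Rightarrow> nat \<Rightarrow> (nat \<Rightarrow> nat) set" where
  "paths n m \<equiv> {0..m} \<rightarrow>\<^sub>E {1..n}"

lemma paths_Suc_eq: "bij_betw (\<lambda>(\<pi>, y). \<pi>(Suc m := y)) (paths n m \<times> {1..n}) (paths n (Suc m))"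
proof -
  have eq: "{0..Suc m} = insert (Suc m) {0..m}" by auto
  show ?thesis
  proof (rule bij_betw_byWitness[where f' = "\<lambda>\<pi>. (restrict \<pi> {0..m}, \<pi> (Suc m))"])
    show "\<forall>a\<in>paths n m \<times> {1..n}. (\<lambda>\<pi>. (restrict \<pi> {0..m}, \<pi> (Suc m))) ((\<lambda>(\<pi>, y). \<pi>(Suc m := y)) a) = a"
      by (auto simp: fun_eq_iff restrict_def PiE_def extensional_def)
    show "\<forall>a\<in>paths n (Suc m). (\<lambda>(\<pi>, y). \<pi>(Suc m := y)) (restrict a {0..m}, a (Suc m)) = a"
      unfolding eq by (auto simp: fun_eq_iff restrict_def PiE_def extensional_def)
    show "(\<lambda>(\<pi>, y). \<pi>(Suc m := y)) ` (paths n m \<times> {1..n}) \<subseteq> paths n (Suc m)"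
      unfolding eq by (force simp: PiE_def extensional_def Pi_def)
    show "(\<lambda>\<pi>. (restrict \<pi> {0..m}, \<pi> (Suc m))) ` paths n (Suc m) \<subseteq> paths n m \<times> {1..n}"
      by (auto simp: PiE_def Pi_def)
  qed
qed

lemma sum_paths_Suc: "sum f (paths n (Suc m)) = (\<Sum>\<pi>\<in>paths n m. \<Sum>y\<in>{1..n}. f (\<pi>(Suc m := y)))"
  unfolding sum.reindex_bij_betw[OF paths_Suc_eq, symmetric] sum.cartesian_product
  by (simp add: split_def)

text \<open>The end points are fixed by indicator factors instead of a smaller index set, so that
  every sum runs over all paths and \<open>sum_paths_Suc\<close> applies. The shifts by one
  reconcile vertices in \<open>{1..n}\<close> with matrix indices from 0.\<close>

lemma mat_pow_entry_eq_path_sum: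
  fixes A :: "real mat"
  assumes A: "A \<in> carrier_mat n n"
  shows "i < n \<Longrightarrow> j < n \<Longrightarrow> (A ^\<^sub>m m) $$ (i, j) = (\<Sum>\<pi>\<in>paths n m.
    of_bool (\<pi> 0 = Suc i) * of_bool (\<pi> m = Suc j) * (\<Prod>q=1..m. A $$ (\<pi> (q - 1) - 1, \<pi> q - 1)))"
proof (induction m arbitrary: j)
  case 0
  have "bij_betw (\<lambda>y. restrict (\<lambda>_. y) {0}) {1..n} (paths n 0)"
    by (rule bij_betw_byWitness[where f' = "\<lambda>\<pi>. \<pi> 0"])
      (auto simp: PiE_def extensional_def restrict_def fun_eq_iff)
  then have "(\<Sum>\<pi>\<in>paths n 0. of_bool (\<pi> 0 = Suc i) * of_bool (\<pi> 0 = Suc j))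
    = (\<Sum>y\<in>{1..n}. of_bool (y = Suc i) * of_bool (y = Suc j) :: real)"
    by (subst sum.reindex_bij_betw[symmetric]) auto
  also have "\<dots> = of_bool (i = j)"
    using 0 by (simp add: of_bool_def if_distrib[of "\<lambda>x. x * _"] cong: if_cong)
  finally show ?case using 0 A by simp
next
  case (Suc m)
  have Am: "A ^\<^sub>m m \<in> carrier_mat n n" using A by simp
  let ?P = "\<lambda>\<pi> m. \<Prod>q=1..m. A $$ (\<pi> (q - 1) - 1, \<pi> q - 1)"
  let ?f = "\<lambda>\<pi> k. of_bool (\<pi> 0 = Suc i) * of_bool (\<pi> m = Suc k) * ?P \<pi> m * A $$ (k, j)"
  let ?h = "\<lambda>\<pi> y. of_bool (\<pi> 0 = Suc i) * of_bool (y = Suc j) * (?P \<pi> m * A $$ (\<pi> m - 1, y - 1))"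
  have P: "?P (\<pi>(Suc m := y)) (Suc m) = ?P \<pi> m * A $$ (\<pi> m - 1, y - 1)" for \<pi> y
  proof -
    have "?P (\<pi>(Suc m := y)) m = ?P \<pi> m" by (intro prod.cong) auto
    then show ?thesis by (simp del: fun_upd_apply) simp
  qed
  have "(A ^\<^sub>m Suc m) $$ (i, j) = (\<Sum>k<n. (A ^\<^sub>m m) $$ (i, k) * A $$ (k, j))"
    using Suc.prems A Am by (simp add: scalar_prod_def lessThan_atLeast0)
  also have "\<dots> = (\<Sum>k<n. \<Sum>\<pi>\<in>paths n m. ?f \<pi> k)"
    using Suc by (simp add: sum_distrib_right)
  also have "\<dots> = (\<Sum>\<pi>\<in>paths n m. \<Sum>k<n. ?f \<pi> k)"
    by (rule sum.swap)
  also have "\<dots> = (\<Sum>\<pi>\<in>paths n m. of_bool (\<pi> 0 = Suc i) * ?P \<pi> m * A $$ (\<pi> m - 1, j))"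
  proof (rule sum.cong[OF refl])
    fix \<pi> assume "\<pi> \<in> paths n m"
    then have \<pi>: "\<pi> m \<in> {1..n}" by auto
    have "(\<Sum>k<n. ?f \<pi> k)
      = (\<Sum>k\<in>{\<pi> m - 1}. ?f \<pi> k)"
      using \<pi> by (intro sum.mono_neutral_right) auto
    then show "(\<Sum>k<n. ?f \<pi> k)
      = of_bool (\<pi> 0 = Suc i) * ?P \<pi> m * A $$ (\<pi> m - 1, j)" using \<pi> by simp
  qed
  also have "\<dots> = (\<Sum>\<pi>\<in>paths n m. \<Sum>y\<in>{1..n}. ?h \<pi> y)"
  proof (rule sum.cong[OF refl])
    fix \<pi>
    have "(\<Sum>y\<in>{1..n}. ?h \<pi> y)
      = (\<Sum>y\<in>{Suc j}. ?h \<pi> y)"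
      using Suc.prems by (intro sum.mono_neutral_right) auto
    then show "of_bool (\<pi> 0 = Suc i) * ?P \<pi> m * A $$ (\<pi> m - 1, j) =
      (\<Sum>y\<in>{1..n}. ?h \<pi> y)" by simp
  qed
  finally show ?case unfolding sum_paths_Suc P by (simp add: mult.assoc)
qed

theorem mat_trace_pow_eq_circuit_sum:
  fixes A :: "real mat"
  assumes A: "A \<in> carrier_mat n n"
  shows "mat_trace (A ^\<^sub>m l) = (\<Sum>\<pi>\<in>circuits n l. \<Prod>q=1..l. A $$ (\<pi> (q - 1) - 1, \<pi> q - 1))"
proof -
  let ?P = "\<lambda>\<pi>. \<Prod>q=1..l. A $$ (\<pi> (q - 1) - 1, \<pi> q - 1)"
  let ?f = "\<lambda>\<pi> i. of_bool (\<pi> 0 = Suc i) * of_bool (\<pi> l = Suc i) * ?P \<pi>"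
  have Al: "A ^\<^sub>m l \<in> carrier_mat n n" using A by simp
  have "mat_trace (A ^\<^sub>m l) = (\<Sum>i<n. \<Sum>\<pi>\<in>paths n l. ?f \<pi> i)"
    using A by (simp add: mat_trace_def mat_pow_entry_eq_path_sum[OF A])
  also have "\<dots> = (\<Sum>\<pi>\<in>paths n l. \<Sum>i<n. ?f \<pi> i)"
    by (rule sum.swap)
  also have "\<dots> = (\<Sum>\<pi>\<in>paths n l. if \<pi> 0 = \<pi> l then ?P \<pi> else 0)"
  proof (rule sum.cong[OF refl])
    fix \<pi> assume "\<pi> \<in> paths n l"
    then have \<pi>: "\<pi> 0 \<in> {1..n}" by auto
    have "(\<Sum>i<n. ?f \<pi> i)
      = (\<Sum>i\<in>{\<pi> 0 - 1}. ?f \<pi> i)"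
      using \<pi> by (intro sum.mono_neutral_right) auto
    then show "(\<Sum>i<n. ?f \<pi> i)
      = (if \<pi> 0 = \<pi> l then ?P \<pi> else 0)" using \<pi> by auto
  qed
  also have "\<dots> = (\<Sum>\<pi>\<in>circuits n l. ?P \<pi>)"
    unfolding circuits_def by (intro sum.inter_filter[symmetric] finite_PiE) auto
  finally show ?thesis .
qed

subsection \<open>Counting circuits with prescribed coincidences\<close>

text \<open>The link function at a fixed \<open>n\<close> is kept abstract as \<open>g\<close>; the
  counting uses it only through the bound in \<open>bounded_link\<close>.\<close>

definition edge_letter :: "(nat \<Rightarrow> nat \<Rightarrow> 'r) \<Rightarrow> (nat \<Rightarrow> nat) \<Rightarrow> nat \<Rightarrow> 'r" where
  "edge_letter g \<pi> q = g (\<pi> (q - 1)) (\<pi> q)"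

text \<open>The edges of \<open>\<pi>\<close> are labelled by \<open>w\<close>; the letters of the labels in \<open>K\<close>, which stem from
  circuits traversed earlier, are prescribed by \<open>\<rho>\<close>.\<close>

definition follows :: "(nat \<Rightarrow> nat \<Rightarrow> 'r) \<Rightarrow> nat \<Rightarrow> (nat \<Rightarrow> 'b) \<Rightarrow> 'b set \<Rightarrow> ('b \<Rightarrow> 'r) \<Rightarrow> (nat \<Rightarrow> nat) \<Rightarrow> bool" where
  "follows g m w K \<rho> \<pi> \<longleftrightarrow>
     (\<forall>q\<in>{1..m}. w q \<in> K \<longrightarrow> edge_letter g \<pi> q = \<rho> (w q)) \<and>
     (\<forall>q\<in>{1..m}. \<forall>q'\<in>{1..m}. w q = w q' \<longrightarrow> edge_letter g \<pi> q = edge_letter g \<pi> q')"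

abbreviation circuits_following where
  "circuits_following g n l w K \<rho> \<equiv> {\<pi> \<in> circuits n l. follows g l w K \<rho> \<pi>}"

lemma follows_restrict:
  assumes f: "follows g m w K \<rho> \<pi>" and "m' \<le> m" and eq: "\<And>i. i \<le> m' \<Longrightarrow> \<pi>' i = \<pi> i"
  shows "follows g m' w K \<rho> \<pi>'"
  unfolding follows_def
proof (intro conjI ballI impI)
  have init: "edge_letter g \<pi>' q = edge_letter g \<pi> q" "q \<in> {1..m}" if "q \<in> {1..m'}" for q
    using that \<open>m' \<le> m\<close> by (auto simp: edge_letter_def eq)
  fix q assume q: "q \<in> {1..m'}"
  show "edge_letter g \<pi>' q = \<rho> (w q)" if "w q \<in> K"
    unfolding init(1)[OF q] using f init(2)[OF q] that unfolding follows_def by blast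
  fix q' assume q': "q' \<in> {1..m'}" and "w q = w q'"
  then show "edge_letter g \<pi>' q = edge_letter g \<pi>' q'"
    unfolding init(1)[OF q] init(1)[OF q'] using f init(2)[OF q] init(2)[OF q']
    unfolding follows_def by blast
qed

lemma finite_paths: "finite (paths n m)"
  by (intro finite_PiE) auto

lemma finite_circuits: "finite (circuits n l)"
  unfolding circuits_def using finite_paths by simp

text \<open>The coincidences of \<open>h\<close> on \<open>E\<close> are encoded by choosing a
  representative in each class. Hence there are at most \<open>card E ^ card E\<close> patterns,
  whatever the range of \<open>h\<close>; in the applications to circuits this number does not
  depend on \<open>n\<close>.\<close>

lemma ex_pattern:
  assumes "finite E"
  shows "\<exists>lab \<in> E \<rightarrow>\<^sub>E E. \<forall>x\<in>E. \<forall>y\<in>E. lab x = lab y \<longleftrightarrow> h x = h y"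
proof -
  define lab where "lab = (\<lambda>x\<in>E. SOME y. y \<in> E \<and> h y = h x)"
  have lab: "lab x \<in> E \<and> h (lab x) = h x" if "x \<in> E" for x
  proof -
    have "(SOME y. y \<in> E \<and> h y = h x) \<in> E \<and> h (SOME y. y \<in> E \<and> h y = h x) = h x"
      by (rule someI_ex) (use that in blast)
    then show ?thesis using that by (simp add: lab_def)
  qed
  have "lab x = lab y \<longleftrightarrow> h x = h y" if "x \<in> E" "y \<in> E" for x y
  proof
    assume "lab x = lab y" then show "h x = h y" using lab that by metis
  next
    assume "h x = h y" then show "lab x = lab y" using that by (simp add: lab_def)
  qed
  moreover have "lab \<in> E \<rightarrow>\<^sub>E E" using lab by (auto simp: lab_def)
  ultimately show ?thesis by blast
qed

lemma card_le_pattern_union: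
  assumes E: "finite E" and P: "P \<subseteq> E \<rightarrow>\<^sub>E E" and F: "F \<subseteq> (\<Union>lab\<in>P. Q lab)"
    and Q: "\<And>lab. lab \<in> P \<Longrightarrow> finite (Q lab)" "\<And>lab. lab \<in> P \<Longrightarrow> card (Q lab) \<le> B"
  shows "card F \<le> card E ^ card E * B"
proof -
  have finE: "finite (E \<rightarrow>\<^sub>E E)" using E by (intro finite_PiE)
  then have finP: "finite P" using P by (rule rev_finite_subset)
  have "card F \<le> card (\<Union>lab\<in>P. Q lab)" using F finP Q(1) by (intro card_mono finite_UN_I)
  also have "\<dots> \<le> (\<Sum>lab\<in>P. card (Q lab))" using finP by (rule card_UN_le)
  also have "\<dots> \<le> card P * B" using sum_bounded_above[of P "\<lambda>lab. card (Q lab)" B] Q(2) by simp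
  also have "card P \<le> card (E \<rightarrow>\<^sub>E E)" using P finE by (intro card_mono)
  also have "\<dots> = card E ^ card E" using E by (simp add: card_PiE)
  finally show ?thesis by simp
qed

locale bounded_link =
  fixes g :: "nat \<Rightarrow> nat \<Rightarrow> 'r" and n C :: nat
  assumes bound: "\<And>i r. i \<in> {1..n} \<Longrightarrow> card {j \<in> {1..n}. g i j = r} \<le> C"
    and n_pos: "1 \<le> n" and C_pos: "1 \<le> C"
begin

text \<open>Build the path vertex by vertex. The start is free, and an edge with a new label leaves
  up to \<open>n\<close> end points. If the letter is known, either prescribed by
  \<open>\<rho>\<close> or met earlier on the path, at most \<open>C\<close> end points
  remain.\<close>

lemma card_paths_follows:
  "card {\<pi> \<in> paths n m. follows g m w K \<rho> \<pi>} \<le> n ^ (1 + card (w ` {1..m} - K)) * C ^ m"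
proof (induction m)
  case 0
  have "card {\<pi> \<in> paths n 0. follows g 0 w K \<rho> \<pi>} \<le> card (paths n 0)"
    by (intro card_mono finite_paths) auto
  also have "\<dots> = n" by (simp add: card_PiE)
  finally show ?case by simp
next
  case (Suc m)
  let ?Q = "\<lambda>m. {\<pi> \<in> paths n m. follows g m w K \<rho> \<pi>}"
  define B where "B = (if w (Suc m) \<in> K \<or> w (Suc m) \<in> w ` {1..m} then C else n)"
  define Y where "Y \<pi> = {y \<in> {1..n}. follows g (Suc m) w K \<rho> (\<pi>(Suc m := y))}" for \<pi>
  have Y: "card (Y \<pi>) \<le> B" if "\<pi> \<in> ?Q m" for \<pi>
  proof -
    have last: "edge_letter g (\<pi>(Suc m := y)) (Suc m) = g (\<pi> m) y"
      and init: "q \<in> {1..m} \<Longrightarrow> edge_letter g (\<pi>(Suc m := y)) q = edge_letter g \<pi> q" for y q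
      by (auto simp: edge_letter_def)
    have \<pi>: "\<pi> m \<in> {1..n}" using that by auto
    have "w (Suc m) \<in> K \<or> (\<exists>q\<in>{1..m}. w (Suc m) = w q) \<or> B = n"
      unfolding B_def image_iff by presburger
    then consider (K) "w (Suc m) \<in> K" | (old) q where "q \<in> {1..m}" "w (Suc m) = w q" | (new) "B = n"
      by blast
    then show ?thesis
    proof cases
      case K
      have "g (\<pi> m) y = \<rho> (w (Suc m))" if "y \<in> Y \<pi>" for y
      proof -
        have "follows g (Suc m) w K \<rho> (\<pi>(Suc m := y))" using that by (simp add: Y_def)
        then have "edge_letter g (\<pi>(Suc m := y)) (Suc m) = \<rho> (w (Suc m))"
          unfolding follows_def using K by simp
        then show ?thesis using last by simp
      qed
      then have "Y \<pi> \<subseteq> {y \<in> {1..n}. g (\<pi> m) y = \<rho> (w (Suc m))}"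
        by (auto simp: Y_def)
      then have "card (Y \<pi>) \<le> C" by (intro order_trans[OF card_mono bound[OF \<pi>]]) auto
      with K show ?thesis by (simp add: B_def)
    next
      case old
      have "g (\<pi> m) y = edge_letter g \<pi> q" if "y \<in> Y \<pi>" for y
      proof -
        have "follows g (Suc m) w K \<rho> (\<pi>(Suc m := y))" using that by (simp add: Y_def)
        then have "edge_letter g (\<pi>(Suc m := y)) (Suc m) = edge_letter g (\<pi>(Suc m := y)) q"
          unfolding follows_def using old by simp
        then show ?thesis using last init[OF old(1)] by simp
      qed
      then have "Y \<pi> \<subseteq> {y \<in> {1..n}. g (\<pi> m) y = edge_letter g \<pi> q}"
        by (auto simp: Y_def)
      then have "card (Y \<pi>) \<le> C" by (intro order_trans[OF card_mono bound[OF \<pi>]]) auto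
      with old show ?thesis by (simp add: B_def)
    next
      case new
      have "card (Y \<pi>) \<le> card {1..n}" by (intro card_mono) (auto simp: Y_def)
      with new show ?thesis by simp
    qed
  qed
  have "?Q (Suc m) \<subseteq> (\<lambda>(\<pi>, y). \<pi>(Suc m := y)) ` (SIGMA \<pi> : ?Q m. Y \<pi>)"
  proof
    fix \<pi>' assume \<pi>': "\<pi>' \<in> ?Q (Suc m)"
    then have "\<pi>' \<in> (\<lambda>(\<pi>, y). \<pi>(Suc m := y)) ` (paths n m \<times> {1..n})"
      using paths_Suc_eq by (auto simp: bij_betw_def)
    then obtain \<pi> y where \<pi>: "\<pi> \<in> paths n m" "y \<in> {1..n}" and eq: "\<pi>' = \<pi>(Suc m := y)" by auto
    have "follows g (Suc m) w K \<rho> (\<pi>(Suc m := y))" using \<pi>' eq by simp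
    moreover from this have "follows g m w K \<rho> \<pi>"
      by (rule follows_restrict) auto
    ultimately show "\<pi>' \<in> (\<lambda>(\<pi>, y). \<pi>(Suc m := y)) ` (SIGMA \<pi> : ?Q m. Y \<pi>)"
      using \<pi> eq by (auto simp: Y_def intro!: image_eqI[of _ _ "(\<pi>, y)"])
  qed
  moreover have fin: "finite (?Q m)" "\<And>\<pi>. finite (Y \<pi>)" using finite_paths by (auto simp: Y_def)
  ultimately have "card (?Q (Suc m)) \<le> card (SIGMA \<pi> : ?Q m. Y \<pi>)"
    by (intro surj_card_le) auto
  also have "\<dots> = (\<Sum>\<pi>\<in>?Q m. card (Y \<pi>))" using fin by simp
  also have "\<dots> \<le> card (?Q m) * B" using sum_bounded_above[of "?Q m" "\<lambda>\<pi>. card (Y \<pi>)" B] Y by simp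
  also have "\<dots> \<le> n ^ (1 + card (w ` {1..m} - K)) * C ^ m * B" using Suc by (intro mult_right_mono) auto
  also have "\<dots> \<le> n ^ (1 + card (w ` {1..Suc m} - K)) * C ^ Suc m"
  proof -
    have ins: "w ` {1..Suc m} = insert (w (Suc m)) (w ` {1..m})" by (simp add: atLeastAtMostSuc_conv)
    show ?thesis
    proof (cases "w (Suc m) \<in> K \<or> w (Suc m) \<in> w ` {1..m}")
      case True
      then have "w ` {1..Suc m} - K = w ` {1..m} - K" using ins by auto
      then show ?thesis using True by (simp add: B_def)
    next
      case False
      then have "card (w ` {1..Suc m} - K) = Suc (card (w ` {1..m} - K))"
        unfolding ins by (simp add: insert_Diff_if)
      then show ?thesis using False C_pos by (simp add: B_def)
    qed
  qed
  finally show ?case .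
qed

text \<open>Closing the circuit determines the last vertex, so the last edge costs no choice,
  whatever its label. For this reason only the labels of the first \<open>l - 1\<close> edges are
  counted.\<close>

lemma card_circuits_follows_le_paths:
  assumes "1 \<le> l"
  shows "card (circuits_following g n l w K \<rho>) \<le> n ^ (1 + card (w ` {1..l-1} - K)) * C ^ l"
proof -
  obtain m where l: "l = Suc m" using assms by (cases l) auto
  let ?Q = "circuits_following g n l w K \<rho>" and ?P = "{\<pi> \<in> paths n m. follows g m w K \<rho> \<pi>}"
  have "card ?Q \<le> card ?P"
  proof (rule card_inj_on_le[where f = "\<lambda>\<pi>. restrict \<pi> {0..m}"])
    show "inj_on (\<lambda>\<pi>. restrict \<pi> {0..m}) ?Q"
    proof (rule inj_onI)
      fix \<pi> \<pi>' assume *: "\<pi> \<in> ?Q" "\<pi>' \<in> ?Q" "restrict \<pi> {0..m} = restrict \<pi>' {0..m}"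
      have eq: "\<pi> i = \<pi>' i" if "i \<le> m" for i using fun_cong[OF *(3), of i] that by simp
      show "\<pi> = \<pi>'"
      proof (rule PiE_ext)
        show "\<pi> \<in> paths n l" "\<pi>' \<in> paths n l" using * by (auto simp: circuits_def)
        fix i assume "i \<in> {0..l}"
        then consider "i \<le> m" | "i = l" using l by fastforce
        then show "\<pi> i = \<pi>' i"
        proof cases
          case 2
          then show ?thesis using eq[of 0] *(1,2) by (simp add: circuits_def)
        qed (rule eq)
      qed
    qed
    show "(\<lambda>\<pi>. restrict \<pi> {0..m}) ` ?Q \<subseteq> ?P"
    proof (intro image_subsetI CollectI conjI)
      fix \<pi> assume \<pi>: "\<pi> \<in> ?Q"
      then show "restrict \<pi> {0..m} \<in> paths n m" by (auto simp: circuits_def l)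
      from \<pi> have "follows g l w K \<rho> \<pi>" by simp
      then show "follows g m w K \<rho> (restrict \<pi> {0..m})"
        by (rule follows_restrict) (auto simp: l)
    qed
    show "finite ?P" using finite_paths by simp
  qed
  also have "\<dots> \<le> n ^ (1 + card (w ` {1..m} - K)) * C ^ m" by (rule card_paths_follows)
  also have "\<dots> \<le> n ^ (1 + card (w ` {1..l-1} - K)) * C ^ l" using C_pos by (simp add: l)
  finally show ?thesis .
qed

lemma card_circuits_follows:
  assumes "1 \<le> l"
  shows "card (circuits_following g n l w K \<rho>) \<le> n ^ (1 + card (w ` {1..l} - K)) * C ^ l"
proof -
  have "card (w ` {1..l-1} - K) \<le> card (w ` {1..l} - K)" by (intro card_mono) auto
  then have "n ^ (1 + card (w ` {1..l-1} - K)) * C ^ l \<le> n ^ (1 + card (w ` {1..l} - K)) * C ^ l"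
    using n_pos by (intro mult_right_mono power_increasing) auto
  with card_circuits_follows_le_paths[OF assms] show ?thesis by (rule order_trans)
qed

text \<open>An edge whose letter is new and occurs only once in the circuit may be traversed last; both its
  end points are determined by then, so its letter costs no free choice.\<close>

lemma card_circuits_follows_saving:
  assumes p: "p \<in> {1..l}" "w p \<notin> K" "\<And>q. q \<in> {1..l} \<Longrightarrow> q \<noteq> p \<Longrightarrow> w q \<noteq> w p"
  shows "card (circuits_following g n l w K \<rho>) \<le> n ^ card (w ` {1..l} - K) * C ^ l"
proof -
  \<comment> \<open>A cyclic shift of the edge numbers that makes \<open>p\<close> the last edge.
    Correspondingly, \<open>rot\<close> below starts the circuit at the vertex
    \<open>\<pi> p\<close>.\<close>
  define s where "s i = (if i + p \<le> l then i + p else i + p - l)" for i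
  define w' where "w' = w \<circ> s"
  have s_img: "s ` {1..l} = {1..l}"
  proof
    show "s ` {1..l} \<subseteq> {1..l}" using p by (auto simp: s_def)
    show "{1..l} \<subseteq> s ` {1..l}"
    proof
      fix q assume "q \<in> {1..l}"
      then show "q \<in> s ` {1..l}"
        using p by (intro image_eqI[of _ _ "if p < q then q - p else q + l - p"]) (auto simp: s_def)
    qed
  qed
  have s_l: "s l = p" using p by (simp add: s_def)
  have s_ne: "s q \<noteq> p" if "q \<in> {1..l-1}" for q using that p by (auto simp: s_def)
  have s_in: "s q \<in> {1..l}" if "q \<in> {1..l}" for q using that s_img by auto
  have letters: "w ` {1..l} - K = insert (w p) (w' ` {1..l-1} - K)"
  proof -
    have "w ` {1..l} = w' ` {1..l}" unfolding w'_def image_comp[symmetric] s_img ..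
    also have "\<dots> = insert (w' l) (w' ` {1..l-1})"
    proof -
      have "{1..l} = insert l {1..l-1}" using p by auto
      then show ?thesis by (metis image_insert)
    qed
    finally have "w ` {1..l} = insert (w p) (w' ` {1..l-1})" by (simp add: w'_def s_l)
    then show ?thesis using p(2) by (simp add: insert_Diff_if)
  qed
  have "w p \<notin> w' ` {1..l-1} - K"
  proof
    assume "w p \<in> w' ` {1..l-1} - K"
    then obtain q where q: "q \<in> {1..l-1}" "w p = w (s q)" by (auto simp: w'_def)
    have "q \<in> {1..l}" using q by auto
    from p(3)[OF s_in[OF this] s_ne[OF q(1)]] q(2) show False by simp
  qed
  then have card: "card (w ` {1..l} - K) = 1 + card (w' ` {1..l-1} - K)"
    unfolding letters by (subst card_insert_disjoint) auto
  define rot where "rot \<pi> = (\<lambda>i\<in>{0..l}. if i + p \<le> l then \<pi> (i + p) else \<pi> (i + p - l))" for \<pi> :: "nat \<Rightarrow> nat"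
  have rot_edge: "edge_letter g (rot \<pi>) i = edge_letter g \<pi> (s i)" if "\<pi> \<in> circuits n l" "i \<in> {1..l}" for \<pi> i
  proof -
    have \<pi>: "\<pi> 0 = \<pi> l" and i: "i \<in> {1..l}" using that by (simp_all add: circuits_def)
    have "rot \<pi> i = \<pi> (s i)" using that by (auto simp: rot_def s_def)
    \<comment> \<open>The seam is at \<open>i + p = l + 1\<close>: there \<open>rot\<close> yields
      \<open>\<pi> l\<close> and the shifted edge number yields \<open>\<pi> 0\<close>, which agree
      on a circuit.\<close>
    moreover have "rot \<pi> (i - 1) = \<pi> (s i - 1)"
    proof -
      have "rot \<pi> (i - 1) = (if i - 1 + p \<le> l then \<pi> (i - 1 + p) else \<pi> (i - 1 + p - l))"
        using that unfolding rot_def by (intro restrict_apply') auto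
      moreover have "s i - 1 = i - 1 + p" if "i + p \<le> l" using that i by (auto simp: s_def)
      moreover have "s i - 1 = i - 1 + p - l" if "\<not> i + p \<le> l" using that i by (auto simp: s_def)
      moreover have "i - 1 + p = l" if "\<not> i + p \<le> l" "i - 1 + p \<le> l" using that i by auto
      moreover have "i - 1 + p \<le> l" if "i + p \<le> l" using that by auto
      ultimately show ?thesis using \<pi> by (metis diff_self_eq_0)
    qed
    ultimately show ?thesis by (simp add: edge_letter_def)
  qed
  let ?Q = "circuits_following g n l w K \<rho>" and ?Q' = "circuits_following g n l w' K \<rho>"
  have "card ?Q \<le> card ?Q'"
  proof (rule card_inj_on_le[where f = rot])
    show "inj_on rot ?Q"
    proof (rule inj_onI)
      fix \<pi> \<pi>' assume *: "\<pi> \<in> ?Q" "\<pi>' \<in> ?Q" "rot \<pi> = rot \<pi>'"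
      show "\<pi> = \<pi>'"
      proof (rule PiE_ext)
        show "\<pi> \<in> paths n l" "\<pi>' \<in> paths n l" using * by (auto simp: circuits_def)
        fix i assume i: "i \<in> {0..l}"
        \<comment> \<open>The place at which \<open>rot\<close> shows vertex \<open>i\<close>; for
          \<open>i = 0\<close> it is the place of vertex \<open>l\<close>.\<close>
        let ?j = "if p \<le> i then i - p else i + l - p"
        have j: "?j \<in> {0..l}" using i p by auto
        have rot_j: "rot \<pi> ?j = \<pi> i" if "\<pi> 0 = \<pi> l" for \<pi>
        proof (cases "i = 0")
          case True then show ?thesis using p that by (simp add: rot_def)
        next
          case False then show ?thesis using p i by (auto simp: rot_def)
        qed
        have "\<pi> 0 = \<pi> l" "\<pi>' 0 = \<pi>' l" using * by (auto simp: circuits_def)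
        then show "\<pi> i = \<pi>' i" using rot_j[of \<pi>] rot_j[of \<pi>'] *(3) by simp
      qed
    qed
    show "rot ` ?Q \<subseteq> ?Q'"
    proof safe
      fix \<pi> assume \<pi>: "\<pi> \<in> circuits n l" "follows g l w K \<rho> \<pi>"
      then have mem: "\<pi> i \<in> {1..n}" if "i \<le> l" for i using that by (auto simp: circuits_def PiE_def Pi_def)
      show "rot \<pi> \<in> circuits n l"
        unfolding circuits_def using \<pi> p mem by (auto simp: rot_def circuits_def intro!: mem)
      show "follows g l w' K \<rho> (rot \<pi>)"
        using \<pi>(2) s_in unfolding follows_def
        by (simp add: rot_edge[OF \<pi>(1)] w'_def)
    qed
    show "finite ?Q'" using finite_circuits by simp
  qed
  also have "\<dots> \<le> n ^ (1 + card (w' ` {1..l-1} - K)) * C ^ l"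
    using p(1) by (intro card_circuits_follows_le_paths) auto
  finally show ?thesis unfolding card .
qed

end

section \<open>Tuples of circuits traversed one after another\<close>

definition label_mult :: "nat \<Rightarrow> (nat \<times> nat \<Rightarrow> 'b) \<Rightarrow> nat \<Rightarrow> 'b \<Rightarrow> nat" where
  "label_mult l lab a x = card {q \<in> {1..l}. lab (a, q) = x}"

text \<open>A labelling \<open>lab\<close> sends the \<open>q\<close>th edge of circuit \<open>a\<close>, coded as \<open>(a, q)\<close>, to its letter. A fresh
  circuit \<open>a\<close>, traversed after those in \<open>S\<close>, has one free choice less than it has new letters.\<close>

definition fresh :: "nat \<Rightarrow> (nat \<times> nat \<Rightarrow> 'b) \<Rightarrow> nat set \<Rightarrow> nat \<Rightarrow> bool" where
  "fresh l lab S a \<longleftrightarrow> (\<exists>x. label_mult l lab a x = 1 \<and> (\<forall>b\<in>S. label_mult l lab b x = 0))"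

text \<open>The head of the list is traversed last: its freshness is judged against all circuits in
  the tail.\<close>

fun savings :: "nat \<Rightarrow> (nat \<times> nat \<Rightarrow> 'b) \<Rightarrow> nat list \<Rightarrow> nat" where
  "savings l lab [] = 0"
| "savings l lab (a # as) = savings l lab as + of_bool (fresh l lab (set as) a)"

lemma label_mult_pos_iff: "label_mult l lab a x > 0 \<longleftrightarrow> (\<exists>q\<in>{1..l}. lab (a, q) = x)"
  unfolding label_mult_def by (auto simp: card_gt_0_iff)

text \<open>Since the head comes last, \<open>rev [0..<k]\<close> stands for the increasing order of
  traversal and \<open>[0..<k]\<close> for the decreasing one.\<close>

lemma savings_rev_upt: "savings l lab (rev [0..<k]) = card {a. a < k \<and> fresh l lab {..<a} a}"
proof (induction k)
  case (Suc k)
  have "{a. a < Suc k \<and> fresh l lab {..<a} a} =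
      {a. a < k \<and> fresh l lab {..<a} a} \<union> (if fresh l lab {..<k} k then {k} else {})"
    by (auto simp: less_Suc_eq)
  then show ?case using Suc by (simp add: lessThan_atLeast0)
qed simp

lemma savings_upt: "savings l lab [0..<k] = card {a. a < k \<and> fresh l lab {a<..<k} a}"
proof -
  have "j \<le> k \<Longrightarrow> savings l lab [j..<k] = card {a. j \<le> a \<and> a < k \<and> fresh l lab {a<..<k} a}" for j
  proof (induction "k - j" arbitrary: j)
    case (Suc d)
    then have j: "j < k" by simp
    have "{a. j \<le> a \<and> a < k \<and> fresh l lab {a<..<k} a} =
        {a. Suc j \<le> a \<and> a < k \<and> fresh l lab {a<..<k} a} \<union> (if fresh l lab {j<..<k} j then {j} else {})"
      using j by (auto simp: Suc_le_eq order_le_less)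
    moreover have "set [Suc j..<k] = {j<..<k}" by auto
    ultimately show ?case using Suc.hyps(1)[of "Suc j"] Suc.hyps(2) j
      by (simp add: upt_conv_Cons)
  qed auto
  from this[of 0] show ?thesis by simp
qed

text \<open>Only the coincidences demanded by \<open>lab\<close> are imposed, further ones are
  allowed. This suffices for upper bounds, as each tuple realizes its own pattern.\<close>

definition realizations :: "(nat \<Rightarrow> nat \<Rightarrow> 'r) \<Rightarrow> nat \<Rightarrow> nat \<Rightarrow> (nat \<times> nat \<Rightarrow> 'b) \<Rightarrow> nat set \<Rightarrow> (nat \<Rightarrow> nat \<Rightarrow> nat) set" where
  "realizations g n l lab S = {f \<in> S \<rightarrow>\<^sub>E circuits n l.
     \<forall>a\<in>S. \<forall>q\<in>{1..l}. \<forall>a'\<in>S. \<forall>q'\<in>{1..l}. lab (a, q) = lab (a', q') \<longrightarrow>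
       edge_letter g (f a) q = edge_letter g (f a') q'}"

lemma finite_realizations: "finite S \<Longrightarrow> finite (realizations g n l lab S)"
  unfolding realizations_def by (intro finite_Collect_conjI disjI1) (simp add: finite_PiE finite_circuits)

context bounded_link
begin

text \<open>The saving stands as a factor on the left, which avoids subtraction in the exponent and
  lets savings multiply up along a list.\<close>

lemma card_circuits_follows_fresh:
  assumes "1 \<le> l" and S: "K = lab ` (S \<times> {1..l})"
  shows "card (circuits_following g n l (\<lambda>q. lab (a, q)) K \<rho>) * n ^ of_bool (fresh l lab S a)
    \<le> n ^ (1 + card ((\<lambda>q. lab (a, q)) ` {1..l} - K)) * C ^ l"
proof (cases "fresh l lab S a")
  case True
  then obtain x where x: "label_mult l lab a x = 1" "\<And>b. b \<in> S \<Longrightarrow> label_mult l lab b x = 0"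
    by (auto simp: fresh_def)
  from x(1) obtain p where p: "{q \<in> {1..l}. lab (a, q) = x} = {p}"
    unfolding label_mult_def by (auto simp: card_1_singleton_iff)
  have "x \<notin> K"
  proof
    assume "x \<in> K"
    then obtain b q where "b \<in> S" "q \<in> {1..l}" "lab (b, q) = x" by (auto simp: S)
    then show False using x(2)[of b] label_mult_pos_iff[of l lab b x] by auto
  qed
  then have "card (circuits_following g n l (\<lambda>q. lab (a, q)) K \<rho>)
    \<le> n ^ card ((\<lambda>q. lab (a, q)) ` {1..l} - K) * C ^ l"
  proof (intro card_circuits_follows_saving[of p])
    have "p \<in> {q \<in> {1..l}. lab (a, q) = x}" by (simp only: p singletonI)
    then have px: "p \<in> {1..l}" "lab (a, p) = x" by auto
    then show "p \<in> {1..l}" "lab (a, p) \<notin> K" using \<open>x \<notin> K\<close> by auto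
    fix q assume "q \<in> {1..l}" "q \<noteq> p"
    then have "q \<notin> {q \<in> {1..l}. lab (a, q) = x}" by (simp only: p singleton_iff not_False_eq_True)
    then show "lab (a, q) \<noteq> lab (a, p)" using \<open>q \<in> {1..l}\<close> px by blast
  qed
  then show ?thesis using True by (simp add: mult_ac)
next
  case False
  then show ?thesis using card_circuits_follows[OF assms(1)] by simp
qed

text \<open>Each circuit contributes one free starting vertex and one choice for each label not seen
  in the tail, less its saving. Added up along the list, the starting vertices give
  \<open>length as\<close> and the new labels give all labels once.\<close>

lemma card_realizations_savings:
  assumes l: "1 \<le> l" and "distinct as"
  shows "card (realizations g n l lab (set as)) * n ^ savings l lab as
    \<le> n ^ (length as + card (lab ` (set as \<times> {1..l}))) * C ^ (l * length as)"
  using assms(2)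
proof (induction as)
  case Nil
  have "realizations g n l lab (set []) \<subseteq> {\<lambda>_. undefined}" by (auto simp: realizations_def)
  then have "card (realizations g n l lab (set [])) \<le> card {\<lambda>_::nat. undefined :: nat \<Rightarrow> nat}"
    by (intro card_mono) auto
  then show ?case by simp
next
  case (Cons a as)
  let ?S = "set as" and ?R = "realizations g n l lab"
  let ?K = "lab ` (?S \<times> {1..l})" and ?w = "\<lambda>q. lab (a, q)"
  define N where "N = n ^ (1 + card (?w ` {1..l} - ?K)) * C ^ l"
  \<comment> \<open>A realization of the tail has the same letter on all edges with the same label,
    so its letters define \<open>\<rho>\<close> on \<open>?K\<close>; elsewhere the choice operator
    gives an arbitrary value.\<close>
  have "\<exists>\<rho>. \<forall>b\<in>?S. \<forall>q\<in>{1..l}. \<rho> (lab (b, q)) = edge_letter g (f b) q" if "f \<in> ?R ?S" for f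
  proof -
    let ?P = "\<lambda>x z. \<exists>b\<in>?S. \<exists>q\<in>{1..l}. lab (b, q) = x \<and> edge_letter g (f b) q = z"
    have "(SOME z. ?P (lab (b, q)) z) = edge_letter g (f b) q" if "b \<in> ?S" "q \<in> {1..l}" for b q
    proof -
      have "\<exists>z. ?P (lab (b, q)) z" using that by blast
      then have "?P (lab (b, q)) (SOME z. ?P (lab (b, q)) z)" by (rule someI_ex)
      then show ?thesis using \<open>f \<in> ?R ?S\<close> that unfolding realizations_def by blast
    qed
    then show ?thesis by (intro exI[of _ "\<lambda>x. SOME z. ?P x z"]) blast
  qed
  then obtain \<rho> where \<rho>: "\<And>f b q. f \<in> ?R ?S \<Longrightarrow> b \<in> ?S \<Longrightarrow> q \<in> {1..l} \<Longrightarrow> \<rho> f (lab (b, q)) = edge_letter g (f b) q"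
    by metis
  define Y where "Y f = circuits_following g n l ?w ?K (\<rho> f)" for f
  have Y: "card (Y f) * n ^ of_bool (fresh l lab ?S a) \<le> N" for f
    unfolding Y_def N_def by (rule card_circuits_follows_fresh[OF l refl])
  have "a \<notin> ?S" using Cons.prems by simp
  have "card (?R (set (a # as))) \<le> card (SIGMA f : ?R ?S. Y f)"
  proof (rule card_inj_on_le[where f = "\<lambda>f. (restrict f ?S, f a)"])
    show "inj_on (\<lambda>f. (restrict f ?S, f a)) (?R (set (a # as)))"
    proof (rule inj_onI)
      fix f f' assume *: "f \<in> ?R (set (a # as))" "f' \<in> ?R (set (a # as))"
        "(restrict f ?S, f a) = (restrict f' ?S, f' a)"
      show "f = f'"
      proof (rule PiE_ext)
        show "f \<in> set (a # as) \<rightarrow>\<^sub>E circuits n l" "f' \<in> set (a # as) \<rightarrow>\<^sub>E circuits n l"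
          using *(1,2) unfolding realizations_def by blast+
        from *(3) have fa: "f a = f' a" and fS: "restrict f ?S = restrict f' ?S" by simp_all
        fix b assume "b \<in> set (a # as)"
        then consider "b = a" | "b \<in> ?S" by auto
        then show "f b = f' b" using fa fun_cong[OF fS, of b] by cases simp_all
      qed
    qed
    show "(\<lambda>f. (restrict f ?S, f a)) ` ?R (set (a # as)) \<subseteq> (SIGMA f : ?R ?S. Y f)"
    proof (rule image_subsetI, rule SigmaI)
      fix f assume f: "f \<in> ?R (set (a # as))"
      have eq: "edge_letter g (f b) q = edge_letter g (f b') q'"
        if "b \<in> set (a # as)" "b' \<in> set (a # as)" "q \<in> {1..l}" "q' \<in> {1..l}" "lab (b, q) = lab (b', q')" for b q b' q'
        using f that unfolding realizations_def by blast
      have circ: "f b \<in> circuits n l" if "b \<in> set (a # as)" for b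
        using f that unfolding realizations_def by blast
      show r: "restrict f ?S \<in> ?R ?S"
        unfolding realizations_def
      proof (intro CollectI conjI ballI impI)
        show "restrict f ?S \<in> ?S \<rightarrow>\<^sub>E circuits n l" using circ by auto
        fix b q b' q' assume "b \<in> ?S" "q \<in> {1..l}" "b' \<in> ?S" "q' \<in> {1..l}" "lab (b, q) = lab (b', q')"
        then show "edge_letter g (restrict f ?S b) q = edge_letter g (restrict f ?S b') q'"
          using eq[of b b' q q'] by simp
      qed
      have "follows g l ?w ?K (\<rho> (restrict f ?S)) (f a)"
        unfolding follows_def
      proof (intro conjI ballI impI)
        fix q assume q: "q \<in> {1..l}" and "?w q \<in> ?K"
        then obtain b q' where b: "b \<in> ?S" "q' \<in> {1..l}" "?w q = lab (b, q')" by auto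
        have "\<rho> (restrict f ?S) (lab (b, q')) = edge_letter g (restrict f ?S b) q'"
          by (rule \<rho>[OF r b(1,2)])
        also have "\<dots> = edge_letter g (f a) q"
          using eq[of b a q' q] b q by simp
        finally show "edge_letter g (f a) q = \<rho> (restrict f ?S) (?w q)" using b(3) by simp
      next
        fix q q' assume "q \<in> {1..l}" "q' \<in> {1..l}" "?w q = ?w q'"
        then show "edge_letter g (f a) q = edge_letter g (f a) q'" by (intro eq) auto
      qed
      then show "f a \<in> Y (restrict f ?S)" using circ[of a] by (simp add: Y_def)
    qed
    show "finite (SIGMA f : ?R ?S. Y f)"
      using finite_circuits by (intro finite_SigmaI finite_realizations) (auto simp: Y_def)
  qed
  also have "\<dots> = (\<Sum>f\<in>?R ?S. card (Y f))"
    using finite_circuits by (intro card_SigmaI finite_realizations ballI) (auto simp: Y_def)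
  finally have "card (?R (set (a # as))) * n ^ of_bool (fresh l lab ?S a)
    \<le> (\<Sum>f\<in>?R ?S. card (Y f)) * n ^ of_bool (fresh l lab ?S a)" by (rule mult_right_mono) simp
  also have "\<dots> \<le> card (?R ?S) * N"
    unfolding sum_distrib_right
    using sum_bounded_above[of "?R ?S" "\<lambda>f. card (Y f) * n ^ of_bool (fresh l lab ?S a)" N] Y by simp
  finally have step: "card (?R (set (a # as))) * n ^ of_bool (fresh l lab ?S a) \<le> card (?R ?S) * N" .
  have "card (?R (set (a # as))) * n ^ savings l lab (a # as)
    = card (?R (set (a # as))) * n ^ of_bool (fresh l lab ?S a) * n ^ savings l lab as"
    by (simp only: savings.simps power_add mult_ac)
  also have "\<dots> \<le> card (?R ?S) * N * n ^ savings l lab as"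
    using step by (rule mult_right_mono) simp
  also have "\<dots> = card (?R ?S) * n ^ savings l lab as * N" by (simp only: mult_ac)
  also have "\<dots> \<le> n ^ (length as + card ?K) * C ^ (l * length as) * N"
    using Cons by (intro mult_right_mono) auto
  also have "\<dots> = n ^ (length (a # as) + card (lab ` (set (a # as) \<times> {1..l}))) * C ^ (l * length (a # as))"
  proof -
    have "lab ` (set (a # as) \<times> {1..l}) = ?K \<union> (?w ` {1..l} - ?K)" by auto
    then have "card (lab ` (set (a # as) \<times> {1..l})) = card ?K + card (?w ` {1..l} - ?K)"
      by (simp only: ) (intro card_Un_disjoint, auto)
    then show ?thesis by (simp add: N_def power_add mult_ac)
  qed
  finally show ?case .
qed

end

text \<open>If every label occurs at least twice and every circuit shares a label with another one, then a
  circuit without savings in either order uses up one of the excess occurrences (those beyond the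
  second) of a label it shares: of the circuits containing that label, the first and the last either
  contain it twice or save.\<close>

lemma two_card_labels_le:
  fixes lab :: "nat \<times> nat \<Rightarrow> 'b"
  assumes twice: "\<And>x. x \<in> lab ` ({..<k} \<times> {1..l}) \<Longrightarrow> 2 \<le> (\<Sum>a<k. label_mult l lab a x)"
    and shared: "\<And>a. a < k \<Longrightarrow> \<exists>x. 0 < label_mult l lab a x \<and> (\<exists>b<k. b \<noteq> a \<and> 0 < label_mult l lab b x)"
  shows "2 * card (lab ` ({..<k} \<times> {1..l})) + k
    \<le> k * l + card {a. a < k \<and> fresh l lab {..<a} a} + card {a. a < k \<and> fresh l lab {a<..<k} a}"
proof -
  let ?m = "label_mult l lab" and ?X = "lab ` ({..<k} \<times> {1..l})"
  let ?S1 = "{a. a < k \<and> fresh l lab {..<a} a}" and ?S2 = "{a. a < k \<and> fresh l lab {a<..<k} a}"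
  \<comment> \<open>The circuits that save in neither order; they must be paid for by excess
    occurrences.\<close>
  define U where "U = {..<k} - ?S1 - ?S2"
  obtain h where h: "\<And>a. a < k \<Longrightarrow> 0 < ?m a (h a) \<and> (\<exists>b<k. b \<noteq> a \<and> 0 < ?m b (h a))"
    using shared by metis
  \<comment> \<open>Each label is charged two occurrences for itself and one more for every circuit
    in \<open>U\<close> that chose it as its shared label \<open>h a\<close>. Summing over the
    labels compares this charge with the \<open>k * l\<close> edges.\<close>
  have key: "2 + card {a \<in> U. h a = x} \<le> (\<Sum>a<k. ?m a x)" if "x \<in> ?X" for x
  proof (cases "{a \<in> U. h a = x} = {}")
    case True
    then show ?thesis unfolding True using twice[OF that] by simp
  next
    case False
    define T where "T = {a \<in> U. h a = x}"
    define J where "J = {a. a < k \<and> 0 < ?m a x}"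
    have J: "finite J" "T \<subseteq> J" using h by (auto simp: J_def T_def U_def)
    from False obtain a where a: "a \<in> U" "h a = x" by auto
    then have "a < k" by (auto simp: U_def)
    with h[of a] a obtain b where b: "a \<in> J" "b \<in> J" "a \<noteq> b" by (auto simp: J_def)
    \<comment> \<open>The first and the last circuit containing \<open>x\<close>. If such a circuit
      lies in \<open>U\<close> and contained \<open>x\<close> only once, it would be fresh in the
      increasing or in the decreasing order; so it contains \<open>x\<close> at least twice. The two
      regular occurrences of \<open>x\<close> are taken from \<open>c1\<close> and
      \<open>c2\<close>, which differ because \<open>x\<close> is shared.\<close>
    define c1 c2 where "c1 = Min J" and "c2 = Max J"
    have c: "c1 \<in> J" "c2 \<in> J" "\<And>i. i \<in> J \<Longrightarrow> c1 \<le> i \<and> i \<le> c2"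
    proof -
      have "J \<noteq> {}" using b by auto
      then show "c1 \<in> J" "c2 \<in> J" unfolding c1_def c2_def using Min_in[OF J(1)] Max_in[OF J(1)] by blast+
      show "\<And>i. i \<in> J \<Longrightarrow> c1 \<le> i \<and> i \<le> c2" unfolding c1_def c2_def using J(1) by simp
    qed
    have "c1 \<noteq> c2" using c(3)[OF b(1)] c(3)[OF b(2)] b(3) by linarith
    have zero1: "?m b x = 0" if "b < c1" for b
      using c(1) c(3)[of b] that by (auto simp: J_def)
    have zero2: "?m b x = 0" if "c2 < b" "b < k" for b
      using c(3)[of b] that by (auto simp: J_def)
    have "?m c1 x \<noteq> 1" if "c1 \<in> T"
      using that zero1 unfolding T_def U_def fresh_def by auto
    then have 1: "of_bool (c1 \<in> T) + 1 \<le> ?m c1 x"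
      using c(1) by (auto simp: J_def)
    have "?m c2 x \<noteq> 1" if "c2 \<in> T"
      using that zero2 unfolding T_def U_def fresh_def by auto
    then have 2: "of_bool (c2 \<in> T) + 1 \<le> ?m c2 x"
      using c(2) by (auto simp: J_def)
    have 3: "of_bool (a \<in> T) \<le> ?m a x" for a using J(2) by (auto simp: J_def)
    have split: "(\<Sum>a<k. f a) = f c1 + f c2 + (\<Sum>a\<in>{..<k} - {c1, c2}. f a)" for f :: "nat \<Rightarrow> nat"
    proof -
      have "{..<k} = insert c1 (insert c2 ({..<k} - {c1, c2}))" using c by (auto simp: J_def)
      then have "(\<Sum>a<k. f a) = sum f (insert c1 (insert c2 ({..<k} - {c1, c2})))" by simp
      then show ?thesis using \<open>c1 \<noteq> c2\<close> by simp
    qed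
    have "card T = (\<Sum>a<k. of_bool (a \<in> T))"
    proof -
      have "T \<subseteq> {..<k}" by (auto simp: T_def U_def)
      then have "{..<k} \<inter> T = T" by auto
      then show ?thesis by (simp add: of_bool_def sum.If_cases)
    qed
    also have "2 + \<dots> \<le> (\<Sum>a<k. ?m a x)"
      unfolding split using 1 2 sum_mono[of "{..<k} - {c1, c2}" "\<lambda>a. of_bool (a \<in> T)" "\<lambda>a. ?m a x"] 3
      by simp
    finally show ?thesis unfolding T_def .
  qed
  have "(\<Sum>x\<in>?X. \<Sum>a<k. ?m a x) = (\<Sum>a<k. \<Sum>x\<in>?X. ?m a x)" by (rule sum.swap)
  also have "\<dots> = (\<Sum>a<k. l)"
  proof (rule sum.cong[OF refl])
    fix a assume a: "a \<in> {..<k}"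
    have "(\<Sum>x\<in>?X. ?m a x) = card (\<Union>x\<in>?X. {q \<in> {1..l}. lab (a, q) = x})"
      unfolding label_mult_def by (intro card_UN_disjoint[symmetric]) auto
    also have "(\<Union>x\<in>?X. {q \<in> {1..l}. lab (a, q) = x}) = {1..l}" using a by blast
    finally show "(\<Sum>x\<in>?X. ?m a x) = l" by simp
  qed
  finally have total: "(\<Sum>x\<in>?X. \<Sum>a<k. ?m a x) = k * l" by simp
  have "(\<Sum>x\<in>?X. card {a \<in> U. h a = x}) = card (\<Union>x\<in>?X. {a \<in> U. h a = x})"
    by (intro card_UN_disjoint[symmetric]) (auto simp: U_def)
  also have "(\<Union>x\<in>?X. {a \<in> U. h a = x}) = U"
  proof -
    have "h a \<in> ?X" if "a \<in> U" for a
    proof -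
      have "a < k" using that by (auto simp: U_def)
      then obtain q where "q \<in> {1..l}" "lab (a, q) = h a"
        using h[of a] label_mult_pos_iff[of l lab a "h a"] by auto
      then show ?thesis using \<open>a < k\<close> by force
    qed
    then show ?thesis by auto
  qed
  finally have U: "(\<Sum>x\<in>?X. card {a \<in> U. h a = x}) = card U" .
  have "2 * card ?X + card U = (\<Sum>x\<in>?X. 2 + card {a \<in> U. h a = x})"
    unfolding sum.distrib U by simp
  also have "\<dots> \<le> (\<Sum>x\<in>?X. \<Sum>a<k. ?m a x)" by (intro sum_mono key)
  finally have "2 * card ?X + card U \<le> k * l" unfolding total .
  moreover have "k \<le> card U + card ?S1 + card ?S2"
  proof -
    have "{..<k} \<subseteq> U \<union> ?S1 \<union> ?S2" by (auto simp: U_def)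
    then have "card {..<k} \<le> card (U \<union> ?S1 \<union> ?S2)" by (intro card_mono) (auto simp: U_def)
    also have "\<dots> \<le> card U + card ?S1 + card ?S2"
      by (meson card_Un_le add_right_mono order_trans)
    finally show ?thesis by simp
  qed
  ultimately show ?thesis by linarith
qed

text \<open>Failure of either condition, \<open>matched\<close> or \<open>linked\<close>, isolates
  an independent factor of mean zero in the product of the centred blocks. Only tuples satisfying
  both have to be counted.\<close>

definition matched :: "(nat \<Rightarrow> nat \<Rightarrow> 'r) \<Rightarrow> nat \<Rightarrow> nat \<Rightarrow> (nat \<Rightarrow> nat \<Rightarrow> nat) \<Rightarrow> bool" where
  "matched g l k f \<longleftrightarrow> (\<forall>a<k. \<forall>q\<in>{1..l}. \<exists>b<k. \<exists>q'\<in>{1..l}.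
     (b, q') \<noteq> (a, q) \<and> edge_letter g (f b) q' = edge_letter g (f a) q)"

definition linked :: "(nat \<Rightarrow> nat \<Rightarrow> 'r) \<Rightarrow> nat \<Rightarrow> nat \<Rightarrow> (nat \<Rightarrow> nat \<Rightarrow> nat) \<Rightarrow> bool" where
  "linked g l k f \<longleftrightarrow> (\<forall>a<k. \<exists>b<k. b \<noteq> a \<and>
     (\<exists>q\<in>{1..l}. \<exists>q'\<in>{1..l}. edge_letter g (f b) q' = edge_letter g (f a) q))"

lemma card_image_le_if_coarser:
  assumes "finite E" and "\<And>x y. x \<in> E \<Longrightarrow> y \<in> E \<Longrightarrow> h x = h y \<Longrightarrow> lab x = lab y"
  shows "card (lab ` E) \<le> card (h ` E)"
proof (rule surj_card_le)
  show "finite (h ` E)" using assms(1) by simp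
  show "lab ` E \<subseteq> (\<lambda>r. lab (inv_into E h r)) ` (h ` E)"
  proof (rule image_subsetI)
    fix x assume x: "x \<in> E"
    have "lab (inv_into E h (h x)) = lab x"
      by (rule assms(2)) (use x in \<open>auto intro: inv_into_into f_inv_into_f\<close>)
    then show "lab x \<in> (\<lambda>r. lab (inv_into E h r)) ` (h ` E)"
      using x by (metis imageI)
  qed
qed

context bounded_link
begin

text \<open>With \<open>u\<close> labels, the savings of the two orders add up to at least
  \<open>2 * u + k - k * l\<close>, and the better order has at least half of them. As
  \<open>k\<close> is even, halving loses nothing, and \<open>k + u - s\<close> is at most
  \<open>j * (l + 1)\<close>.\<close>

lemma card_realizations_le_if_matched_linked:
  fixes lab :: "nat \<times> nat \<Rightarrow> 'b"
  assumes l: "1 \<le> l" and k: "k = 2 * j"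
    and twice: "\<And>x. x \<in> lab ` ({..<k} \<times> {1..l}) \<Longrightarrow> 2 \<le> (\<Sum>a<k. label_mult l lab a x)"
    and shared: "\<And>a. a < k \<Longrightarrow> \<exists>x. 0 < label_mult l lab a x \<and> (\<exists>b<k. b \<noteq> a \<and> 0 < label_mult l lab b x)"
  shows "card (realizations g n l lab {..<k}) \<le> n ^ (j * (l + 1)) * C ^ (l * k)"
proof -
  let ?u = "card (lab ` ({..<k} \<times> {1..l}))" and ?N = "card (realizations g n l lab {..<k})"
  define s where "s = max (savings l lab [0..<k]) (savings l lab (rev [0..<k]))"
  have "2 * ?u + k \<le> k * l + savings l lab (rev [0..<k]) + savings l lab [0..<k]"
    unfolding savings_rev_upt savings_upt by (rule two_card_labels_le[OF twice shared])
  then have "2 * (k + ?u) \<le> 2 * (j * (l + 1) + s)"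
    unfolding s_def k by (simp add: algebra_simps max_def)
  then have exp: "k + ?u \<le> j * (l + 1) + s" by simp
  have "?N * n ^ s \<le> n ^ (k + ?u) * C ^ (l * k)"
    using card_realizations_savings[OF l, of "[0..<k]" lab] card_realizations_savings[OF l, of "rev [0..<k]" lab]
    by (simp add: s_def max_def lessThan_atLeast0)
  also have "\<dots> \<le> n ^ (j * (l + 1) + s) * C ^ (l * k)"
    using exp n_pos by (intro mult_right_mono power_increasing) auto
  finally have "?N * n ^ s \<le> n ^ (j * (l + 1)) * C ^ (l * k) * n ^ s"
    by (simp only: power_add mult_ac)
  then show ?thesis using n_pos by (simp only: mult_le_cancel2) simp
qed

theorem card_matched_linked_tuples:
  assumes l: "1 \<le> l" and k: "k = 2 * j"
  shows "card {f \<in> {..<k} \<rightarrow>\<^sub>E circuits n l. matched g l k f \<and> linked g l k f}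
    \<le> (k * l) ^ (k * l) * C ^ (l * k) * n ^ (j * (l + 1))"
proof -
  let ?E = "{..<k} \<times> {1..l}"
  let ?F = "{f \<in> {..<k} \<rightarrow>\<^sub>E circuits n l. matched g l k f \<and> linked g l k f}"
  define B where "B = n ^ (j * (l + 1)) * C ^ (l * k)"
  \<comment> \<open>The desired bound is built into \<open>P\<close>; that the pattern of an actual
    tuple belongs to \<open>P\<close> is where \<open>matched\<close> and \<open>linked\<close>
    enter.\<close>
  define P where "P = {lab \<in> ?E \<rightarrow>\<^sub>E ?E. card (realizations g n l lab {..<k}) \<le> B}"
  have "?F \<subseteq> (\<Union>lab\<in>P. realizations g n l lab {..<k})"
  proof
    fix f assume f: "f \<in> ?F"
    then have circ: "f \<in> {..<k} \<rightarrow>\<^sub>E circuits n l" and m: "matched g l k f" and lk: "linked g l k f" by auto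
    obtain lab where lab: "lab \<in> ?E \<rightarrow>\<^sub>E ?E"
      and eq: "\<And>x y. x \<in> ?E \<Longrightarrow> y \<in> ?E \<Longrightarrow>
        lab x = lab y \<longleftrightarrow> edge_letter g (f (fst x)) (snd x) = edge_letter g (f (fst y)) (snd y)"
      using ex_pattern[of ?E "\<lambda>x. edge_letter g (f (fst x)) (snd x)"] by blast
    have eq': "lab (a, q) = lab (b, q') \<longleftrightarrow> edge_letter g (f a) q = edge_letter g (f b) q'"
      if "a < k" "b < k" "q \<in> {1..l}" "q' \<in> {1..l}" for a b q q'
      using eq[of "(a, q)" "(b, q')"] that by simp
    have "card (realizations g n l lab {..<k}) \<le> B"
      unfolding B_def
    proof (rule card_realizations_le_if_matched_linked[OF l k])
      fix x assume "x \<in> lab ` ?E"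
      then obtain a q where a: "a < k" "q \<in> {1..l}" "lab (a, q) = x" by auto
      then obtain b q' where b: "b < k" "q' \<in> {1..l}" "(b, q') \<noteq> (a, q)"
        "edge_letter g (f b) q' = edge_letter g (f a) q"
        using m unfolding matched_def by blast
      have "lab (b, q') = x" using eq'[OF b(1) a(1) b(2) a(2)] b(4) a(3) by simp
      then have "{(a, q), (b, q')} \<subseteq> (SIGMA a:{..<k}. {q \<in> {1..l}. lab (a, q) = x})"
        using a b by blast
      then have "card {(a, q), (b, q')} \<le> card (SIGMA a:{..<k}. {q \<in> {1..l}. lab (a, q) = x})"
        by (intro card_mono finite_SigmaI) auto
      moreover have "card {(a, q), (b, q')} = 2" using b(3) by (subst card_2_iff) metis
      ultimately show "2 \<le> (\<Sum>a<k. label_mult l lab a x)"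
        unfolding label_mult_def by (subst (asm) card_SigmaI) auto
    next
      fix a assume a: "a < k"
      then obtain b q q' where b: "b < k" "b \<noteq> a" "q \<in> {1..l}" "q' \<in> {1..l}"
        "edge_letter g (f b) q' = edge_letter g (f a) q"
        using lk unfolding linked_def by blast
      have "lab (b, q') = lab (a, q)" using eq'[OF b(1) a b(4,3)] b(5) by simp
      then show "\<exists>x. 0 < label_mult l lab a x \<and> (\<exists>b<k. b \<noteq> a \<and> 0 < label_mult l lab b x)"
        unfolding label_mult_pos_iff using b by blast
    qed
    then have "lab \<in> P" using lab by (simp add: P_def)
    moreover have "f \<in> realizations g n l lab {..<k}"
      unfolding realizations_def using circ eq' by simp
    ultimately show "f \<in> (\<Union>lab\<in>P. realizations g n l lab {..<k})" by blast
  qed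
  then have "card ?F \<le> card ?E ^ card ?E * B"
    by (rule card_le_pattern_union[rotated 2]) (auto simp: P_def finite_realizations)
  then show ?thesis by (simp add: B_def mult_ac)
qed

text \<open>Controls the circuits that are negligible in the mean: those without a unique letter
  that are not pair-matched.\<close>

theorem card_circuits_few_letters:
  assumes l: "1 \<le> l"
  shows "card {\<pi> \<in> circuits n l. card (edge_letter g \<pi> ` {1..l}) \<le> u} \<le> l ^ l * C ^ l * n ^ (1 + u)"
proof -
  let ?E = "{1..l}"
  let ?F = "{\<pi> \<in> circuits n l. card (edge_letter g \<pi> ` {1..l}) \<le> u}"
  let ?Q = "\<lambda>lab. circuits_following g n l lab {} (\<lambda>_. undefined)"
  define B where "B = n ^ (1 + u) * C ^ l"
  define P where "P = {lab \<in> ?E \<rightarrow>\<^sub>E ?E. card (lab ` ?E) \<le> u}"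
  have B: "card (?Q lab) \<le> B" if "lab \<in> P" for lab
  proof -
    have "card (?Q lab) \<le> n ^ (1 + card (lab ` ?E - {})) * C ^ l" by (rule card_circuits_follows[OF l])
    also have "\<dots> \<le> B"
      unfolding B_def using that n_pos by (intro mult_right_mono power_increasing) (auto simp: P_def)
    finally show ?thesis .
  qed
  have "?F \<subseteq> (\<Union>lab\<in>P. ?Q lab)"
  proof
    fix \<pi> assume \<pi>: "\<pi> \<in> ?F"
    obtain lab where lab: "lab \<in> ?E \<rightarrow>\<^sub>E ?E"
      and eq: "\<And>x y. x \<in> ?E \<Longrightarrow> y \<in> ?E \<Longrightarrow> lab x = lab y \<longleftrightarrow> edge_letter g \<pi> x = edge_letter g \<pi> y"
      using ex_pattern[of ?E "edge_letter g \<pi>"] by blast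
    have "card (lab ` ?E) \<le> card (edge_letter g \<pi> ` ?E)"
      using eq by (intro card_image_le_if_coarser) auto
    then have "lab \<in> P" using lab \<pi> by (simp add: P_def)
    moreover have "\<pi> \<in> ?Q lab" using \<pi> eq unfolding follows_def by simp
    ultimately show "\<pi> \<in> (\<Union>lab\<in>P. ?Q lab)" by blast
  qed
  then have "card ?F \<le> card ?E ^ card ?E * B"
    by (rule card_le_pattern_union[rotated 2]) (use B finite_circuits in \<open>auto simp: P_def\<close>)
  then show ?thesis by (simp add: B_def mult_ac)
qed

end

subsection \<open>Products of independent centred variables\<close>

text \<open>A class closed under sums and products, so integrability of every polynomial in the
  walks is immediate.\<close>

definition all_moments :: "'a measure \<Rightarrow> ('a \<Rightarrow> real) \<Rightarrow> bool" where
  "all_moments M f \<longleftrightarrow> f \<in> borel_measurable M \<and> (\<forall>p. integrable M (\<lambda>x. \<bar>f x\<bar> ^ p))"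

lemma all_moments_integrable: "all_moments M f \<Longrightarrow> integrable M f"
  unfolding all_moments_def by (auto dest: spec[of _ 1] simp: integrable_abs_iff)

lemma all_moments_mult:
  assumes "all_moments M f" "all_moments M g"
  shows "all_moments M (\<lambda>x. f x * g x)"
  unfolding all_moments_def
proof (intro conjI allI)
  have [measurable]: "f \<in> borel_measurable M" "g \<in> borel_measurable M"
    using assms by (auto simp: all_moments_def)
  show "(\<lambda>x. f x * g x) \<in> borel_measurable M" by measurable
  fix p
  show "integrable M (\<lambda>x. \<bar>f x * g x\<bar> ^ p)"
  proof (rule Bochner_Integration.integrable_bound)
    show "integrable M (\<lambda>x. \<bar>f x\<bar> ^ (2 * p) + \<bar>g x\<bar> ^ (2 * p))"
      using assms by (auto simp: all_moments_def)
    show "AE x in M. norm (\<bar>f x * g x\<bar> ^ p) \<le> norm (\<bar>f x\<bar> ^ (2 * p) + \<bar>g x\<bar> ^ (2 * p))"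
    proof (rule AE_I2)
      fix x
      let ?a = "\<bar>f x\<bar> ^ p" and ?b = "\<bar>g x\<bar> ^ p"
      have nn: "0 \<le> ?a" "0 \<le> ?b" by simp_all
      have "?a * ?b \<le> ?a\<^sup>2 + ?b\<^sup>2"
        using sum_squares_bound[of ?a ?b] mult_nonneg_nonneg[OF nn] by linarith
      then show "norm (\<bar>f x * g x\<bar> ^ p) \<le> norm (\<bar>f x\<bar> ^ (2 * p) + \<bar>g x\<bar> ^ (2 * p))"
        by (simp add: abs_mult power_mult_distrib power_mult[symmetric] mult.commute[of p])
    qed
  qed measurable
qed

lemma abs_add_power_le: "\<bar>a + b :: real\<bar> ^ p \<le> 2 ^ p * (\<bar>a\<bar> ^ p + \<bar>b\<bar> ^ p)"
proof -
  have "\<bar>a + b\<bar> ^ p \<le> (2 * max \<bar>a\<bar> \<bar>b\<bar>) ^ p" by (intro power_mono) auto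
  also have "\<dots> = 2 ^ p * (max \<bar>a\<bar> \<bar>b\<bar>) ^ p" by (rule power_mult_distrib)
  also have "\<dots> \<le> 2 ^ p * (\<bar>a\<bar> ^ p + \<bar>b\<bar> ^ p)" by (intro mult_left_mono) (auto simp: max_def)
  finally show ?thesis .
qed

lemma all_moments_add:
  assumes "all_moments M f" "all_moments M g"
  shows "all_moments M (\<lambda>x. f x + g x)"
  unfolding all_moments_def
proof (intro conjI allI)
  have [measurable]: "f \<in> borel_measurable M" "g \<in> borel_measurable M"
    using assms by (auto simp: all_moments_def)
  show "(\<lambda>x. f x + g x) \<in> borel_measurable M" by measurable
  fix p
  show "integrable M (\<lambda>x. \<bar>f x + g x\<bar> ^ p)"
  proof (rule Bochner_Integration.integrable_bound)
    show "integrable M (\<lambda>x. 2 ^ p * (\<bar>f x\<bar> ^ p + \<bar>g x\<bar> ^ p))"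
      using assms by (auto simp: all_moments_def)
    show "AE x in M. norm (\<bar>f x + g x\<bar> ^ p) \<le> norm (2 ^ p * (\<bar>f x\<bar> ^ p + \<bar>g x\<bar> ^ p))"
      using abs_add_power_le by (intro AE_I2) simp
  qed measurable
qed

context prob_space
begin

abbreviation abs_moment :: "nat \<Rightarrow> ('a \<Rightarrow> real) \<Rightarrow> real" where
  "abs_moment p f \<equiv> expectation (\<lambda>\<omega>. \<bar>f \<omega>\<bar> ^ p)"

lemma all_moments_const: "all_moments M (\<lambda>_. c)"
  by (simp add: all_moments_def)

lemma all_moments_diff_const:
  assumes "all_moments M f" shows "all_moments M (\<lambda>x. f x - c)"
  using all_moments_add[OF assms all_moments_const[of "- c"]] by simp

lemma all_moments_prod: "(\<And>i. i \<in> I \<Longrightarrow> all_moments M (f i)) \<Longrightarrow> all_moments M (\<lambda>x. \<Prod>i\<in>I. f i x)"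
  by (induction I rule: infinite_finite_induct) (auto intro: all_moments_const all_moments_mult)

lemma all_moments_sum: "(\<And>i. i \<in> I \<Longrightarrow> all_moments M (f i)) \<Longrightarrow> all_moments M (\<lambda>x. \<Sum>i\<in>I. f i x)"
  by (induction I rule: infinite_finite_induct) (auto intro: all_moments_const all_moments_add)

lemma all_moments_power: "all_moments M f \<Longrightarrow> all_moments M (\<lambda>x. f x ^ p)"
  by (induction p) (auto intro: all_moments_const all_moments_mult)

end

text \<open>The product is at most the \<open>card I\<close>th power of its largest factor. This
  takes the place of Hoelder's inequality and needs no independence, so repeated letters do no
  harm.\<close>

lemma abs_prod_le_sum_power:
  fixes x :: "'i \<Rightarrow> real"
  assumes "finite I" "I \<noteq> {}"
  shows "\<bar>\<Prod>i\<in>I. x i\<bar> \<le> (\<Sum>i\<in>I. \<bar>x i\<bar> ^ card I)"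
proof -
  let ?A = "(\<lambda>i. \<bar>x i\<bar>) ` I"
  have "Max ?A \<in> ?A" using assms by (intro Max_in) auto
  then obtain j where j: "j \<in> I" "Max ?A = \<bar>x j\<bar>" by auto
  have le: "\<bar>x i\<bar> \<le> \<bar>x j\<bar>" if "i \<in> I" for i
    unfolding j(2)[symmetric] using assms that by (intro Max_ge) auto
  have "\<bar>\<Prod>i\<in>I. x i\<bar> = (\<Prod>i\<in>I. \<bar>x i\<bar>)" by (rule abs_prod)
  also have "\<dots> \<le> (\<Prod>i\<in>I. \<bar>x j\<bar>)" using le by (intro prod_mono) auto
  also have "\<dots> = \<bar>x j\<bar> ^ card I" by simp
  also have "\<dots> \<le> (\<Sum>i\<in>I. \<bar>x i\<bar> ^ card I)"
    using assms j(1) by (intro member_le_sum) auto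
  finally show ?thesis .
qed

text \<open>Serves at two levels: for the single steps, to bound the moments of a walk, and for the
  walks themselves, indexed by the values of the link function.\<close>

locale indep_centered = prob_space M for M :: "'a measure" +
  fixes W :: "'r \<Rightarrow> 'a \<Rightarrow> real" and R :: "'r set"
  assumes indep: "indep_vars (\<lambda>_. borel) W R"
    and moments: "r \<in> R \<Longrightarrow> all_moments M (W r)"
    and centered: "r \<in> R \<Longrightarrow> expectation (W r) = 0"
begin

text \<open>\<open>F\<close> and \<open>G\<close> exhibit \<open>U\<close> and \<open>V\<close> as
  functions of disjoint groups of independent variables. The expectation therefore factorizes, and
  the factor of mean zero annihilates it.\<close>

lemma expectation_mult_disjoint_eq_0:
  fixes F G :: "('r \<Rightarrow> real) \<Rightarrow> real"
  assumes U: "\<And>\<omega>. F (\<lambda>r\<in>A. W r \<omega>) = U \<omega>" "integrable M U" "expectation U = 0"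
    and V: "\<And>\<omega>. G (\<lambda>r\<in>B. W r \<omega>) = V \<omega>" "integrable M V"
    and AB: "A \<inter> B = {}" "A \<subseteq> R" "B \<subseteq> R"
    and F: "F \<in> borel_measurable (PiM A (\<lambda>_. borel))" and G: "G \<in> borel_measurable (PiM B (\<lambda>_. borel))"
  shows "expectation (\<lambda>\<omega>. U \<omega> * V \<omega>) = 0"
proof -
  have "indep_var borel (F \<circ> (\<lambda>\<omega>. \<lambda>r\<in>A. W r \<omega>)) borel (G \<circ> (\<lambda>\<omega>. \<lambda>r\<in>B. W r \<omega>))"
    by (rule indep_var_compose[OF indep_var_restrict[OF indep AB] F G])
  then have "indep_var borel U borel V" unfolding o_def U(1) V(1) .
  then show ?thesis using U(2,3) V(2) by (simp add: indep_var_lebesgue_integral)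
qed

lemma expectation_prod_unique_factor:
  assumes I: "finite I" "\<And>i. i \<in> I \<Longrightarrow> s i \<in> R" and j: "j \<in> I" "\<And>i. i \<in> I \<Longrightarrow> i \<noteq> j \<Longrightarrow> s i \<noteq> s j"
  shows "expectation (\<lambda>\<omega>. \<Prod>i\<in>I. W (s i) \<omega>) = 0"
proof -
  let ?A = "{s j}" and ?B = "s ` (I - {j})"
  let ?F = "\<lambda>x. x (s j) :: real" and ?G = "\<lambda>x. \<Prod>i\<in>I - {j}. x (s i) :: real"
  have F: "?F (\<lambda>r\<in>?A. W r \<omega>) = W (s j) \<omega>" for \<omega> by simp
  have G: "?G (\<lambda>r\<in>?B. W r \<omega>) = (\<Prod>i\<in>I - {j}. W (s i) \<omega>)" for \<omega> by (intro prod.cong) auto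
  have "expectation (\<lambda>\<omega>. W (s j) \<omega> * (\<Prod>i\<in>I - {j}. W (s i) \<omega>)) = 0"
  proof (rule expectation_mult_disjoint_eq_0[where F = ?F and A = ?A and G = ?G and B = ?B, OF F _ _ G])
    show "?A \<inter> ?B = {}" using j(2) by force
    show "?A \<subseteq> R" "?B \<subseteq> R" using I j(1) by auto
    show "?F \<in> borel_measurable (PiM ?A (\<lambda>_. borel))"
      by (intro measurable_component_singleton) simp
    show "?G \<in> borel_measurable (PiM ?B (\<lambda>_. borel))"
      by (intro borel_measurable_prod measurable_component_singleton) simp
    show "integrable M (W (s j))" "expectation (W (s j)) = 0"
      using I j(1) by (auto intro: all_moments_integrable moments centered)
    show "integrable M (\<lambda>\<omega>. \<Prod>i\<in>I - {j}. W (s i) \<omega>)"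
      using I by (intro all_moments_integrable all_moments_prod moments) auto
  qed
  then show ?thesis by (simp add: prod.remove[OF I(1) j(1)])
qed

lemma expectation_abs_prod_le:
  assumes I: "finite I" "I \<noteq> {}" "\<And>i. i \<in> I \<Longrightarrow> s i \<in> R"
    and D: "\<And>r. r \<in> R \<Longrightarrow> abs_moment (card I) (W r) \<le> D"
  shows "expectation (\<lambda>\<omega>. \<bar>\<Prod>i\<in>I. W (s i) \<omega>\<bar>) \<le> real (card I) * D"
proof -
  have int: "integrable M (\<lambda>\<omega>. \<bar>W (s i) \<omega>\<bar> ^ card I)" if "i \<in> I" for i
    using moments[OF I(3)[OF that]] by (simp add: all_moments_def)
  have "expectation (\<lambda>\<omega>. \<bar>\<Prod>i\<in>I. W (s i) \<omega>\<bar>) \<le> expectation (\<lambda>\<omega>. \<Sum>i\<in>I. \<bar>W (s i) \<omega>\<bar> ^ card I)"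
  proof (rule integral_mono)
    show "integrable M (\<lambda>\<omega>. \<bar>\<Prod>i\<in>I. W (s i) \<omega>\<bar>)"
      using I by (intro integrable_abs all_moments_integrable all_moments_prod moments)
    show "integrable M (\<lambda>\<omega>. \<Sum>i\<in>I. \<bar>W (s i) \<omega>\<bar> ^ card I)"
      using int by (intro Bochner_Integration.integrable_sum)
  qed (rule abs_prod_le_sum_power[OF I(1,2)])
  also have "\<dots> = (\<Sum>i\<in>I. abs_moment (card I) (W (s i)))"
    using int by (intro Bochner_Integration.integral_sum)
  also have "\<dots> \<le> real (card I) * D"
    using D I(3) by (intro sum_bounded_above) auto
  finally show ?thesis .
qed

definition block :: "nat \<Rightarrow> (nat \<Rightarrow> 'r) \<Rightarrow> 'a \<Rightarrow> real" where
  "block l s \<omega> = (\<Prod>q=1..l. W (s q) \<omega>)"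

lemma all_moments_block:
  "(\<And>q. q \<in> {1..l} \<Longrightarrow> s q \<in> R) \<Longrightarrow> all_moments M (block l s)"
  unfolding block_def by (intro all_moments_prod moments)

text \<open>A letter without a partner makes the mean of its own block vanish, so the centring of
  that block disappears. The variable of this letter then splits off the whole product.\<close>

lemma expectation_prod_blocks_not_matched:
  fixes k :: nat
  assumes R: "\<And>a q. a < k \<Longrightarrow> q \<in> {1..l} \<Longrightarrow> s a q \<in> R"
    and a: "a < k" "p \<in> {1..l}"
      "\<And>b q. b < k \<Longrightarrow> q \<in> {1..l} \<Longrightarrow> (b, q) \<noteq> (a, p) \<Longrightarrow> s b q \<noteq> s a p"
  shows "expectation (\<lambda>\<omega>. \<Prod>b<k. (block l (s b) \<omega> - expectation (block l (s b)))) = 0"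
proof -
  define c where "c b = expectation (block l (s b))" for b
  let ?A = "{s a p}" and ?B = "(\<lambda>(b, q). s b q) ` ({..<k} \<times> {1..l} - {(a, p)})"
  let ?F = "\<lambda>x. x (s a p) :: real"
  let ?G = "\<lambda>x. (\<Prod>q\<in>{1..l} - {p}. x (s a q)) * (\<Prod>b\<in>{..<k} - {a}. (\<Prod>q=1..l. x (s b q)) - c b) :: real"
  have mem: "s b q \<in> ?B" if "b < k" "q \<in> {1..l}" "(b, q) \<noteq> (a, p)" for b q
    using that by (intro image_eqI[of _ _ "(b, q)"]) auto
  have "c a = 0"
    unfolding c_def block_def
    using R a by (intro expectation_prod_unique_factor[where j = p]) auto
  have F: "?F (\<lambda>r\<in>?A. W r \<omega>) = W (s a p) \<omega>" for \<omega> by simp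
  have G: "?G (\<lambda>r\<in>?B. W r \<omega>) =
      (\<Prod>q\<in>{1..l} - {p}. W (s a q) \<omega>) * (\<Prod>b\<in>{..<k} - {a}. block l (s b) \<omega> - c b)" for \<omega>
  proof -
    have "(\<Prod>q\<in>{1..l} - {p}. (\<lambda>r\<in>?B. W r \<omega>) (s a q)) = (\<Prod>q\<in>{1..l} - {p}. W (s a q) \<omega>)"
      by (intro prod.cong refl restrict_apply' mem) (use a in auto)
    moreover have "(\<Prod>q=1..l. (\<lambda>r\<in>?B. W r \<omega>) (s b q)) = block l (s b) \<omega>" if "b \<in> {..<k} - {a}" for b
      unfolding block_def by (intro prod.cong refl restrict_apply' mem) (use that in auto)
    ultimately show ?thesis by simp
  qed
  have "expectation (\<lambda>\<omega>. W (s a p) \<omega> *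
      ((\<Prod>q\<in>{1..l} - {p}. W (s a q) \<omega>) * (\<Prod>b\<in>{..<k} - {a}. block l (s b) \<omega> - c b))) = 0"
  proof (rule expectation_mult_disjoint_eq_0[where F = ?F and A = ?A and G = ?G and B = ?B, OF F _ _ G])
    show "?A \<inter> ?B = {}" using a(3) by fastforce
    show "?A \<subseteq> R" using R[OF a(1,2)] by simp
    show "?B \<subseteq> R" using R by auto
    show "?F \<in> borel_measurable (PiM ?A (\<lambda>_. borel))"
      by (intro measurable_component_singleton) simp
    show "?G \<in> borel_measurable (PiM ?B (\<lambda>_. borel))"
      by (intro borel_measurable_times borel_measurable_prod borel_measurable_diff
          borel_measurable_const measurable_component_singleton mem) (use a in auto)
    show "integrable M (W (s a p))" "expectation (W (s a p)) = 0"
      using R[OF a(1,2)] by (auto intro: all_moments_integrable moments centered)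
    show "integrable M (\<lambda>\<omega>. (\<Prod>q\<in>{1..l} - {p}. W (s a q) \<omega>) * (\<Prod>b\<in>{..<k} - {a}. block l (s b) \<omega> - c b))"
      using R a(1)
      by (intro all_moments_integrable all_moments_mult all_moments_prod all_moments_diff_const
          all_moments_block moments) auto
  qed
  moreover have "(\<Prod>b<k. block l (s b) \<omega> - c b)
    = W (s a p) \<omega> * ((\<Prod>q\<in>{1..l} - {p}. W (s a q) \<omega>) * (\<Prod>b\<in>{..<k} - {a}. block l (s b) \<omega> - c b))" for \<omega>
  proof -
    have "block l (s a) \<omega> = W (s a p) \<omega> * (\<Prod>q\<in>{1..l} - {p}. W (s a q) \<omega>)"
      unfolding block_def using a(2) by (intro prod.remove) auto
    then show ?thesis using a(1) \<open>c a = 0\<close> by (simp add: prod.remove[of "{..<k}" a] mult.assoc)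
  qed
  ultimately show ?thesis
    unfolding c_def[symmetric] by simp
qed

text \<open>Block \<open>a\<close> uses variables that occur in no other block; once centred, it is
  an independent factor of mean zero.\<close>

lemma expectation_prod_blocks_not_linked:
  fixes k :: nat
  assumes R: "\<And>a q. a < k \<Longrightarrow> q \<in> {1..l} \<Longrightarrow> s a q \<in> R"
    and a: "a < k"
      "\<And>b q q'. b < k \<Longrightarrow> b \<noteq> a \<Longrightarrow> q \<in> {1..l} \<Longrightarrow> q' \<in> {1..l} \<Longrightarrow> s b q' \<noteq> s a q"
  shows "expectation (\<lambda>\<omega>. \<Prod>b<k. (block l (s b) \<omega> - expectation (block l (s b)))) = 0"
proof -
  define c where "c b = expectation (block l (s b))" for b
  let ?A = "s a ` {1..l}" and ?B = "(\<lambda>(b, q). s b q) ` (({..<k} - {a}) \<times> {1..l})"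
  let ?F = "\<lambda>x. (\<Prod>q=1..l. x (s a q)) - c a :: real"
  let ?G = "\<lambda>x. \<Prod>b\<in>{..<k} - {a}. (\<Prod>q=1..l. x (s b q)) - c b :: real"
  have mem: "s b q \<in> ?B" if "b \<in> {..<k} - {a}" "q \<in> {1..l}" for b q
    using that by (intro image_eqI[of _ _ "(b, q)"]) auto
  have F: "?F (\<lambda>r\<in>?A. W r \<omega>) = block l (s a) \<omega> - c a" for \<omega>
    by (simp add: block_def)
  have G: "?G (\<lambda>r\<in>?B. W r \<omega>) = (\<Prod>b\<in>{..<k} - {a}. block l (s b) \<omega> - c b)" for \<omega>
  proof (rule prod.cong[OF refl])
    fix b assume b: "b \<in> {..<k} - {a}"
    have "(\<Prod>q=1..l. (\<lambda>r\<in>?B. W r \<omega>) (s b q)) = block l (s b) \<omega>"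
      unfolding block_def by (intro prod.cong refl restrict_apply' mem b)
    then show "(\<Prod>q=1..l. (\<lambda>r\<in>?B. W r \<omega>) (s b q)) - c b = block l (s b) \<omega> - c b" by simp
  qed
  have "expectation (\<lambda>\<omega>. (block l (s a) \<omega> - c a) * (\<Prod>b\<in>{..<k} - {a}. block l (s b) \<omega> - c b)) = 0"
  proof (rule expectation_mult_disjoint_eq_0[where F = ?F and A = ?A and G = ?G and B = ?B, OF F _ _ G])
    show "?A \<inter> ?B = {}" using a(2) by fastforce
    show "?A \<subseteq> R" "?B \<subseteq> R" using R a by auto
    show "?F \<in> borel_measurable (PiM ?A (\<lambda>_. borel))"
      by (intro borel_measurable_prod borel_measurable_diff
          borel_measurable_const measurable_component_singleton imageI)
    show "?G \<in> borel_measurable (PiM ?B (\<lambda>_. borel))"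
      by (intro borel_measurable_prod borel_measurable_diff
          borel_measurable_const measurable_component_singleton mem)
    have "integrable M (block l (s a))"
      using R a by (intro all_moments_integrable all_moments_block) auto
    then show "integrable M (\<lambda>\<omega>. block l (s a) \<omega> - c a)" "expectation (\<lambda>\<omega>. block l (s a) \<omega> - c a) = 0"
      by (simp_all add: c_def prob_space)
    show "integrable M (\<lambda>\<omega>. \<Prod>b\<in>{..<k} - {a}. block l (s b) \<omega> - c b)"
      using R by (intro all_moments_integrable all_moments_prod all_moments_diff_const all_moments_block) auto
  qed
  moreover have "(\<Prod>b<k. block l (s b) \<omega> - c b)
    = (block l (s a) \<omega> - c a) * (\<Prod>b\<in>{..<k} - {a}. block l (s b) \<omega> - c b)" for \<omega>
    using a(1) by (intro prod.remove) auto
  ultimately show ?thesis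
    unfolding c_def[symmetric] by simp
qed

text \<open>The scale \<open>\<tau>\<close> of the variables is kept apart so that the remaining
  constant depends on neither \<open>n\<close> nor \<open>t\<close> when
  \<open>\<tau> = sqrt (n t)\<close>. The 16 is the \<open>2 ^ 4\<close> of
  \<open>abs_add_power_le\<close>.\<close>

lemma fourth_moment_block_le:
  assumes l: "1 \<le> l" and R: "\<And>q. q \<in> {1..l} \<Longrightarrow> s q \<in> R"
    and D1: "\<And>r. r \<in> R \<Longrightarrow> abs_moment l (W r) \<le> D1 * \<tau> ^ l"
    and D4: "\<And>r. r \<in> R \<Longrightarrow> abs_moment (4 * l) (W r) \<le> D4 * \<tau> ^ (4 * l)"
  shows "expectation (\<lambda>\<omega>. (block l s \<omega> - expectation (block l s)) ^ 4)
    \<le> 16 * (real l * D4 + (real l * D1) ^ 4) * \<tau> ^ (4 * l)"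
proof -
  let ?P = "block l s"
  define c where "c = expectation ?P"
  have mom: "all_moments M ?P" using R by (rule all_moments_block)
  have "\<bar>c\<bar> \<le> expectation (\<lambda>\<omega>. \<bar>?P \<omega>\<bar>)" unfolding c_def by (rule integral_abs_bound)
  also have "\<dots> \<le> real (card {1..l}) * (D1 * \<tau> ^ l)"
    unfolding block_def using l R D1 by (intro expectation_abs_prod_le) auto
  finally have "\<bar>c\<bar> ^ 4 \<le> (real l * (D1 * \<tau> ^ l)) ^ 4" by (intro power_mono) auto
  then have c4: "\<bar>c\<bar> ^ 4 \<le> (real l * D1) ^ 4 * \<tau> ^ (4 * l)"
    by (simp add: power_mult_distrib power_mult[symmetric] mult.commute mult.left_commute)
  have P4: "abs_moment 4 ?P \<le> real l * (D4 * \<tau> ^ (4 * l))"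
  proof -
    have int: "integrable M (\<lambda>\<omega>. \<bar>W (s q) \<omega>\<bar> ^ (4 * l))" if "q \<in> {1..l}" for q
      using moments[OF R[OF that]] by (simp add: all_moments_def)
    have "abs_moment 4 ?P \<le> expectation (\<lambda>\<omega>. \<Sum>q=1..l. \<bar>W (s q) \<omega>\<bar> ^ (4 * l))"
    proof (rule integral_mono)
      show "integrable M (\<lambda>\<omega>. \<bar>?P \<omega>\<bar> ^ 4)"
        using mom unfolding all_moments_def by blast
      show "integrable M (\<lambda>\<omega>. \<Sum>q=1..l. \<bar>W (s q) \<omega>\<bar> ^ (4 * l))"
        using int by (intro Bochner_Integration.integrable_sum)
      fix \<omega>
      have "\<bar>?P \<omega>\<bar> ^ 4 = \<bar>\<Prod>q=1..l. W (s q) \<omega> ^ 4\<bar>"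
        by (simp only: block_def prod_power_distrib[symmetric] power_abs)
      also have "\<dots> \<le> (\<Sum>q=1..l. \<bar>W (s q) \<omega> ^ 4\<bar> ^ card {1..l})"
        using l by (intro abs_prod_le_sum_power) auto
      also have "\<dots> = (\<Sum>q=1..l. \<bar>W (s q) \<omega>\<bar> ^ (4 * l))"
        by (simp only: power_abs[symmetric] power_mult card_atLeastAtMost) simp
      finally show "\<bar>?P \<omega>\<bar> ^ 4 \<le> (\<Sum>q=1..l. \<bar>W (s q) \<omega>\<bar> ^ (4 * l))" .
    qed
    also have "\<dots> = (\<Sum>q=1..l. abs_moment (4 * l) (W (s q)))"
      using int by (intro Bochner_Integration.integral_sum)
    also have "\<dots> \<le> real (card {1..l}) * (D4 * \<tau> ^ (4 * l))"
      using D4 R by (intro sum_bounded_above) auto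
    finally show ?thesis by simp
  qed
  have int4: "integrable M (\<lambda>\<omega>. ?P \<omega> ^ 4)"
    using mom by (intro all_moments_integrable all_moments_power)
  have "expectation (\<lambda>\<omega>. (?P \<omega> - c) ^ 4) \<le> expectation (\<lambda>\<omega>. 16 * (\<bar>?P \<omega>\<bar> ^ 4 + \<bar>c\<bar> ^ 4))"
  proof (rule integral_mono)
    show "integrable M (\<lambda>\<omega>. (?P \<omega> - c) ^ 4)"
      using mom by (intro all_moments_integrable all_moments_power all_moments_diff_const)
    show "integrable M (\<lambda>\<omega>. 16 * (\<bar>?P \<omega>\<bar> ^ 4 + \<bar>c\<bar> ^ 4))" using int4 by simp
    fix \<omega>
    show "(?P \<omega> - c) ^ 4 \<le> 16 * (\<bar>?P \<omega>\<bar> ^ 4 + \<bar>c\<bar> ^ 4)"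
      using abs_add_power_le[of "?P \<omega>" "- c" 4] by simp
  qed
  also have "\<dots> = 16 * (abs_moment 4 ?P + \<bar>c\<bar> ^ 4)"
    using int4 by (simp add: prob_space)
  also have "\<dots> \<le> 16 * (real l * (D4 * \<tau> ^ (4 * l)) + (real l * D1) ^ 4 * \<tau> ^ (4 * l))"
    using P4 c4 by simp
  finally show ?thesis unfolding c_def by (simp add: algebra_simps)
qed

end

section \<open>Moments of sums of independent centred variables\<close>

lemma two_card_image_le:
  assumes E: "finite E" and twin: "\<And>x. x \<in> E \<Longrightarrow> \<exists>y\<in>E. y \<noteq> x \<and> h y = h x"
  shows "2 * card (h ` E) \<le> card E"
proof -
  have "2 \<le> card {x \<in> E. h x = r}" if r: "r \<in> h ` E" for r
  proof -
    obtain x where x: "x \<in> E" "h x = r" using r by auto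
    obtain y where y: "y \<in> E" "y \<noteq> x" "h y = h x" using twin[OF x(1)] by auto
    have "card {x, y} \<le> card {x \<in> E. h x = r}" using E x y by (intro card_mono) auto
    then show ?thesis using y(2) by simp
  qed
  then have "(\<Sum>r\<in>h ` E. 2) \<le> (\<Sum>r\<in>h ` E. card {x \<in> E. h x = r})" by (intro sum_mono)
  also have "\<dots> = card E" using sum.image_gen[OF E, of "\<lambda>_. 1 :: nat" h] by simp
  finally show ?thesis by simp
qed

text \<open>A map is recovered from its pattern of coincidences and its values on the at most
  \<open>p\<close> classes.\<close>

lemma card_PiE_small_image:
  assumes E: "finite E" and B: "finite B" "1 \<le> card B"
  shows "card {f \<in> E \<rightarrow>\<^sub>E B. card (f ` E) \<le> p} \<le> card E ^ card E * card B ^ p"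
proof -
  let ?F = "{f \<in> E \<rightarrow>\<^sub>E B. card (f ` E) \<le> p}"
  let ?Q = "\<lambda>lab. (\<lambda>g. \<lambda>x\<in>E. g (lab x)) ` (lab ` E \<rightarrow>\<^sub>E B)"
  define P where "P = {lab \<in> E \<rightarrow>\<^sub>E E. card (lab ` E) \<le> p}"
  have fin: "finite (lab ` E \<rightarrow>\<^sub>E B)" for lab :: "'a \<Rightarrow> 'a" using E B by (intro finite_PiE) auto
  have Q: "card (?Q lab) \<le> card B ^ p" if "lab \<in> P" for lab
  proof -
    have "card (?Q lab) \<le> card (lab ` E \<rightarrow>\<^sub>E B)" using fin by (rule card_image_le)
    also have "\<dots> = card B ^ card (lab ` E)" using E by (simp add: card_PiE)
    also have "\<dots> \<le> card B ^ p" using that B by (intro power_increasing) (auto simp: P_def)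
    finally show ?thesis .
  qed
  have "?F \<subseteq> (\<Union>lab\<in>P. ?Q lab)"
  proof
    fix f assume f: "f \<in> ?F"
    obtain lab where lab: "lab \<in> E \<rightarrow>\<^sub>E E"
      and eq: "\<And>x y. x \<in> E \<Longrightarrow> y \<in> E \<Longrightarrow> lab x = lab y \<longleftrightarrow> f x = f y"
      using ex_pattern[OF E, of f] by blast
    have "card (lab ` E) \<le> card (f ` E)" using eq E by (intro card_image_le_if_coarser) auto
    then have "lab \<in> P" using lab f by (simp add: P_def)
    moreover have "f \<in> ?Q lab"
    proof (rule image_eqI)
      let ?g = "\<lambda>z\<in>lab ` E. f (inv_into E lab z)"
      have inv: "inv_into E lab (lab x) \<in> E" "lab (inv_into E lab (lab x)) = lab x" if "x \<in> E" for x
        using that by (auto intro: inv_into_into f_inv_into_f)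
      have f_inv: "f (inv_into E lab (lab x)) = f x" if "x \<in> E" for x
        using eq[OF inv(1)[OF that] that] inv(2)[OF that] by simp
      have fB: "f x \<in> B" if "x \<in> E" for x using f that by auto
      show "?g \<in> lab ` E \<rightarrow>\<^sub>E B" using inv(1) fB by auto
      show "f = (\<lambda>x\<in>E. ?g (lab x))"
      proof (rule extensionalityI)
        show "f \<in> extensional E" using f by (auto simp: PiE_def)
        show "(\<lambda>x\<in>E. ?g (lab x)) \<in> extensional E" by simp
        fix x assume "x \<in> E"
        then show "f x = (\<lambda>x\<in>E. ?g (lab x)) x" using f_inv by simp
      qed
    qed
    ultimately show "f \<in> (\<Union>lab\<in>P. ?Q lab)" by blast
  qed
  then show ?thesis
    by (rule card_le_pattern_union[rotated 2]) (use E fin Q in \<open>auto simp: P_def\<close>)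
qed

lemma power_sum_eq_PiE_sum:
  fixes x :: "'i \<Rightarrow> 'c :: comm_ring_1"
  assumes "finite S"
  shows "(\<Sum>i\<in>S. x i) ^ m = (\<Sum>f\<in>{..<m} \<rightarrow>\<^sub>E S. \<Prod>j<m. x (f j))"
proof -
  have "(\<Sum>i\<in>S. x i) ^ m = (\<Prod>j<m. \<Sum>i\<in>S. x i)" by simp
  also have "\<dots> = (\<Sum>f\<in>{..<m} \<rightarrow>\<^sub>E S. \<Prod>j<m. x (f j))"
    using assms by (intro prod_sum_PiE) auto
  finally show ?thesis .
qed

lemma abs_power_le_one_plus:
  assumes "p \<le> q" shows "\<bar>x :: real\<bar> ^ p \<le> 1 + \<bar>x\<bar> ^ q"
proof (cases "\<bar>x\<bar> \<le> 1")
  case True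
  then have "\<bar>x\<bar> ^ p \<le> 1" by (simp add: power_le_one)
  then show ?thesis by (simp add: add_increasing2)
next
  case False
  then have "\<bar>x\<bar> ^ p \<le> \<bar>x\<bar> ^ q" using assms by (intro power_increasing) auto
  then show ?thesis by simp
qed

context indep_centered
begin

text \<open>In the expanded power, a term with an index occurring once has mean zero. In every other
  term the \<open>2 * p\<close> factors use at most \<open>p\<close> indices, so only
  \<open>O(card S ^ p)\<close> terms survive, with a constant independent of
  \<open>S\<close>.\<close>

lemma even_moment_sum_le:
  assumes S: "finite S" "S \<subseteq> R" "1 \<le> card S" and p: "1 \<le> p"
    and D: "\<And>r. r \<in> R \<Longrightarrow> abs_moment (2 * p) (W r) \<le> D"
  shows "expectation (\<lambda>\<omega>. (\<Sum>r\<in>S. W r \<omega>) ^ (2 * p))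
    \<le> real ((2 * p) ^ (2 * p)) * (real (2 * p) * D) * real (card S) ^ p"
proof -
  let ?I = "{..<2 * p}"
  let ?F = "?I \<rightarrow>\<^sub>E S" and ?G = "{f \<in> ?I \<rightarrow>\<^sub>E S. card (f ` ?I) \<le> p}"
  let ?e = "\<lambda>f. expectation (\<lambda>\<omega>. \<Prod>i\<in>?I. W (f i) \<omega>)"
  have mem: "f i \<in> R" if "f \<in> ?F" "i \<in> ?I" for f i using that S by auto
  have finF: "finite ?F" using S by (intro finite_PiE) auto
  have int: "integrable M (\<lambda>\<omega>. \<Prod>i\<in>?I. W (f i) \<omega>)" if "f \<in> ?F" for f
    using mem[OF that] by (intro all_moments_integrable all_moments_prod moments)
  have "expectation (\<lambda>\<omega>. (\<Sum>r\<in>S. W r \<omega>) ^ (2 * p)) = (\<Sum>f\<in>?F. ?e f)"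
    unfolding power_sum_eq_PiE_sum[OF S(1)] using int by (rule Bochner_Integration.integral_sum)
  also have "\<dots> = (\<Sum>f\<in>?G. ?e f)"
  proof (rule sum.mono_neutral_right[OF finF])
    show "\<forall>f\<in>?F - ?G. ?e f = 0"
    proof
      fix f assume f: "f \<in> ?F - ?G"
      have "\<exists>j\<in>?I. \<forall>i\<in>?I. i \<noteq> j \<longrightarrow> f i \<noteq> f j"
      proof (rule ccontr)
        assume "\<not> ?thesis"
        then have "2 * card (f ` ?I) \<le> card ?I" by (intro two_card_image_le) auto
        then show False using f by auto
      qed
      then obtain j where "j \<in> ?I" "\<And>i. i \<in> ?I \<Longrightarrow> i \<noteq> j \<Longrightarrow> f i \<noteq> f j" by blast
      then show "?e f = 0" using f mem by (intro expectation_prod_unique_factor) auto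
    qed
  qed auto
  also have "\<dots> \<le> real (card ?G) * (real (2 * p) * D)"
  proof (rule sum_bounded_above)
    fix f assume f: "f \<in> ?G"
    have "?e f \<le> expectation (\<lambda>\<omega>. \<bar>\<Prod>i\<in>?I. W (f i) \<omega>\<bar>)"
      using int f by (intro integral_mono integrable_abs) auto
    also have "\<dots> \<le> real (card ?I) * D"
      using f p mem D by (intro expectation_abs_prod_le) (auto simp: lessThan_empty_iff)
    finally show "?e f \<le> real (2 * p) * D" by simp
  qed
  also have "\<dots> \<le> real ((2 * p) ^ (2 * p) * card S ^ p) * (real (2 * p) * D)"
  proof (rule mult_right_mono)
    show "real (card ?G) \<le> real ((2 * p) ^ (2 * p) * card S ^ p)"
      using card_PiE_small_image[of ?I S p] S by (simp only: of_nat_le_iff card_lessThan finite_lessThan)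
    obtain r where "r \<in> R" using S by (metis One_nat_def Suc_n_not_le_n card.empty subset_eq ex_in_conv le0 not_less_eq_eq)
    have "0 \<le> abs_moment (2 * p) (W r)" by (intro Bochner_Integration.integral_nonneg) simp
    then have "0 \<le> D" using D[OF \<open>r \<in> R\<close>] by linarith
    then show "0 \<le> real (2 * p) * D" by simp
  qed
  finally show ?thesis by (simp add: mult_ac)
qed

text \<open>Obtained from the moment of order \<open>2 * p\<close> through
  \<open>abs y ^ p <= 1 + abs y ^ (2 * p)\<close>, applied to the sum divided by
  \<open>sqrt (card S)\<close>; dividing first is what produces the right power of
  \<open>card S\<close>.\<close>

lemma abs_moment_sum_le:
  assumes S: "finite S" "S \<subseteq> R"
    and D: "\<And>r. r \<in> R \<Longrightarrow> abs_moment (2 * p) (W r) \<le> D" and "0 \<le> D"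
  shows "expectation (\<lambda>\<omega>. \<bar>\<Sum>r\<in>S. W r \<omega>\<bar> ^ p)
    \<le> (1 + real ((2 * p) ^ (2 * p)) * (real (2 * p) * D)) * sqrt (real (card S)) ^ p"
proof (cases "p = 0 \<or> card S = 0")
  case True
  then show ?thesis
  proof
    assume "p = 0" then show ?thesis by (simp add: prob_space)
  next
    assume "card S = 0"
    then have "S = {}" using S by simp
    then show ?thesis using \<open>0 \<le> D\<close> by (cases "p = 0") (simp_all add: prob_space zero_power)
  qed
next
  case False
  define \<sigma> where "\<sigma> = sqrt (real (card S))"
  let ?f = "\<lambda>\<omega>. \<Sum>r\<in>S. W r \<omega>"
  define K where "K = real ((2 * p) ^ (2 * p)) * (real (2 * p) * D)"
  have \<sigma>: "0 < \<sigma>" "\<sigma> ^ (2 * p) = real (card S) ^ p"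
    using False by (auto simp: \<sigma>_def power_mult)
  have mom: "all_moments M ?f" using S by (intro all_moments_sum moments) auto
  have pt: "\<bar>?f \<omega>\<bar> ^ p \<le> \<sigma> ^ p * (1 + ?f \<omega> ^ (2 * p) / \<sigma> ^ (2 * p))" for \<omega>
  proof -
    have "\<bar>?f \<omega> / \<sigma>\<bar> ^ p \<le> 1 + \<bar>?f \<omega> / \<sigma>\<bar> ^ (2 * p)" by (rule abs_power_le_one_plus) simp
    moreover have "\<bar>?f \<omega> / \<sigma>\<bar> ^ (2 * p) = ?f \<omega> ^ (2 * p) / \<sigma> ^ (2 * p)"
      by (simp add: power_even_abs power_divide)
    moreover have "\<bar>?f \<omega> / \<sigma>\<bar> ^ p = \<bar>?f \<omega>\<bar> ^ p / \<sigma> ^ p"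
      using \<sigma>(1) by (simp add: power_divide)
    ultimately show ?thesis using \<sigma>(1) by (simp add: pos_divide_le_eq mult.commute)
  qed
  have int: "integrable M (\<lambda>\<omega>. ?f \<omega> ^ (2 * p))"
    using mom by (intro all_moments_integrable all_moments_power)
  have "abs_moment p ?f \<le> expectation (\<lambda>\<omega>. \<sigma> ^ p * (1 + ?f \<omega> ^ (2 * p) / \<sigma> ^ (2 * p)))"
    using mom int unfolding all_moments_def by (intro integral_mono pt) auto
  also have "\<dots> = \<sigma> ^ p * (1 + expectation (\<lambda>\<omega>. ?f \<omega> ^ (2 * p)) / \<sigma> ^ (2 * p))"
    using int by (simp add: prob_space)
  also have "\<dots> \<le> \<sigma> ^ p * (1 + K * real (card S) ^ p / \<sigma> ^ (2 * p))"
  proof -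
    have "1 \<le> card S" "1 \<le> p" using False by simp_all
    then have "expectation (\<lambda>\<omega>. ?f \<omega> ^ (2 * p)) \<le> K * real (card S) ^ p"
      unfolding K_def using S D by (intro even_moment_sum_le) auto
    then show ?thesis using \<sigma>(1) by (intro mult_left_mono add_left_mono divide_right_mono) auto
  qed
  also have "\<dots> = (1 + K) * \<sigma> ^ p" using \<sigma> False by simp
  finally show ?thesis unfolding K_def \<sigma>_def .
qed

lemma second_moment_sum:
  assumes S: "finite S" "S \<subseteq> R" and var: "\<And>r. r \<in> R \<Longrightarrow> expectation (\<lambda>\<omega>. (W r \<omega>)\<^sup>2) = 1"
  shows "expectation (\<lambda>\<omega>. (\<Sum>r\<in>S. W r \<omega>)\<^sup>2) = real (card S)"
proof -
  have int: "integrable M (\<lambda>\<omega>. W r \<omega> * W r' \<omega>)" if "r \<in> S" "r' \<in> S" for r r'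
    using that S by (intro all_moments_integrable all_moments_mult moments) auto
  have cov: "expectation (\<lambda>\<omega>. W r \<omega> * W r' \<omega>) = of_bool (r = r')" if "r \<in> S" "r' \<in> S" for r r'
  proof (cases "r = r'")
    case True
    then show ?thesis using var[of r] that S by (auto simp: power2_eq_square)
  next
    case False
    have "expectation (\<lambda>\<omega>. \<Prod>i\<in>{r, r'}. W (id i) \<omega>) = 0"
      using that S False by (intro expectation_prod_unique_factor[where j = r]) auto
    then show ?thesis using False by simp
  qed
  have "expectation (\<lambda>\<omega>. (\<Sum>r\<in>S. W r \<omega>)\<^sup>2) = expectation (\<lambda>\<omega>. \<Sum>r\<in>S. \<Sum>r'\<in>S. W r \<omega> * W r' \<omega>)"
    by (simp add: power2_eq_square sum_product)
  also have "\<dots> = (\<Sum>r\<in>S. \<Sum>r'\<in>S. expectation (\<lambda>\<omega>. W r \<omega> * W r' \<omega>))"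
    using int by (subst Bochner_Integration.integral_sum)
      (auto intro!: sum.cong Bochner_Integration.integral_sum Bochner_Integration.integrable_sum)
  also have "\<dots> = (\<Sum>r\<in>S. \<Sum>r'\<in>S. of_bool (r = r'))" using cov by (intro sum.cong refl) auto
  also have "\<dots> = real (card S)" using S(1) by simp
  finally show ?thesis .
qed

end

subsection \<open>Moments of the random walks\<close>

text \<open>Assumption I speaks of uniform moments of order at least 3; powers of lower order are
  dominated by one plus the third power.\<close>

lemma (in prob_space) all_moments_if_large_moments:
  assumes "f \<in> borel_measurable M" and int: "\<And>p. 3 \<le> p \<Longrightarrow> integrable M (\<lambda>\<omega>. \<bar>f \<omega>\<bar> ^ p)"
  shows "all_moments M f"
  unfolding all_moments_def
proof (intro conjI allI)
  fix p
  show "integrable M (\<lambda>\<omega>. \<bar>f \<omega>\<bar> ^ p)"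
  proof (rule Bochner_Integration.integrable_bound)
    show "integrable M (\<lambda>\<omega>. 1 + \<bar>f \<omega>\<bar> ^ max 3 p)" using int[of "max 3 p"] by simp
    show "AE \<omega> in M. norm (\<bar>f \<omega>\<bar> ^ p) \<le> norm (1 + \<bar>f \<omega>\<bar> ^ max 3 p)"
    proof (rule AE_I2)
      fix \<omega>
      show "norm (\<bar>f \<omega>\<bar> ^ p) \<le> norm (1 + \<bar>f \<omega>\<bar> ^ max 3 p)"
        using abs_power_le_one_plus[of p "max 3 p" "f \<omega>"] by simp
    qed
  qed (use assms(1) in measurable)
qed (rule assms(1))

locale input_variables = prob_space M for M :: "'a measure" +
  fixes X :: "nat list \<Rightarrow> nat \<Rightarrow> 'a \<Rightarrow> real"
  assumes input: "assumption_I M X"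
begin

abbreviation "index_set \<equiv> (Zplus 1 \<union> Zplus 2) \<times> {1 :: nat..}"

lemma input_indep: "indep_vars (\<lambda>_. borel) (\<lambda>(r, k). X r k) index_set"
  using input by (simp add: assumption_I_def)

lemma input_measurable: "r \<in> Zplus 1 \<union> Zplus 2 \<Longrightarrow> 1 \<le> k \<Longrightarrow> X r k \<in> borel_measurable M"
  using input_indep unfolding indep_vars_def by force

lemma Zplus_cases:
  assumes "r \<in> Zplus 1 \<union> Zplus 2"
  obtains i where "r = [i]" | i j where "r = [i, j]"
  using assms by (auto simp: Zplus_def length_Suc_conv numeral_2_eq_2)

text \<open>The supremum in the assumption is taken over sums of one variable of each kind. Dropping
  a nonnegative summand bounds either kind; for \<open>r = [i]\<close> the second index
  \<open>j\<close> is arbitrary.\<close>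

lemma large_moment_bound:
  assumes p: "3 \<le> p"
  shows "\<exists>m. \<forall>r\<in>Zplus 1 \<union> Zplus 2. \<forall>k\<ge>1. integrable M (\<lambda>\<omega>. \<bar>X r k \<omega>\<bar> ^ p) \<and>
    abs_moment p (X r k) \<le> m"
proof -
  let ?I = "\<lambda>(i, j, k). \<integral>\<^sup>+\<omega>. ennreal (\<bar>X [i, j] k \<omega>\<bar> ^ p + \<bar>X [i] k \<omega>\<bar> ^ p) \<partial>M"
  define s where "s = (SUP ijk\<in>UNIV \<times> UNIV \<times> {1..}. ?I ijk)"
  have s: "s < \<infinity>"
    using input p unfolding assumption_I_def s_def by (simp add: split_def)
  have "integrable M (\<lambda>\<omega>. \<bar>X r k \<omega>\<bar> ^ p) \<and> abs_moment p (X r k) \<le> enn2real s"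
    if r: "r \<in> Zplus 1 \<union> Zplus 2" and k: "1 \<le> k" for r k
  proof -
    have "(\<integral>\<^sup>+\<omega>. ennreal (\<bar>X r k \<omega>\<bar> ^ p) \<partial>M) \<le> s"
    proof -
      have "\<exists>i j. r = [i, j] \<or> r = [i]" using Zplus_cases[OF r] by metis
      then obtain i j where ij: "r = [i, j] \<or> r = [i]" by blast
      then have "(\<integral>\<^sup>+\<omega>. ennreal (\<bar>X r k \<omega>\<bar> ^ p) \<partial>M) \<le> ?I (i, j, k)"
        unfolding split_def fst_conv snd_conv
        by (intro nn_integral_mono ennreal_leI) auto
      also have "\<dots> \<le> s" unfolding s_def using k by (intro SUP_upper) auto
      finally show ?thesis .
    qed
    moreover have "(\<lambda>\<omega>. \<bar>X r k \<omega>\<bar> ^ p) \<in> borel_measurable M"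
      using input_measurable[OF r k] by measurable
    ultimately have int: "integrable M (\<lambda>\<omega>. \<bar>X r k \<omega>\<bar> ^ p)"
      using s by (intro integrableI_bounded) (auto intro: le_less_trans)
    have "ennreal (abs_moment p (X r k)) \<le> s"
      using int \<open>(\<integral>\<^sup>+\<omega>. ennreal (\<bar>X r k \<omega>\<bar> ^ p) \<partial>M) \<le> s\<close>
      by (subst nn_integral_eq_integral[symmetric]) auto
    also have "s = ennreal (enn2real s)" using s by (simp add: ennreal_enn2real)
    finally have "abs_moment p (X r k) \<le> enn2real s" by (simp add: ennreal_le_iff)
    with int show ?thesis by simp
  qed
  then show ?thesis by blast
qed

lemma input_all_moments: "r \<in> Zplus 1 \<union> Zplus 2 \<Longrightarrow> 1 \<le> k \<Longrightarrow> all_moments M (X r k)"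
  using large_moment_bound by (intro all_moments_if_large_moments input_measurable) blast+

lemma moment_bound:
  "\<exists>m\<ge>0. \<forall>r\<in>Zplus 1 \<union> Zplus 2. \<forall>k\<ge>1. abs_moment p (X r k) \<le> m"
proof -
  obtain m where m: "\<And>r k. r \<in> Zplus 1 \<union> Zplus 2 \<Longrightarrow> 1 \<le> k \<Longrightarrow>
      abs_moment (max 3 p) (X r k) \<le> m"
    using large_moment_bound[of "max 3 p"] by auto
  have "abs_moment p (X r k) \<le> 1 + \<bar>m\<bar>" if r: "r \<in> Zplus 1 \<union> Zplus 2" "1 \<le> k" for r k
  proof -
    have int: "integrable M (\<lambda>\<omega>. \<bar>X r k \<omega>\<bar> ^ q)" for q
      using input_all_moments[OF r] by (simp add: all_moments_def)
    have "abs_moment p (X r k) \<le> expectation (\<lambda>\<omega>. 1 + \<bar>X r k \<omega>\<bar> ^ max 3 p)"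
      using int by (intro integral_mono abs_power_le_one_plus) auto
    also have "\<dots> = 1 + abs_moment (max 3 p) (X r k)" using int by (simp add: prob_space)
    also have "\<dots> \<le> 1 + \<bar>m\<bar>" using m[OF r] by simp
    finally show ?thesis .
  qed
  then show ?thesis by (intro exI[of _ "1 + \<bar>m\<bar>"]) auto
qed

sublocale inputs: indep_centered M "\<lambda>(r, k). X r k" index_set
proof
  show "indep_vars (\<lambda>_. borel) (\<lambda>(r, k). X r k) index_set" by (rule input_indep)
  fix x assume x: "x \<in> index_set"
  obtain r k where x': "x = (r, k)" by (cases x)
  show "all_moments M (case x of (r, k) \<Rightarrow> X r k)" using x input_all_moments by (auto simp: x')
  show "expectation (case x of (r, k) \<Rightarrow> X r k) = 0"
    using x input by (auto simp: x' assumption_I_def)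
qed

definition steps :: "nat list \<Rightarrow> nat \<Rightarrow> (nat list \<times> nat) set" where
  "steps r N = Pair r ` {1..N}"

lemma steps: "finite (steps r N)" "card (steps r N) = N"
  "r \<in> Zplus 1 \<union> Zplus 2 \<Longrightarrow> steps r N \<subseteq> index_set"
  by (auto simp: steps_def card_image inj_on_def)

lemma walk_eq: "walk X n r t \<omega> = (\<Sum>x\<in>steps r (nat \<lfloor>real n * t\<rfloor>). (\<lambda>(r, k). X r k) x \<omega>)"
  unfolding walk_def steps_def by (simp add: sum.reindex inj_on_def)

text \<open>\<open>D\<close> is chosen before \<open>n\<close>, \<open>t\<close> and
  \<open>r\<close>. This uniformity is the source of the factor \<open>t ^ (2 * l)\<close> in the
  final bound; the number of steps enters through
  \<open>\<lfloor>real n * t\<rfloor> \<le> real n * t\<close>.\<close>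

lemma walk_moment_bound:
  "\<exists>D\<ge>0. \<forall>n. \<forall>t\<ge>0. \<forall>r\<in>Zplus 1 \<union> Zplus 2.
    abs_moment p (walk X n r t) \<le> D * sqrt (real n * t) ^ p"
proof -
  obtain m where m: "0 \<le> m" "\<And>r k. r \<in> Zplus 1 \<union> Zplus 2 \<Longrightarrow> 1 \<le> k \<Longrightarrow>
      abs_moment (2 * p) (X r k) \<le> m"
    using moment_bound[of "2 * p"] by auto
  define D where "D = 1 + real ((2 * p) ^ (2 * p)) * (real (2 * p) * m)"
  have "D \<ge> 0" using m(1) by (simp add: D_def)
  moreover have "abs_moment p (walk X n r t) \<le> D * sqrt (real n * t) ^ p"
    if t: "0 \<le> t" and r: "r \<in> Zplus 1 \<union> Zplus 2" for n t r
  proof -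
    let ?N = "nat \<lfloor>real n * t\<rfloor>"
    have "abs_moment p (walk X n r t) \<le> D * sqrt (real (card (steps r ?N))) ^ p"
      unfolding walk_eq D_def
      using steps r m by (intro inputs.abs_moment_sum_le) auto
    also have "\<dots> \<le> D * sqrt (real n * t) ^ p"
      using \<open>D \<ge> 0\<close> t by (intro mult_left_mono power_mono) (auto simp: steps of_nat_nat)
    finally show ?thesis .
  qed
  ultimately show ?thesis by blast
qed

lemma walk_second_moment:
  assumes "r \<in> Zplus 1 \<union> Zplus 2"
  shows "expectation (\<lambda>\<omega>. (walk X n r t \<omega>)\<^sup>2) = real (nat \<lfloor>real n * t\<rfloor>)"
proof -
  have "expectation (\<lambda>\<omega>. ((\<lambda>(r, k). X r k) x \<omega>)\<^sup>2) = 1" if "x \<in> index_set" for x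
  proof -
    obtain s k where x: "x = (s, k)" "s \<in> Zplus 1 \<union> Zplus 2" "1 \<le> k" using \<open>x \<in> index_set\<close> by auto
    have "expectation (X s k) = 0" "variance (X s k) = 1"
      using input x unfolding assumption_I_def by blast+
    then show ?thesis by (simp add: x(1))
  qed
  then show ?thesis
    unfolding walk_eq using steps assms by (subst inputs.second_moment_sum) auto
qed

text \<open>Each walk is a function of its own row \<open>{r} \<times> {1..}\<close> of input
  variables, and distinct rows are disjoint.\<close>

lemma walks_indep_centered:
  assumes d: "d \<in> {1, 2}"
  shows "indep_centered M (\<lambda>r. walk X n r t) (Zplus d)"
proof
  let ?N = "nat \<lfloor>real n * t\<rfloor>"
  have dZ: "Zplus d \<subseteq> Zplus 1 \<union> Zplus 2" using d by auto
  let ?K = "\<lambda>r :: nat list. {r} \<times> {1 :: nat..}"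
  have "indep_vars (\<lambda>r. PiM (?K r) (\<lambda>_. borel)) (\<lambda>r \<omega>. \<lambda>x\<in>?K r. (\<lambda>(r, k). X r k) x \<omega>) (Zplus d)"
    using dZ by (intro indep_vars_restrict[OF input_indep]) (auto simp: disjoint_family_on_def)
  then have "indep_vars (\<lambda>_. borel) (\<lambda>r \<omega>. \<Sum>k=1..?N. (\<lambda>x\<in>?K r. (\<lambda>(r, k). X r k) x \<omega>) (r, k)) (Zplus d)"
    by (rule indep_vars_compose2)
      (auto intro!: borel_measurable_sum measurable_component_singleton)
  also have "?this \<longleftrightarrow> indep_vars (\<lambda>_. borel) (\<lambda>r. walk X n r t) (Zplus d)"
    by (intro indep_vars_cong) (auto simp: walk_def fun_eq_iff)
  finally show "indep_vars (\<lambda>_. borel) (\<lambda>r. walk X n r t) (Zplus d)" .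
  fix r assume "r \<in> Zplus d"
  then have r: "r \<in> Zplus 1 \<union> Zplus 2" using dZ by blast
  show "all_moments M (walk X n r t)"
    unfolding walk_def[abs_def] using r by (intro all_moments_sum input_all_moments) auto
  have "expectation (walk X n r t) = (\<Sum>k=1..?N. expectation (X r k))"
    unfolding walk_def[abs_def] using r
    by (intro Bochner_Integration.integral_sum all_moments_integrable input_all_moments) auto
  also have "\<dots> = 0" using input r by (intro sum.neutral) (auto simp: assumption_I_def)
  finally show "expectation (walk X n r t) = 0" .
qed

end

subsection \<open>Words and pair-matched circuits\<close>

lemma is_word_snoc:
  "is_word (w @ [a]) \<longleftrightarrow> is_word w \<and> (a \<in> set w \<or> a = card (set w))"
  by (auto simp: is_word_def nth_append less_Suc_eq)

lemma set_word: "is_word w \<Longrightarrow> set w = {..<card (set w)}"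
proof (induction w rule: rev_induct)
  case (snoc a w)
  then have w: "set w = {..<card (set w)}" and a: "a \<in> set w \<or> a = card (set w)"
    by (auto simp: is_word_snoc)
  from a show ?case
  proof
    assume "a \<in> set w"
    then have "set (w @ [a]) = set w" by auto
    then show ?thesis using w by simp
  next
    assume a: "a = card (set w)"
    then have "a \<notin> set w" using w by blast
    then have "card (set (w @ [a])) = Suc (card (set w))" by simp
    moreover have "set (w @ [a]) = {..<Suc (card (set w))}" using w a by (simp add: lessThan_Suc)
    ultimately show ?thesis by simp
  qed
qed simp

lemma ex_canonical_word:
  "\<exists>w. is_word w \<and> length w = l \<and> (\<forall>i<l. \<forall>j<l. w ! i = w ! j \<longleftrightarrow> h i = h j)"
proof (induction l)
  case 0
  show ?case by (intro exI[of _ "[]"]) (simp add: is_word_def)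
next
  case (Suc l)
  then obtain w where w: "is_word w" "length w = l" "\<And>i j. i < l \<Longrightarrow> j < l \<Longrightarrow> w ! i = w ! j \<longleftrightarrow> h i = h j"
    by blast
  define a where "a = (if \<exists>j<l. h j = h l then w ! (SOME j. j < l \<and> h j = h l) else card (set w))"
  have old: "w ! i = a \<longleftrightarrow> h i = h l" if i: "i < l" for i
  proof (cases "\<exists>j<l. h j = h l")
    case True
    then obtain j where j: "j < l" "h j = h l" "a = w ! j"
      unfolding a_def using someI_ex[of "\<lambda>j. j < l \<and> h j = h l"] by auto
    then show ?thesis using w(3)[OF i j(1)] by simp
  next
    case False
    then have "a \<notin> set w" using set_word[OF w(1)] by (auto simp: a_def)
    then show ?thesis using False i w(2) by auto
  qed
  have "is_word (w @ [a])"
    unfolding is_word_snoc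
  proof (intro conjI w(1))
    show "a \<in> set w \<or> a = card (set w)"
    proof (cases "\<exists>j<l. h j = h l")
      case True
      then obtain j where "j < l" "h j = h l" by blast
      then show ?thesis using old[of j] w(2) by auto
    qed (simp only: a_def if_False simp_thms)
  qed
  moreover have "(w @ [a]) ! i = (w @ [a]) ! j \<longleftrightarrow> h i = h j" if ij: "i < Suc l" "j < Suc l" for i j
  proof -
    consider "i < l" "j < l" | "i = l" "j < l" | "i < l" "j = l" | "i = l" "j = l"
      using ij unfolding less_Suc_eq by blast
    then show ?thesis
    proof cases
      case 1 then show ?thesis using w by (simp add: nth_append)
    next
      case 2 then show ?thesis using old[of j] w(2) by (auto simp: nth_append)
    next
      case 3 then show ?thesis using old[of i] w(2) by (auto simp: nth_append)
    qed simp
  qed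
  ultimately show ?case using w(2) by (intro exI[of _ "w @ [a]"]) simp
qed

lemma is_word_nth_new:
  assumes "is_word w" "i < length w" "\<And>j. j < i \<Longrightarrow> w ! j \<noteq> w ! i"
  shows "w ! i = card (set (take i w))"
proof -
  have "w ! i \<notin> set (take i w)" using assms(2,3) by (auto simp: in_set_conv_nth)
  then show ?thesis using assms(1,2) by (auto simp: is_word_def)
qed

text \<open>Agreement spreads from prefix to prefix. Where a letter is new, both words must take the
  number of letters used so far, which is the same for equal prefixes; where it is old, the
  assumption \<open>old\<close> decides.\<close>

lemma word_eqI:
  assumes w: "is_word w" "is_word w'" "length w' = length w"
    and new: "\<And>i. i < length w \<Longrightarrow> (\<forall>j<i. w ! j \<noteq> w ! i) \<longleftrightarrow> (\<forall>j<i. w' ! j \<noteq> w' ! i)"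
    and old: "\<And>i j. i < length w \<Longrightarrow> j < i \<Longrightarrow> w ! j = w ! i \<Longrightarrow> take i w = take i w' \<Longrightarrow> w' ! i = w ! i"
  shows "w = w'"
proof -
  have "i \<le> length w \<Longrightarrow> take i w = take i w'" for i
  proof (induction i)
    case (Suc i)
    then have i: "i < length w" and IH: "take i w = take i w'" by auto
    have "w ! i = w' ! i"
    proof (cases "\<forall>j<i. w ! j \<noteq> w ! i")
      case True
      then have "\<forall>j<i. w' ! j \<noteq> w' ! i" using new[OF i] by blast
      then show ?thesis using True is_word_nth_new[OF w(1) i] is_word_nth_new[OF w(2)] i w(3) IH by simp
    next
      case False
      then show ?thesis using old[OF i] IH by force
    qed
    then show ?case using i w(3) IH by (simp add: take_Suc_conv_app_nth)
  qed simp
  from this[of "length w"] show ?thesis using w(3) by simp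
qed

lemma word_eq_if_same_kernel:
  assumes "is_word w" "is_word w'" "length w' = length w"
    and ker: "\<And>i j. i < length w \<Longrightarrow> j < length w \<Longrightarrow> w ! i = w ! j \<longleftrightarrow> w' ! i = w' ! j"
  shows "w = w'"
proof (rule word_eqI[OF assms(1-3)])
  fix i assume i: "i < length w"
  show "(\<forall>j<i. w ! j \<noteq> w ! i) \<longleftrightarrow> (\<forall>j<i. w' ! j \<noteq> w' ! i)"
    using ker i by (meson order.strict_trans)
  fix j assume j: "j < i" "w ! j = w ! i" and IH: "take i w = take i w'"
  have "w' ! i = w' ! j" using ker[of i j] i j by simp
  also have "\<dots> = w ! j" using nth_take[OF j(1), of w] nth_take[OF j(1), of w'] IH by simp
  finally show "w' ! i = w ! i" using j(2) by simp
qed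

lemma pair_matched_words_iff:
  "w \<in> pair_matched_words l \<longleftrightarrow>
    is_word w \<and> length w = l \<and> (\<forall>i<l. card {j. j < l \<and> w ! j = w ! i} = 2)"
proof -
  have "count_list w a = card {j. j < length w \<and> w ! j = a}" for a
    by (simp add: count_list_eq_length_filter length_filter_conv_card eq_commute)
  then show ?thesis
    unfolding pair_matched_words_def by (auto simp: all_set_conv_all_nth)
qed

lemma card_set_pair_matched:
  assumes "w \<in> pair_matched_words l"
  shows "2 * card (set w) = l"
proof -
  from assms have len: "length w = l" and two: "\<And>a. a \<in> set w \<Longrightarrow> count_list w a = 2"
    by (auto simp: pair_matched_words_def)
  have "l = (\<Sum>a\<in>set w. count_list w a)" using len by (simp add: sum_count_set)
  also have "\<dots> = (\<Sum>a\<in>set w. 2)" using two by (intro sum.cong) auto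
  finally show ?thesis by simp
qed

lemma finite_pair_matched_words: "finite (pair_matched_words l)"
proof (rule finite_subset)
  show "pair_matched_words l \<subseteq> {w. set w \<subseteq> {..l} \<and> length w = l}"
  proof
    fix w assume "w \<in> pair_matched_words l"
    then have w: "is_word w" "length w = l" by (auto simp: pair_matched_words_def)
    have "set w = {..<card (set w)}" by (rule set_word[OF w(1)])
    moreover have "card (set w) \<le> l" using w(2) card_length by blast
    ultimately have "set w \<subseteq> {..l}" by (metis lessThan_subset_iff lessThan_Suc_atMost le_SucI)
    then show "w \<in> {w. set w \<subseteq> {..l} \<and> length w = l}" using w(2) by simp
  qed
  show "finite {w. set w \<subseteq> {..l} \<and> length w = l}" by (intro finite_lists_length_eq) simp
qed

text \<open>A word is determined by the set of positions at which a new letter appears together with the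
  letters at the remaining positions.\<close>

lemma card_pair_matched_words_le: "card (pair_matched_words (2 * m)) \<le> 4 ^ m * m ^ m"
proof -
  let ?n = "2 * m" and ?P = "pair_matched_words (2 * m)"
  define new where "new w = {i. i < length w \<and> (\<forall>j<i. w ! j \<noteq> w ! i)}" for w :: "nat list"
  \<comment> \<open>There are at most \<open>2 ^ (2 * m) = 4 ^ m\<close> choices for the positions
    of new letters, one position per letter. The other \<open>m\<close> positions carry any of
    \<open>m\<close> letters, which gives \<open>m ^ m\<close>.\<close>
  define As where "As = {A. A \<subseteq> {..<?n} \<and> card A = m}"
  have finAs: "finite As" unfolding As_def by (rule finite_subset[of _ "Pow {..<?n}"]) auto
  have fin: "finite (({..<?n} - A) \<rightarrow>\<^sub>E {..<m})" for A by (intro finite_PiE) auto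
  have card_new: "card (new w) = card (set w)" for w
  proof (rule bij_betw_same_card[of "nth w"])
    show "bij_betw (nth w) (new w) (set w)"
      unfolding bij_betw_def
    proof
      show "inj_on (nth w) (new w)"
        unfolding new_def inj_on_def by (auto) (metis linorder_neqE_nat)
      show "nth w ` new w = set w"
      proof
        show "nth w ` new w \<subseteq> set w" by (auto simp: new_def)
        show "set w \<subseteq> nth w ` new w"
        proof
          fix a assume "a \<in> set w"
          then have ex: "\<exists>i. i < length w \<and> w ! i = a" by (auto simp: in_set_conv_nth)
          define i where "i = (LEAST i. i < length w \<and> w ! i = a)"
          have i: "i < length w" "w ! i = a" using LeastI_ex[OF ex] by (auto simp: i_def)
          have "w ! j \<noteq> w ! i" if "j < i" for j
            using not_less_Least[of j "\<lambda>i. i < length w \<and> w ! i = a"] that i by (auto simp: i_def[symmetric])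
          then show "a \<in> nth w ` new w" using i by (auto simp: new_def)
        qed
      qed
    qed
  qed
  have "card ?P \<le> card (SIGMA A : As. ({..<?n} - A) \<rightarrow>\<^sub>E {..<m})"
  proof (rule card_inj_on_le[where f = "\<lambda>w. (new w, \<lambda>i\<in>{..<?n} - new w. w ! i)"])
    show "inj_on (\<lambda>w. (new w, \<lambda>i\<in>{..<?n} - new w. w ! i)) ?P"
    proof (rule inj_onI)
      fix w w' assume w: "w \<in> ?P" "w' \<in> ?P"
        and eq: "(new w, \<lambda>i\<in>{..<?n} - new w. w ! i) = (new w', \<lambda>i\<in>{..<?n} - new w'. w' ! i)"
      have new_eq: "new w = new w'" and
        fun_eq: "(\<lambda>i\<in>{..<?n} - new w. w ! i) = (\<lambda>i\<in>{..<?n} - new w. w' ! i)" using eq by auto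
      have len: "length w = ?n" "length w' = ?n" and words: "is_word w" "is_word w'"
        using w by (auto simp: pair_matched_words_def)
      show "w = w'"
      proof (rule word_eqI[OF words])
        show "length w' = length w" using len by simp
        fix i assume i: "i < length w"
        then have "i \<in> new w \<longleftrightarrow> i \<in> new w'" using new_eq by simp
        then show "(\<forall>j<i. w ! j \<noteq> w ! i) \<longleftrightarrow> (\<forall>j<i. w' ! j \<noteq> w' ! i)"
          using i len by (auto simp: new_def)
        fix j assume "j < i" "w ! j = w ! i"
        then have "i \<in> {..<?n} - new w" using i len by (auto simp: new_def)
        then show "w' ! i = w ! i" using fun_cong[OF fun_eq, of i] by simp
      qed
    qed
    show "(\<lambda>w. (new w, \<lambda>i\<in>{..<?n} - new w. w ! i)) ` ?P \<subseteq> (SIGMA A : As. ({..<?n} - A) \<rightarrow>\<^sub>E {..<m})"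
    proof (rule image_subsetI, rule SigmaI)
      fix w assume w: "w \<in> ?P"
      then have len: "length w = ?n" and word: "is_word w" by (auto simp: pair_matched_words_def)
      have m: "card (set w) = m" using card_set_pair_matched[OF w] by simp
      show "new w \<in> As" using card_new[of w] m len by (auto simp: As_def new_def)
      have "w ! i < m" if "i < ?n" for i
        using set_word[OF word, unfolded m] len nth_mem[of i w] that by simp
      then show "(\<lambda>i\<in>{..<?n} - new w. w ! i) \<in> ({..<?n} - new w) \<rightarrow>\<^sub>E {..<m}" by auto
    qed
    show "finite (SIGMA A : As. ({..<?n} - A) \<rightarrow>\<^sub>E {..<m})" using finAs fin by (intro finite_SigmaI)
  qed
  also have "\<dots> = (\<Sum>A\<in>As. card (({..<?n} - A) \<rightarrow>\<^sub>E {..<m}))"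
    using finAs fin by (intro card_SigmaI) auto
  also have "\<dots> = (\<Sum>A\<in>As. m ^ m)"
  proof (rule sum.cong[OF refl])
    fix A assume "A \<in> As"
    then have "card ({..<?n} - A) = m" by (auto simp: As_def card_Diff_subset finite_subset)
    then show "card (({..<?n} - A) \<rightarrow>\<^sub>E {..<m}) = m ^ m" by (simp add: card_PiE)
  qed
  also have "\<dots> = card As * m ^ m" by simp
  also have "card As \<le> card (Pow {..<?n})" by (intro card_mono) (auto simp: As_def)
  also have "card (Pow {..<?n}) = 4 ^ m" by (simp add: card_Pow power_mult)
  finally show ?thesis by simp
qed

text \<open>Each factor of \<open>(m + 1) * ... * (m + k)\<close> is at least \<open>m\<close>. For
  \<open>k = m\<close> this turns the word count \<open>m ^ m\<close> into the quotient
  \<open>fact (2 * m) / fact m\<close> of the moment growth condition.\<close>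

lemma power_self_times_fact_le: "m ^ k * fact m \<le> (fact (m + k) :: nat)"
proof (induction k)
  case (Suc k)
  have "m ^ Suc k * fact m = m * (m ^ k * fact m)" by simp
  also have "\<dots> \<le> (m + Suc k) * fact (m + k)" using Suc by (intro mult_mono) auto
  finally show ?case by simp
qed simp

lemma card_pair_matched_words_growth:
  "real (card (pair_matched_words (2 * m))) \<le> fact (2 * m) / fact m * 4 ^ m"
proof -
  have "real (m ^ m * fact m) \<le> real (fact (m + m))"
    using power_self_times_fact_le[of m m] by (simp only: of_nat_le_iff)
  then have le: "real (m ^ m) \<le> fact (2 * m) / fact m"
    by (simp add: pos_le_divide_eq mult_2)
  have "real (card (pair_matched_words (2 * m))) \<le> real (4 ^ m * m ^ m)"
    using card_pair_matched_words_le[of m] by (simp only: of_nat_le_iff)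
  also have "\<dots> = real (m ^ m) * 4 ^ m" by simp
  also have "\<dots> \<le> fact (2 * m) / fact m * 4 ^ m" by (rule mult_right_mono[OF le]) simp
  finally show ?thesis .
qed

section \<open>Pair-matched circuits and their classification by words\<close>

definition pair_matched_circuits :: "(nat \<Rightarrow> nat \<Rightarrow> 'r) \<Rightarrow> nat \<Rightarrow> nat \<Rightarrow> (nat \<Rightarrow> nat) set" where
  "pair_matched_circuits g n l = {\<pi> \<in> circuits n l.
     \<forall>q\<in>{1..l}. card {q'\<in>{1..l}. edge_letter g \<pi> q' = edge_letter g \<pi> q} = 2}"

lemma word_circuits_iff:
  "\<pi> \<in> word_circuits L n w \<longleftrightarrow> \<pi> \<in> circuits n (length w) \<and>
    (\<forall>i<length w. \<forall>j<length w. w ! i = w ! j \<longleftrightarrow>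
      edge_letter (L n) \<pi> (Suc i) = edge_letter (L n) \<pi> (Suc j))"
proof -
  have shift: "(\<forall>i\<in>{1..l}. P i) \<longleftrightarrow> (\<forall>i<l. P (Suc i))" for P and l :: nat
    unfolding image_Suc_lessThan[symmetric] by blast
  show ?thesis unfolding word_circuits_def edge_letter_def shift by simp
qed

text \<open>Edges are numbered from 1, positions in a word from 0.\<close>

lemma card_class_shift:
  "card {q'\<in>{1..l}. h q' = c} = card {j. j < l \<and> h (Suc j) = c}" for l :: nat
proof (rule bij_betw_same_card[of "\<lambda>q. q - 1"])
  show "bij_betw (\<lambda>q. q - 1) {q'\<in>{1..l}. h q' = c} {j. j < l \<and> h (Suc j) = c}"
    by (rule bij_betw_byWitness[where f' = Suc]) auto
qed

text \<open>A circuit belongs to the canonical word with the same coincidences as its edge letters,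
  and being pair-matched depends on these coincidences alone.\<close>

lemma pair_matched_circuits_eq:
  "pair_matched_circuits (L n) n l = (\<Union>w\<in>pair_matched_words l. word_circuits L n w)"
proof
  show "pair_matched_circuits (L n) n l \<subseteq> (\<Union>w\<in>pair_matched_words l. word_circuits L n w)"
  proof
    fix \<pi> assume \<pi>: "\<pi> \<in> pair_matched_circuits (L n) n l"
    let ?h = "\<lambda>i. edge_letter (L n) \<pi> (Suc i)"
    obtain w where w: "is_word w" "length w = l" "\<And>i j. i < l \<Longrightarrow> j < l \<Longrightarrow> w ! i = w ! j \<longleftrightarrow> ?h i = ?h j"
      using ex_canonical_word[of l ?h] by blast
    have "card {j. j < l \<and> w ! j = w ! i} = 2" if i: "i < l" for i
    proof -
      have "{j. j < l \<and> w ! j = w ! i} = {j. j < l \<and> ?h j = ?h i}" using w(3) i by blast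
      also have "card \<dots> = 2"
        using \<pi> i card_class_shift[of l "edge_letter (L n) \<pi>" "?h i"] by (simp add: pair_matched_circuits_def)
      finally show ?thesis .
    qed
    then have "w \<in> pair_matched_words l" using w by (simp add: pair_matched_words_iff)
    moreover have "\<pi> \<in> word_circuits L n w"
      using \<pi> w by (simp add: word_circuits_iff pair_matched_circuits_def)
    ultimately show "\<pi> \<in> (\<Union>w\<in>pair_matched_words l. word_circuits L n w)" by blast
  qed
  show "(\<Union>w\<in>pair_matched_words l. word_circuits L n w) \<subseteq> pair_matched_circuits (L n) n l"
  proof (rule UN_least, rule subsetI)
    fix w \<pi> assume w: "w \<in> pair_matched_words l" and \<pi>: "\<pi> \<in> word_circuits L n w"
    let ?h = "\<lambda>i. edge_letter (L n) \<pi> (Suc i)"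
    have len: "length w = l" and two: "\<And>i. i < l \<Longrightarrow> card {j. j < l \<and> w ! j = w ! i} = 2"
      using w by (auto simp: pair_matched_words_iff)
    have ker: "w ! i = w ! j \<longleftrightarrow> ?h i = ?h j" if "i < l" "j < l" for i j
      using \<pi> that len by (simp add: word_circuits_iff)
    have "card {q'\<in>{1..l}. edge_letter (L n) \<pi> q' = edge_letter (L n) \<pi> q} = 2" if "q \<in> {1..l}" for q
    proof -
      obtain i where i: "q = Suc i" "i < l" using \<open>q \<in> {1..l}\<close> by (cases q) auto
      have "{j. j < l \<and> ?h j = ?h i} = {j. j < l \<and> w ! j = w ! i}" using ker i(2) by blast
      then show ?thesis using two[OF i(2)] card_class_shift[of l "edge_letter (L n) \<pi>" "?h i"] i(1) by simp
    qed
    then show "\<pi> \<in> pair_matched_circuits (L n) n l"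
      using \<pi> len by (simp add: pair_matched_circuits_def word_circuits_iff)
  qed
qed

lemma card_pair_matched_circuits:
  "card (pair_matched_circuits (L n) n l) = (\<Sum>w\<in>pair_matched_words l. card (word_circuits L n w))"
  unfolding pair_matched_circuits_eq
proof (rule card_UN_disjoint[OF finite_pair_matched_words])
  show "\<forall>w\<in>pair_matched_words l. finite (word_circuits L n w)"
    using finite_circuits by (simp add: word_circuits_def)
  show "\<forall>w\<in>pair_matched_words l. \<forall>w'\<in>pair_matched_words l. w \<noteq> w' \<longrightarrow>
    word_circuits L n w \<inter> word_circuits L n w' = {}"
  proof (intro ballI impI)
    fix w w' assume w: "w \<in> pair_matched_words l" "w' \<in> pair_matched_words l" and "w \<noteq> w'"
    have len: "length w = l" "length w' = l" and words: "is_word w" "is_word w'"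
      using w by (auto simp: pair_matched_words_def)
    show "word_circuits L n w \<inter> word_circuits L n w' = {}"
    proof (rule ccontr)
      assume "word_circuits L n w \<inter> word_circuits L n w' \<noteq> {}"
      then obtain \<pi> where "\<pi> \<in> word_circuits L n w" "\<pi> \<in> word_circuits L n w'" by blast
      then have "w = w'"
        using len by (intro word_eq_if_same_kernel[OF words]) (simp_all add: word_circuits_iff)
      with \<open>w \<noteq> w'\<close> show False ..
    qed
  qed
qed

lemma two_card_image_eq:
  assumes "finite E" "\<And>x. x \<in> E \<Longrightarrow> card {y \<in> E. h y = h x} = 2"
  shows "2 * card (h ` E) = card E"
proof -
  have "card E = (\<Sum>r\<in>h ` E. card {y \<in> E. h y = r})"
    using sum.image_gen[OF assms(1), of "\<lambda>_. 1 :: nat" h] by simp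
  also have "\<dots> = (\<Sum>r\<in>h ` E. 2)" using assms(2) by (intro sum.cong) auto
  finally show ?thesis by simp
qed

text \<open>The three kinds of circuits in the mean: contributing, vanishing and negligible. In the
  third kind all letters occur at least twice and one of them at least three times, so twice the
  number of letters is less than \<open>l\<close>.\<close>

lemma letter_multiplicity_cases:
  fixes l :: nat and h :: "nat \<Rightarrow> 'r"
  obtains (pair) "\<And>q. q \<in> {1..l} \<Longrightarrow> card {q'\<in>{1..l}. h q' = h q} = 2" "2 * card (h ` {1..l}) = l"
  | (unique) p where "p \<in> {1..l}" "\<And>q. q \<in> {1..l} \<Longrightarrow> q \<noteq> p \<Longrightarrow> h q \<noteq> h p"
  | (few) "card (h ` {1..l}) \<le> (l - 1) div 2"
proof -
  let ?c = "\<lambda>r. card {q'\<in>{1..l}. h q' = r}"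
  have total: "(\<Sum>r\<in>h ` {1..l}. ?c r) = l"
    using sum.image_gen[of "{1..l}" "\<lambda>_. 1 :: nat" h] by simp
  consider "\<forall>r\<in>h ` {1..l}. ?c r = 2" | r where "r \<in> h ` {1..l}" "?c r = 1"
    | r0 where "r0 \<in> h ` {1..l}" "?c r0 \<noteq> 2" "\<forall>r\<in>h ` {1..l}. ?c r \<noteq> 1" by blast
  then show thesis
  proof cases
    case 1
    then have "2 * card (h ` {1..l}) = l" using two_card_image_eq[of "{1..l}" h] by simp
    with 1 show thesis by (intro pair) auto
  next
    case 2
    then obtain p where p: "{q'\<in>{1..l}. h q' = r} = {p}" by (auto simp: card_1_singleton_iff)
    then have "p \<in> {q'\<in>{1..l}. h q' = r}" by simp
    then have "p \<in> {1..l}" "h p = r" by auto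
    moreover have "h q \<noteq> h p" if "q \<in> {1..l}" "q \<noteq> p" for q
    proof
      assume "h q = h p"
      then have "q \<in> {q'\<in>{1..l}. h q' = r}" using that \<open>h p = r\<close> by simp
      then show False using that(2) unfolding p by simp
    qed
    ultimately show thesis using unique by blast
  next
    case 3
    have pos: "?c r \<noteq> 0" if "r \<in> h ` {1..l}" for r using that by auto
    have ge: "2 \<le> ?c r" if "r \<in> h ` {1..l}" for r
    proof -
      have "?c r \<noteq> 0" "?c r \<noteq> 1" using pos[OF that] 3(3) that by blast+
      then show ?thesis by linarith
    qed
    have "2 < ?c r0" using ge[OF 3(1)] 3(2) by linarith
    then have "(\<Sum>r\<in>h ` {1..l}. 2) < (\<Sum>r\<in>h ` {1..l}. ?c r)"
      using 3(1) ge by (intro sum_strict_mono_ex1) auto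
    then have "2 * card (h ` {1..l}) < l" unfolding total by simp
    then show thesis by (intro few) linarith
  qed
qed

section \<open>Expectation and fourth central moment of sums over circuits\<close>

context indep_centered
begin

text \<open>Grouped by letters, the block is a product of squares of distinct independent
  variables.\<close>

lemma expectation_block_pair_matched:
  assumes R: "\<And>q. q \<in> {1..l} \<Longrightarrow> s q \<in> R" and v: "\<And>r. r \<in> R \<Longrightarrow> expectation (\<lambda>\<omega>. (W r \<omega>)\<^sup>2) = v"
    and pair: "\<And>q. q \<in> {1..l} \<Longrightarrow> card {q'\<in>{1..l}. s q' = s q} = 2"
  shows "expectation (block l s) = v ^ card (s ` {1..l})"
proof -
  let ?S = "s ` {1..l}"
  have "block l s \<omega> = (\<Prod>r\<in>?S. (W r \<omega>)\<^sup>2)" for \<omega>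
  proof -
    have "block l s \<omega> = (\<Prod>r\<in>?S. \<Prod>q\<in>{q\<in>{1..l}. s q = r}. W (s q) \<omega>)"
      unfolding block_def by (rule prod.image_gen) simp
    also have "\<dots> = (\<Prod>r\<in>?S. (W r \<omega>)\<^sup>2)"
    proof (rule prod.cong[OF refl])
      fix r assume "r \<in> ?S"
      then have "card {q\<in>{1..l}. s q = r} = 2" using pair by blast
      then show "(\<Prod>q\<in>{q\<in>{1..l}. s q = r}. W (s q) \<omega>) = (W r \<omega>)\<^sup>2" by simp
    qed
    finally show ?thesis .
  qed
  then have "expectation (block l s) = expectation (\<lambda>\<omega>. \<Prod>r\<in>?S. (W r \<omega>)\<^sup>2)" by (simp cong: Bochner_Integration.integral_cong)
  also have "\<dots> = (\<Prod>r\<in>?S. expectation (\<lambda>\<omega>. (W r \<omega>)\<^sup>2))"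
  proof (rule indep_vars_lebesgue_integral)
    have "?S \<subseteq> R" using R by auto
    then have "indep_vars (\<lambda>_. borel) W ?S" by (rule indep_vars_subset[OF indep])
    then show "indep_vars (\<lambda>_. borel) (\<lambda>r \<omega>. (W r \<omega>)\<^sup>2) ?S"
      by (rule indep_vars_compose2) simp
    show "integrable M (\<lambda>\<omega>. (W r \<omega>)\<^sup>2)" if "r \<in> ?S" for r
      using that R by (intro all_moments_integrable all_moments_power moments) auto
  qed simp
  also have "\<dots> = (\<Prod>r\<in>?S. v)" using R v by (intro prod.cong) auto
  finally show ?thesis by simp
qed

text \<open>Pair-matched circuits contribute exactly \<open>v ^ (l div 2)\<close> each and circuits
  with a unique letter nothing, so the entire error comes from circuits with few letters.\<close>

lemma sum_expectation_blocks:
  fixes g :: "nat \<Rightarrow> nat \<Rightarrow> 'r"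
  assumes l: "1 \<le> l" and R: "\<And>\<pi> q. \<pi> \<in> circuits n l \<Longrightarrow> q \<in> {1..l} \<Longrightarrow> edge_letter g \<pi> q \<in> R"
    and v: "\<And>r. r \<in> R \<Longrightarrow> expectation (\<lambda>\<omega>. (W r \<omega>)\<^sup>2) = v"
    and D: "\<And>r. r \<in> R \<Longrightarrow> abs_moment l (W r) \<le> D" and "0 \<le> D"
  shows "\<bar>(\<Sum>\<pi>\<in>circuits n l. expectation (block l (edge_letter g \<pi>)))
      - real (card (pair_matched_circuits g n l)) * v ^ (l div 2)\<bar>
    \<le> real (card {\<pi> \<in> circuits n l. card (edge_letter g \<pi> ` {1..l}) \<le> (l - 1) div 2}) * (real l * D)"
proof -
  let ?C = "circuits n l" and ?P = "pair_matched_circuits g n l"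
  let ?F = "{\<pi> \<in> circuits n l. card (edge_letter g \<pi> ` {1..l}) \<le> (l - 1) div 2}"
  let ?e = "\<lambda>\<pi>. expectation (block l (edge_letter g \<pi>))"
  have PC: "?P \<subseteq> ?C" by (auto simp: pair_matched_circuits_def)
  have finP: "finite ?P" using PC finite_circuits by (rule finite_subset)
  have P: "?e \<pi> = v ^ (l div 2)" if "\<pi> \<in> ?P" for \<pi>
  proof -
    have pair: "card {q'\<in>{1..l}. edge_letter g \<pi> q' = edge_letter g \<pi> q} = 2" if "q \<in> {1..l}" for q
      using \<open>\<pi> \<in> ?P\<close> that by (simp add: pair_matched_circuits_def)
    then have "card (edge_letter g \<pi> ` {1..l}) = l div 2"
      using two_card_image_eq[of "{1..l}" "edge_letter g \<pi>"] by simp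
    moreover have "?e \<pi> = v ^ card (edge_letter g \<pi> ` {1..l})"
      using R that PC v pair by (intro expectation_block_pair_matched) auto
    ultimately show ?thesis by simp
  qed
  have rest: "\<bar>?e \<pi>\<bar> \<le> (if \<pi> \<in> ?F then real l * D else 0)" if \<pi>: "\<pi> \<in> ?C - ?P" for \<pi>
  proof (rule letter_multiplicity_cases[of l "edge_letter g \<pi>"])
    assume "\<And>q. q \<in> {1..l} \<Longrightarrow> card {q'\<in>{1..l}. edge_letter g \<pi> q' = edge_letter g \<pi> q} = 2"
    then have "\<pi> \<in> ?P" using \<pi> by (simp add: pair_matched_circuits_def)
    then show ?thesis using \<pi> by simp
  next
    fix p assume p: "p \<in> {1..l}" "\<And>q. q \<in> {1..l} \<Longrightarrow> q \<noteq> p \<Longrightarrow> edge_letter g \<pi> q \<noteq> edge_letter g \<pi> p"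
    have "?e \<pi> = 0"
      unfolding block_def using p \<pi> R by (intro expectation_prod_unique_factor[where j = p]) auto
    then show ?thesis using \<open>0 \<le> D\<close> by simp
  next
    assume "card (edge_letter g \<pi> ` {1..l}) \<le> (l - 1) div 2"
    then have F: "\<pi> \<in> ?F" using \<pi> by simp
    have "\<bar>?e \<pi>\<bar> \<le> expectation (\<lambda>\<omega>. \<bar>block l (edge_letter g \<pi>) \<omega>\<bar>)" by (rule integral_abs_bound)
    also have "\<dots> \<le> real (card {1..l}) * D"
      unfolding block_def using l \<pi> R D by (intro expectation_abs_prod_le) auto
    finally show ?thesis using F by simp
  qed
  have "(\<Sum>\<pi>\<in>?C. ?e \<pi>) = (\<Sum>\<pi>\<in>?C - ?P. ?e \<pi>) + (\<Sum>\<pi>\<in>?P. ?e \<pi>)"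
    using PC finite_circuits by (rule sum.subset_diff)
  also have "(\<Sum>\<pi>\<in>?P. ?e \<pi>) = real (card ?P) * v ^ (l div 2)" using P by simp
  finally have "\<bar>(\<Sum>\<pi>\<in>?C. ?e \<pi>) - real (card ?P) * v ^ (l div 2)\<bar> = \<bar>\<Sum>\<pi>\<in>?C - ?P. ?e \<pi>\<bar>" by simp
  also have "\<dots> \<le> (\<Sum>\<pi>\<in>?C - ?P. \<bar>?e \<pi>\<bar>)" by (rule sum_abs)
  also have "\<dots> \<le> (\<Sum>\<pi>\<in>?C - ?P. if \<pi> \<in> ?F then real l * D else 0)" by (intro sum_mono rest)
  also have "\<dots> \<le> (\<Sum>\<pi>\<in>?C. if \<pi> \<in> ?F then real l * D else 0)"
    using finite_circuits \<open>0 \<le> D\<close> by (intro sum_mono2) auto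
  also have "\<dots> = (\<Sum>\<pi>\<in>?C \<inter> ?F. real l * D)" using finite_circuits by (rule sum.inter_restrict[symmetric])
  also have "?C \<inter> ?F = ?F" by auto
  finally show ?thesis by simp
qed

text \<open>The fourth power expands over quadruples of circuits. A surviving quadruple is bounded
  crudely by its four fourth central moments, so all gain must come from the number of such
  quadruples.\<close>

lemma fourth_moment_sum_blocks:
  fixes g :: "nat \<Rightarrow> nat \<Rightarrow> 'r" and c :: real
  assumes l: "1 \<le> l" and R: "\<And>\<pi> q. \<pi> \<in> circuits n l \<Longrightarrow> q \<in> {1..l} \<Longrightarrow> edge_letter g \<pi> q \<in> R"
    and V: "\<And>\<pi>. \<pi> \<in> circuits n l \<Longrightarrow> expectation (\<lambda>\<omega>. (block l (edge_letter g \<pi>) \<omega>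
      - expectation (block l (edge_letter g \<pi>))) ^ 4) \<le> V"
  defines "Y \<equiv> \<lambda>\<omega>. c * (\<Sum>\<pi>\<in>circuits n l. block l (edge_letter g \<pi>) \<omega>)"
  shows "expectation (\<lambda>\<omega>. (Y \<omega> - expectation Y) ^ 4)
    \<le> c ^ 4 * (real (card {f \<in> {..<4} \<rightarrow>\<^sub>E circuits n l. matched g l 4 f \<and> linked g l 4 f}) * (4 * V))"
proof -
  let ?C = "circuits n l"
  let ?F = "{..<4 :: nat} \<rightarrow>\<^sub>E ?C" and ?G = "{f \<in> {..<4 :: nat} \<rightarrow>\<^sub>E ?C. matched g l 4 f \<and> linked g l 4 f}"
  define Z where "Z \<pi> \<omega> = block l (edge_letter g \<pi>) \<omega> - expectation (block l (edge_letter g \<pi>))" for \<pi> \<omega>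
  let ?e = "\<lambda>f. expectation (\<lambda>\<omega>. \<Prod>a<4. Z (f a) \<omega>)"
  have finF: "finite ?F" using finite_circuits by (intro finite_PiE) auto
  have mom: "all_moments M (block l (edge_letter g \<pi>))" if "\<pi> \<in> ?C" for \<pi>
    using R[OF that] by (rule all_moments_block)
  have Z: "all_moments M (Z \<pi>)" if "\<pi> \<in> ?C" for \<pi>
    unfolding Z_def using mom[OF that] by (rule all_moments_diff_const)
  have FC: "f a \<in> ?C" if "f \<in> ?F" "a < 4" for f a using PiE_mem[OF that(1), of a] that(2) by simp
  have int: "integrable M (\<lambda>\<omega>. \<Prod>a<4. Z (f a) \<omega>)" if "f \<in> ?F" for f
    using FC[OF that] by (intro all_moments_integrable all_moments_prod Z) auto
  have "expectation Y = c * (\<Sum>\<pi>\<in>?C. expectation (block l (edge_letter g \<pi>)))"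
    unfolding Y_def using mom
    by (simp add: Bochner_Integration.integral_sum[OF all_moments_integrable])
  then have "Y \<omega> - expectation Y = c * (\<Sum>\<pi>\<in>?C. Z \<pi> \<omega>)" for \<omega>
    by (simp add: Y_def Z_def sum_subtractf right_diff_distrib)
  then have "(Y \<omega> - expectation Y) ^ 4 = c ^ 4 * (\<Sum>f\<in>?F. \<Prod>a<4. Z (f a) \<omega>)" for \<omega>
    by (simp only: power_mult_distrib power_sum_eq_PiE_sum[OF finite_circuits])
  then have "expectation (\<lambda>\<omega>. (Y \<omega> - expectation Y) ^ 4) = c ^ 4 * (\<Sum>f\<in>?F. ?e f)"
    using int by (simp add: Bochner_Integration.integral_sum)
  also have "(\<Sum>f\<in>?F. ?e f) = (\<Sum>f\<in>?G. ?e f)"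
  proof (rule sum.mono_neutral_right[OF finF])
    show "\<forall>f\<in>?F - ?G. ?e f = 0"
    proof
      fix f assume f: "f \<in> ?F - ?G"
      then have Rf: "edge_letter g (f a) q \<in> R" if "a < 4" "q \<in> {1..l}" for a q
        using R[OF FC[of f a] that(2)] that(1) f by simp
      from f have "\<not> matched g l 4 f \<or> \<not> linked g l 4 f" by simp
      then show "?e f = 0"
      proof
        assume "\<not> matched g l 4 f"
        then obtain a p where "a < 4" "p \<in> {1..l}"
          "\<And>b q. b < 4 \<Longrightarrow> q \<in> {1..l} \<Longrightarrow> (b, q) \<noteq> (a, p) \<Longrightarrow> edge_letter g (f b) q \<noteq> edge_letter g (f a) p"
          unfolding matched_def by blast
        then show ?thesis
          unfolding Z_def using Rf
          by (intro expectation_prod_blocks_not_matched[of 4 l "\<lambda>a. edge_letter g (f a)" a p]) auto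
      next
        assume "\<not> linked g l 4 f"
        then obtain a where "a < 4" "\<And>b q q'. b < 4 \<Longrightarrow> b \<noteq> a \<Longrightarrow> q \<in> {1..l} \<Longrightarrow> q' \<in> {1..l} \<Longrightarrow>
            edge_letter g (f b) q' \<noteq> edge_letter g (f a) q"
          unfolding linked_def by blast
        then show ?thesis
          unfolding Z_def using Rf
          by (intro expectation_prod_blocks_not_linked[of 4 l "\<lambda>a. edge_letter g (f a)" a]) auto
      qed
    qed
  qed auto
  finally have eq: "expectation (\<lambda>\<omega>. (Y \<omega> - expectation Y) ^ 4) = c ^ 4 * (\<Sum>f\<in>?G. ?e f)" .
  have "(\<Sum>f\<in>?G. ?e f) \<le> real (card ?G) * (4 * V)"
  proof (rule sum_bounded_above)
    fix f assume "f \<in> ?G"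
    then have f: "f \<in> ?F" by simp
    have Z4: "integrable M (\<lambda>\<omega>. Z (f a) \<omega> ^ 4)" if "a < 4" for a
      using FC[OF f that] by (intro all_moments_integrable all_moments_power Z)
    have "?e f \<le> expectation (\<lambda>\<omega>. \<Sum>a<4. Z (f a) \<omega> ^ 4)"
    proof (rule integral_mono[OF int[OF f]])
      show "integrable M (\<lambda>\<omega>. \<Sum>a<4. Z (f a) \<omega> ^ 4)" using Z4 by (intro Bochner_Integration.integrable_sum) auto
      fix \<omega>
      have "(\<Prod>a<4. Z (f a) \<omega>) \<le> \<bar>\<Prod>a<4. Z (f a) \<omega>\<bar>" by simp
      also have "\<dots> \<le> (\<Sum>a<4. \<bar>Z (f a) \<omega>\<bar> ^ card {..<4::nat})"
        by (intro abs_prod_le_sum_power) (auto simp: lessThan_empty_iff)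
      finally show "(\<Prod>a<4. Z (f a) \<omega>) \<le> (\<Sum>a<4. Z (f a) \<omega> ^ 4)" by simp
    qed
    also have "\<dots> = (\<Sum>a<4. expectation (\<lambda>\<omega>. Z (f a) \<omega> ^ 4))"
      using Z4 by (intro Bochner_Integration.integral_sum) auto
    also have "\<dots> \<le> real (card {..<4::nat}) * V"
    proof (rule sum_bounded_above)
      fix a :: nat assume "a \<in> {..<4}"
      then have "a < 4" by simp
      from V[OF FC[OF f this]] show "expectation (\<lambda>\<omega>. Z (f a) \<omega> ^ 4) \<le> V" unfolding Z_def .
    qed
    also have "\<dots> = 4 * V" by simp
    finally show "?e f \<le> 4 * V" .
  qed
  then have "c ^ 4 * (\<Sum>f\<in>?G. ?e f) \<le> c ^ 4 * (real (card ?G) * (4 * V))"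
    by (rule mult_left_mono) simp
  then show ?thesis unfolding eq .
qed

end

subsection \<open>Convergence of the spectral distributions\<close>

text \<open>The series of the \<open>f n\<close> has finite expectation, hence converges almost
  everywhere, and its terms tend to 0.\<close>

lemma (in prob_space) AE_tendsto_0_if_summable_expectation:
  fixes f :: "nat \<Rightarrow> 'a \<Rightarrow> real"
  assumes nn: "\<And>n \<omega>. 0 \<le> f n \<omega>" and int: "\<And>n. integrable M (f n)"
    and sum: "summable (\<lambda>n. expectation (f n))"
  shows "AE \<omega> in M. (\<lambda>n. f n \<omega>) \<longlonglongrightarrow> 0"
proof -
  have [measurable]: "f n \<in> borel_measurable M" for n using int by auto
  have "(\<integral>\<^sup>+\<omega>. (\<Sum>n. ennreal (f n \<omega>)) \<partial>M) = (\<Sum>n. \<integral>\<^sup>+\<omega>. ennreal (f n \<omega>) \<partial>M)"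
    by (rule nn_integral_suminf) measurable
  also have "\<dots> = (\<Sum>n. ennreal (expectation (f n)))"
    using nn int by (simp add: nn_integral_eq_integral)
  also have "\<dots> = ennreal (\<Sum>n. expectation (f n))"
    using sum nn by (intro suminf_ennreal2) (auto intro: Bochner_Integration.integral_nonneg)
  finally have fin: "(\<integral>\<^sup>+\<omega>. (\<Sum>n. ennreal (f n \<omega>)) \<partial>M) \<noteq> \<infinity>" by simp
  have "AE \<omega> in M. (\<Sum>n. ennreal (f n \<omega>)) \<noteq> \<infinity>"
    by (rule nn_integral_noteq_infinite[OF _ fin]) measurable
  then show ?thesis
  proof eventually_elim
    case (elim \<omega>)
    then have "summable (\<lambda>n. f n \<omega>)" using nn by (intro summable_suminf_not_top) auto
    then show ?case by (rule summable_LIMSEQ_zero)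
  qed
qed

lemma has_moment_0:
  assumes "real_distribution \<mu>"
  shows "has_moment \<mu> 0 1"
proof -
  interpret real_distribution \<mu> by (rule assms)
  show ?thesis using prob_space by (simp add: has_moment_def)
qed

section \<open>The patterned matrix and its normalized traces\<close>

locale patterned_walks = input_variables M X
  for M :: "'a measure" and X :: "nat list \<Rightarrow> nat \<Rightarrow> 'a \<Rightarrow> real" +
  fixes d :: nat and L :: "nat \<Rightarrow> nat \<Rightarrow> nat \<Rightarrow> nat list"
  assumes d: "d \<in> {1, 2}" and link: "link_function d L" and sym: "symmetric_link L"
    and property_B: "property_B d L"
begin

lemma ex_bounded_link: "\<exists>C\<ge>1. \<forall>n\<ge>1. bounded_link (L n) n C"
proof -
  obtain C where C: "\<And>n r i. r \<in> Zplus d \<Longrightarrow> i \<in> {1..n} \<Longrightarrow> card {j \<in> {1..n}. L n i j = r} \<le> C"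
    using property_B unfolding property_B_def by blast
  have "bounded_link (L n) n (max 1 C)" if "1 \<le> n" for n
  proof
    fix i r assume i: "i \<in> {1..n}"
    show "card {j \<in> {1..n}. L n i j = r} \<le> max 1 C"
    proof (cases "r \<in> Zplus d")
      case True
      then show ?thesis using C[OF True i] by simp
    next
      \<comment> \<open>Property B concerns points of \<open>Zplus d\<close> only; any other point
        is not a value of the link function and its fibre is empty.\<close>
      case False
      have "L n i j \<noteq> r" if "j \<in> {1..n}" for j
        using link i that False unfolding link_function_def by blast
      then have "{j \<in> {1..n}. L n i j = r} = {}" by blast
      then show ?thesis by (simp only: card.empty)
    qed
  qed (use that in auto)
  then show ?thesis by (intro exI[of _ "max 1 C"]) simp
qed

lemma circuit_range: "\<pi> \<in> circuits n l \<Longrightarrow> i \<le> l \<Longrightarrow> \<pi> i \<in> {1..n}"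
  unfolding circuits_def by (auto simp: PiE_iff)

lemma edge_letter_Zplus:
  assumes "\<pi> \<in> circuits n l" "q \<in> {1..l}"
  shows "edge_letter (L n) \<pi> q \<in> Zplus d"
proof -
  have "q - 1 \<le> l" "q \<le> l" using assms(2) by auto
  then show ?thesis
    using link circuit_range[OF assms(1)] unfolding link_function_def edge_letter_def by blast
qed

lemma Zplus_d: "r \<in> Zplus d \<Longrightarrow> r \<in> Zplus 1 \<union> Zplus 2"
  using d by auto

text \<open>Of the \<open>l + 1\<close> factors \<open>1 / n\<close>, one averages the trace and one
  scales each of the \<open>l\<close> entries, in two steps of \<open>n ^ (-1/2)\<close>.\<close>

definition normalized_trace :: "nat \<Rightarrow> real \<Rightarrow> nat \<Rightarrow> 'a \<Rightarrow> real" where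
  "normalized_trace n t l \<omega> =
     (1 / real n) ^ (l + 1) * (\<Sum>\<pi>\<in>circuits n l. \<Prod>q=1..l. walk X n (edge_letter (L n) \<pi> q) t \<omega>)"

abbreviation scaled_matrix :: "nat \<Rightarrow> real \<Rightarrow> 'a \<Rightarrow> real mat" where
  "scaled_matrix n t \<omega> \<equiv> (real n powr (-1/2)) \<cdot>\<^sub>m walk_matrix X L n t \<omega>"

abbreviation mean_trace :: "nat \<Rightarrow> real \<Rightarrow> nat \<Rightarrow> real" where
  "mean_trace n t l \<equiv> expectation (normalized_trace n t l)"

lemma scaled_matrix_carrier: "scaled_matrix n t \<omega> \<in> carrier_mat n n"
  by (simp add: walk_matrix_def)

lemma scaled_matrix_entry:
  assumes "1 \<le> n" "i < n" "j < n"
  shows "scaled_matrix n t \<omega> $$ (i, j) = 1 / real n * walk X n (L n (Suc i) (Suc j)) t \<omega>"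
proof -
  have "real n powr (-1/2) * real n powr (-1/2) = 1 / real n"
    using assms(1) by (simp add: powr_add[symmetric] powr_minus_divide)
  then show ?thesis using assms by (simp add: walk_matrix_def mult.assoc[symmetric])
qed

lemma scaled_matrix_symmetric:
  assumes "1 \<le> n" "i < n" "j < n"
  shows "scaled_matrix n t \<omega> $$ (i, j) = scaled_matrix n t \<omega> $$ (j, i)"
proof -
  have "L n (Suc i) (Suc j) = L n (Suc j) (Suc i)"
    using sym assms unfolding symmetric_link_def by auto
  then show ?thesis using assms by (simp only: scaled_matrix_entry)
qed

lemma trace_eq_normalized_trace:
  assumes n: "1 \<le> n"
  shows "1 / real n * mat_trace (scaled_matrix n t \<omega> ^\<^sub>m l) = normalized_trace n t l \<omega>"
proof -
  let ?A = "scaled_matrix n t \<omega>"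
  have "(\<Prod>q=1..l. ?A $$ (\<pi> (q - 1) - 1, \<pi> q - 1))
    = (1 / real n) ^ l * (\<Prod>q=1..l. walk X n (edge_letter (L n) \<pi> q) t \<omega>)" if \<pi>: "\<pi> \<in> circuits n l" for \<pi>
  proof -
    have "?A $$ (\<pi> (q - 1) - 1, \<pi> q - 1) = 1 / real n * walk X n (edge_letter (L n) \<pi> q) t \<omega>"
      if "q \<in> {1..l}" for q
    proof -
      have "q - 1 \<le> l" "q \<le> l" using that by auto
      then have "\<pi> (q - 1) \<in> {1..n}" "\<pi> q \<in> {1..n}"
        using circuit_range[OF \<pi>] by blast+
      then have "\<pi> (q - 1) - 1 < n" "\<pi> q - 1 < n" "Suc (\<pi> (q - 1) - 1) = \<pi> (q - 1)" "Suc (\<pi> q - 1) = \<pi> q"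
        by auto
      then show ?thesis using scaled_matrix_entry[OF n] by (simp only: edge_letter_def)
    qed
    then have "(\<Prod>q=1..l. ?A $$ (\<pi> (q - 1) - 1, \<pi> q - 1))
      = (\<Prod>q=1..l. 1 / real n * walk X n (edge_letter (L n) \<pi> q) t \<omega>)" by (intro prod.cong) auto
    then show ?thesis by (simp only: prod.distrib prod_constant card_atLeastAtMost diff_Suc_1)
  qed
  then have "mat_trace (?A ^\<^sub>m l)
    = (1 / real n) ^ l * (\<Sum>\<pi>\<in>circuits n l. \<Prod>q=1..l. walk X n (edge_letter (L n) \<pi> q) t \<omega>)"
    unfolding mat_trace_pow_eq_circuit_sum[OF scaled_matrix_carrier] sum_distrib_left
    by (intro sum.cong) auto
  then show ?thesis by (simp add: normalized_trace_def)
qed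

lemma all_moments_normalized_trace: "all_moments M (normalized_trace n t l)"
proof -
  interpret W: indep_centered M "\<lambda>r. walk X n r t" "Zplus d" by (rule walks_indep_centered[OF d])
  show ?thesis
    unfolding normalized_trace_def[abs_def]
    by (intro all_moments_mult all_moments_const all_moments_sum all_moments_prod W.moments edge_letter_Zplus)
qed

text \<open>The powers of \<open>n\<close>: \<open>- (4 * l + 4)\<close> from the normalization,
  \<open>2 * l + 2\<close> from the number of quadruples and \<open>2 * l\<close> from the walks, in
  total \<open>-2\<close>. The walks enter as \<open>(n t) ^ (2 * l)\<close>, which also yields the
  power of \<open>t\<close>.\<close>

lemma normalized_trace_fourth_moment:
  assumes l: "1 \<le> l"
  shows "\<exists>K. \<forall>n\<ge>1. \<forall>t\<ge>0. expectation (\<lambda>\<omega>. (normalized_trace n t l \<omega> - mean_trace n t l) ^ 4)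
    \<le> t ^ (2 * l) * (K * real n powr (-2))"
proof -
  obtain C where C: "\<And>n. 1 \<le> n \<Longrightarrow> bounded_link (L n) n C" using ex_bounded_link by blast
  obtain D1 where D1: "\<And>n t r. 0 \<le> t \<Longrightarrow> r \<in> Zplus 1 \<union> Zplus 2 \<Longrightarrow>
      abs_moment l (walk X n r t) \<le> D1 * sqrt (real n * t) ^ l"
    using walk_moment_bound[of l] by blast
  obtain D4 where D4: "0 \<le> D4" "\<And>n t r. 0 \<le> t \<Longrightarrow> r \<in> Zplus 1 \<union> Zplus 2 \<Longrightarrow>
      abs_moment (4 * l) (walk X n r t) \<le> D4 * sqrt (real n * t) ^ (4 * l)"
    using walk_moment_bound[of "4 * l"] by blast
  define v where "v = 16 * (real l * D4 + (real l * D1) ^ 4)"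
  have v: "0 \<le> v" using D4(1) by (simp add: v_def)
  define A where "A = (4 * l) ^ (4 * l) * C ^ (l * 4)"
  have "expectation (\<lambda>\<omega>. (normalized_trace n t l \<omega> - mean_trace n t l) ^ 4)
    \<le> t ^ (2 * l) * (real A * (4 * v) * real n powr (-2))" if n: "1 \<le> n" and t: "0 \<le> t" for n t
  proof -
    interpret W: indep_centered M "\<lambda>r. walk X n r t" "Zplus d" by (rule walks_indep_centered[OF d])
    interpret bl: bounded_link "L n" n C by (rule C[OF n])
    let ?\<tau> = "sqrt (real n * t)"
    let ?G = "{f \<in> {..<4} \<rightarrow>\<^sub>E circuits n l. matched (L n) l 4 f \<and> linked (L n) l 4 f}"
    have "expectation (\<lambda>\<omega>. (normalized_trace n t l \<omega> - mean_trace n t l) ^ 4)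
      \<le> ((1 / real n) ^ (l + 1)) ^ 4 * (real (card ?G) * (4 * (v * ?\<tau> ^ (4 * l))))"
      unfolding normalized_trace_def[abs_def] W.block_def[symmetric]
    proof (rule W.fourth_moment_sum_blocks[OF l edge_letter_Zplus])
      fix \<pi> assume \<pi>: "\<pi> \<in> circuits n l"
      show "expectation (\<lambda>\<omega>. (W.block l (edge_letter (L n) \<pi>) \<omega>
        - expectation (W.block l (edge_letter (L n) \<pi>))) ^ 4) \<le> v * ?\<tau> ^ (4 * l)"
        unfolding v_def
        by (rule W.fourth_moment_block_le[OF l edge_letter_Zplus[OF \<pi>] D1[OF t Zplus_d] D4(2)[OF t Zplus_d]])
    qed
    also have "\<dots> \<le> ((1 / real n) ^ (l + 1)) ^ 4 * (real (A * n ^ (2 * (l + 1))) * (4 * (v * ?\<tau> ^ (4 * l))))"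
    proof (intro mult_left_mono mult_right_mono)
      have "card ?G \<le> A * n ^ (2 * (l + 1))"
        unfolding A_def using bl.card_matched_linked_tuples[OF l, of 4 2] by simp
      then show "real (card ?G) \<le> real (A * n ^ (2 * (l + 1)))" by (simp only: of_nat_le_iff)
    qed (use v t in auto)
    also have "?\<tau> ^ (4 * l) = (real n * t) ^ (2 * l)"
    proof -
      have "?\<tau> ^ (4 * l) = (?\<tau> ^ 2) ^ (2 * l)" by (simp only: power_mult[symmetric]) simp
      then show ?thesis using t by simp
    qed
    also have "((1 / real n) ^ (l + 1)) ^ 4 * (real (A * n ^ (2 * (l + 1))) * (4 * (v * (real n * t) ^ (2 * l))))
      = t ^ (2 * l) * (real A * (4 * v)
          * ((1 / real n) ^ (4 * l + 4) * (real n ^ (2 * l + 2) * real n ^ (2 * l))))"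
    proof -
      have "((1 / real n) ^ (l + 1)) ^ 4 = (1 / real n) ^ (4 * l + 4)"
        by (simp only: power_mult[symmetric]) (simp add: algebra_simps)
      then show ?thesis by (simp add: power_mult_distrib algebra_simps)
    qed
    also have "(1 / real n) ^ (4 * l + 4) * (real n ^ (2 * l + 2) * real n ^ (2 * l)) = real n powr (-2)"
    proof -
      have "real n ^ (2 * l + 2) * real n ^ (2 * l) = real n ^ (4 * l + 2)"
        by (simp only: power_add[symmetric]) (simp add: algebra_simps)
      moreover have "(1 / real n) ^ (4 * l + 4) = 1 / (real n ^ (4 * l + 2) * real n ^ 2)"
        by (simp only: power_one_over power_add[symmetric]) (simp add: numeral_eq_Suc)
      moreover have "real n powr (-2) = 1 / real n ^ 2"
        using n by (simp add: powr_minus_divide)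
      ultimately show ?thesis using n by simp
    qed
    finally show ?thesis .
  qed
  then show ?thesis by blast
qed

lemma AE_normalized_trace_centered:
  assumes l: "1 \<le> l" and t: "0 \<le> t"
  shows "AE \<omega> in M. (\<lambda>n. normalized_trace (Suc n) t l \<omega> - mean_trace (Suc n) t l) \<longlonglongrightarrow> 0"
proof -
  obtain K where K: "\<And>n. 1 \<le> n \<Longrightarrow>
      expectation (\<lambda>\<omega>. (normalized_trace n t l \<omega> - mean_trace n t l) ^ 4)
      \<le> t ^ (2 * l) * (K * real n powr (-2))"
    using normalized_trace_fourth_moment[OF l] t by blast
  let ?Z = "\<lambda>n \<omega>. normalized_trace (Suc n) t l \<omega> - mean_trace (Suc n) t l"
  have "AE \<omega> in M. (\<lambda>n. ?Z n \<omega> ^ 4) \<longlonglongrightarrow> 0"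
  proof (rule AE_tendsto_0_if_summable_expectation)
    show "integrable M (\<lambda>\<omega>. ?Z n \<omega> ^ 4)" for n
      by (intro all_moments_integrable all_moments_power all_moments_diff_const all_moments_normalized_trace)
    have "summable (\<lambda>n. inverse (real n ^ 2))" by (rule inverse_power_summable) simp
    then have "summable (\<lambda>n. inverse (real (Suc n) ^ 2))" by (subst summable_Suc_iff)
    then have "summable (\<lambda>n. t ^ (2 * l) * K * inverse (real (Suc n) ^ 2))" by (rule summable_mult)
    then show "summable (\<lambda>n. expectation (\<lambda>\<omega>. ?Z n \<omega> ^ 4))"
    proof (rule summable_comparison_test'[where N = 0])
      fix n :: nat
      have "real (Suc n) powr (-2) = inverse (real (Suc n) ^ 2)"
        by (simp only: powr_minus) (simp add: powr_numeral)
      then have "expectation (\<lambda>\<omega>. ?Z n \<omega> ^ 4) \<le> t ^ (2 * l) * K * inverse (real (Suc n) ^ 2)"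
        using K[of "Suc n"] by (simp add: mult.assoc)
      moreover have "0 \<le> expectation (\<lambda>\<omega>. ?Z n \<omega> ^ 4)"
        by (intro Bochner_Integration.integral_nonneg) simp
      ultimately show "norm (expectation (\<lambda>\<omega>. ?Z n \<omega> ^ 4)) \<le> t ^ (2 * l) * K * inverse (real (Suc n) ^ 2)"
        by simp
    qed
  qed simp
  then show ?thesis by (simp add: power_tendsto_0_iff)
qed

text \<open>\<open>limit_law\<close> prescribes moments of positive order only. The value 1 at order
  0 completes the sequence for the method of moments and holds for every probability law.\<close>

definition limit_moment :: "real \<Rightarrow> nat \<Rightarrow> real" where
  "limit_moment t k = (if odd k then 0 else if k = 0 then 1 else
     t ^ (k div 2) * (\<Sum>w\<in>pair_matched_words k. lim (word_ratio L (k div 2) w)))"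

lemma limit_law_iff: "limit_law L t \<mu> \<longleftrightarrow> real_distribution \<mu> \<and> (\<forall>k. has_moment \<mu> k (limit_moment t k))"
proof
  assume \<mu>: "limit_law L t \<mu>"
  have "has_moment \<mu> k (limit_moment t k)" for k
  proof -
    consider "odd k" | "k = 0" | m where "k = 2 * m" "1 \<le> m"
      by (metis One_nat_def Suc_leI evenE gr0I mult_0_right)
    then show ?thesis
    proof cases
      case 1
      then show ?thesis using \<mu> by (simp add: limit_law_def limit_moment_def)
    next
      case 2
      then show ?thesis using \<mu> has_moment_0 by (simp add: limit_law_def limit_moment_def)
    next
      case 3
      then show ?thesis using \<mu> by (simp add: limit_law_def limit_moment_def)
    qed
  qed
  then show "real_distribution \<mu> \<and> (\<forall>k. has_moment \<mu> k (limit_moment t k))"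
    using \<mu> by (simp add: limit_law_def)
next
  assume \<mu>: "real_distribution \<mu> \<and> (\<forall>k. has_moment \<mu> k (limit_moment t k))"
  have "has_moment \<mu> k 0" if "odd k" for k
  proof -
    have "has_moment \<mu> k (limit_moment t k)" using \<mu> by blast
    then show ?thesis using that by (simp add: limit_moment_def)
  qed
  moreover have "has_moment \<mu> (2 * m)
    (t ^ m * (\<Sum>w\<in>pair_matched_words (2 * m). lim (word_ratio L m w)))" if "1 \<le> m" for m
  proof -
    have "has_moment \<mu> (2 * m) (limit_moment t (2 * m))" using \<mu> by blast
    then show ?thesis using that by (simp add: limit_moment_def)
  qed
  ultimately show "limit_law L t \<mu>" using \<mu> by (simp add: limit_law_def)
qed

text \<open>A pair-matched word of length \<open>2 * m\<close> has \<open>m\<close> letters; these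
  and the starting vertex account for the \<open>1 + m\<close> free choices.\<close>

lemma word_ratio_le:
  assumes w: "w \<in> pair_matched_words (2 * m)" and m: "1 \<le> m" and n: "1 \<le> n"
    and C: "bounded_link (L n) n C"
  shows "word_ratio L m w n \<le> real C ^ (2 * m)"
proof -
  interpret bounded_link "L n" n C by (rule C)
  let ?w = "\<lambda>q. w ! (q - 1)"
  have len: "length w = 2 * m" using w by (simp add: pair_matched_words_def)
  have img: "?w ` {1..2 * m} = set w"
  proof -
    have "?w ` {1..2 * m} = ?w ` Suc ` {..<2 * m}" by (simp only: image_Suc_lessThan)
    also have "\<dots> = (!) w ` {..<2 * m}" by (simp only: image_image diff_Suc_1)
    also have "\<dots> = set w" unfolding len[symmetric] by (auto simp: set_conv_nth)
    finally show ?thesis .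
  qed
  have "word_circuits L n w \<subseteq> circuits_following (L n) n (2 * m) ?w {} (\<lambda>_. undefined)"
    unfolding word_circuits_def follows_def edge_letter_def len by blast
  then have "card (word_circuits L n w)
    \<le> card (circuits_following (L n) n (2 * m) ?w {} (\<lambda>_. undefined))"
    using finite_circuits by (intro card_mono) auto
  also have "\<dots> \<le> n ^ (1 + card (?w ` {1..2 * m} - {})) * C ^ (2 * m)"
    using m by (intro card_circuits_follows) auto
  also have "card (?w ` {1..2 * m} - {}) = m" unfolding img using card_set_pair_matched[OF w] by simp
  finally have "real (card (word_circuits L n w)) \<le> real (n ^ (1 + m) * C ^ (2 * m))"
    by (simp only: of_nat_le_iff)
  then show ?thesis using n by (simp add: word_ratio_def divide_le_eq mult_ac)
qed

section \<open>Limits of the traces and of the spectral distributions\<close>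

context
  assumes conv: "\<And>m w. 1 \<le> m \<Longrightarrow> w \<in> pair_matched_words (2 * m) \<Longrightarrow> convergent (word_ratio L m w)"
begin

lemma limit_moment_growth:
  assumes t: "0 \<le> t"
  shows "\<exists>K. \<forall>m. limit_moment t (2 * m) \<le> fact (2 * m) / fact m * K ^ m"
proof -
  obtain C where C: "\<And>n. 1 \<le> n \<Longrightarrow> bounded_link (L n) n C" using ex_bounded_link by blast
  \<comment> \<open>In the base of the power, 4 comes from the number of words, \<open>t\<close>
    from the walks and \<open>real C ^ 2\<close> from the bound on the word ratios.\<close>
  have "limit_moment t (2 * m) \<le> fact (2 * m) / fact m * (4 * t * real C ^ 2) ^ m" for m
  proof (cases "m = 0")
    case True
    then show ?thesis by (simp add: limit_moment_def)
  next
    case False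
    then have m: "1 \<le> m" by simp
    have lim_le: "lim (word_ratio L m w) \<le> real C ^ (2 * m)" if w: "w \<in> pair_matched_words (2 * m)" for w
    proof (rule LIMSEQ_le_const2)
      show "word_ratio L m w \<longlonglongrightarrow> lim (word_ratio L m w)"
        using conv[OF m w] by (simp add: convergent_LIMSEQ_iff)
      show "\<exists>N. \<forall>n\<ge>N. word_ratio L m w n \<le> real C ^ (2 * m)"
        using word_ratio_le[OF w m _ C] by blast
    qed
    have "limit_moment t (2 * m) = t ^ m * (\<Sum>w\<in>pair_matched_words (2 * m). lim (word_ratio L m w))"
      using False by (simp add: limit_moment_def)
    also have "\<dots> \<le> t ^ m * (real (card (pair_matched_words (2 * m))) * real C ^ (2 * m))"
      using t lim_le by (intro mult_left_mono sum_bounded_above) auto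
    also have "\<dots> \<le> t ^ m * (fact (2 * m) / fact m * 4 ^ m * real C ^ (2 * m))"
      using t card_pair_matched_words_growth by (intro mult_left_mono mult_right_mono) auto
    also have "\<dots> = fact (2 * m) / fact m * (4 * t * real C ^ 2) ^ m"
      by (simp only: power_mult_distrib power_mult[symmetric] times_divide_eq_left mult_ac)
    finally show ?thesis .
  qed
  then show ?thesis by blast
qed

text \<open>\<open>?main\<close> collects the pair-matched circuits. The error has powers
  \<open>- (l + 1)\<close> from the normalization, at most \<open>(l + 1) / 2\<close> from the
  circuits with few letters and \<open>l / 2\<close> from the walks, hence is
  \<open>O(n ^ (-1/2))\<close>.\<close>

lemma expectation_normalized_trace_tendsto:
  assumes l: "1 \<le> l" and t: "0 \<le> t"
  shows "(\<lambda>n. mean_trace n t l) \<longlonglongrightarrow> limit_moment t l"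
proof -
  obtain C where C: "\<And>n. 1 \<le> n \<Longrightarrow> bounded_link (L n) n C" using ex_bounded_link by blast
  obtain D where D: "0 \<le> D" "\<And>n t r. 0 \<le> t \<Longrightarrow> r \<in> Zplus 1 \<union> Zplus 2 \<Longrightarrow>
      abs_moment l (walk X n r t) \<le> D * sqrt (real n * t) ^ l"
    using walk_moment_bound[of l] by blast
  let ?N = "\<lambda>n. real (nat \<lfloor>real n * t\<rfloor>)"
  let ?main = "\<lambda>n. (1 / real n) ^ (l + 1) * (real (card (pair_matched_circuits (L n) n l)) * ?N n ^ (l div 2))"
  define K where "K = real (l ^ l * C ^ l) * (real l * (D * sqrt t ^ l))"
  have err: "\<bar>mean_trace n t l - ?main n\<bar> \<le> K / sqrt (real n)" if n: "1 \<le> n" for n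
  proof -
    interpret W: indep_centered M "\<lambda>r. walk X n r t" "Zplus d" by (rule walks_indep_centered[OF d])
    interpret bl: bounded_link "L n" n C by (rule C[OF n])
    let ?\<tau> = "sqrt (real n * t)" and ?s = "sqrt (real n)"
    let ?S = "\<Sum>\<pi>\<in>circuits n l. expectation (W.block l (edge_letter (L n) \<pi>))"
    let ?F = "{\<pi> \<in> circuits n l. card (edge_letter (L n) \<pi> ` {1..l}) \<le> (l - 1) div 2}"
    have s: "1 \<le> ?s" "?s ^ 2 = real n" using n by auto
    have "expectation (\<lambda>\<omega>. \<Sum>\<pi>\<in>circuits n l. W.block l (edge_letter (L n) \<pi>) \<omega>) = ?S"
      by (intro Bochner_Integration.integral_sum all_moments_integrable W.all_moments_block edge_letter_Zplus)
    then have "mean_trace n t l = (1 / real n) ^ (l + 1) * ?S"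
      unfolding normalized_trace_def[abs_def] W.block_def[symmetric] by simp
    then have "\<bar>mean_trace n t l - ?main n\<bar>
      = (1 / real n) ^ (l + 1) * \<bar>?S - real (card (pair_matched_circuits (L n) n l)) * ?N n ^ (l div 2)\<bar>"
      by (simp only: right_diff_distrib[symmetric] abs_mult) simp
    also have "\<dots> \<le> (1 / real n) ^ (l + 1) * (real (card ?F) * (real l * (D * ?\<tau> ^ l)))"
    proof (rule mult_left_mono[OF W.sum_expectation_blocks[OF l edge_letter_Zplus]])
      show "expectation (\<lambda>\<omega>. (walk X n r t \<omega>)\<^sup>2) = ?N n" if "r \<in> Zplus d" for r
        by (rule walk_second_moment[OF Zplus_d[OF that]])
      show "abs_moment l (walk X n r t) \<le> D * ?\<tau> ^ l" if "r \<in> Zplus d" for r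
        by (rule D(2)[OF t Zplus_d[OF that]])
    qed (use D(1) t in auto)
    \<comment> \<open>Counting in powers of \<open>?s\<close> treats both parities of
      \<open>l\<close> at once, since \<open>2 * (1 + (l - 1) div 2)\<close> is at most
      \<open>l + 1\<close>.\<close>
    also have "\<dots> \<le> (1 / real n) ^ (l + 1) * (real (l ^ l * C ^ l) * ?s ^ (l + 1) * (real l * (D * ?\<tau> ^ l)))"
    proof (intro mult_left_mono mult_right_mono)
      have "real (card ?F) \<le> real (l ^ l * C ^ l * n ^ (1 + (l - 1) div 2))"
        using bl.card_circuits_few_letters[OF l] by (simp only: of_nat_le_iff)
      also have "\<dots> = real (l ^ l * C ^ l) * ?s ^ (2 * (1 + (l - 1) div 2))"
        by (simp only: power_mult s(2) of_nat_mult of_nat_power)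
      also have "\<dots> \<le> real (l ^ l * C ^ l) * ?s ^ (l + 1)"
        using l s(1) by (intro mult_left_mono power_increasing) auto
      finally show "real (card ?F) \<le> real (l ^ l * C ^ l) * ?s ^ (l + 1)" .
    qed (use D(1) t in auto)
    also have "\<dots> = K * ((1 / real n) ^ (l + 1) * (?s ^ (l + 1) * ?s ^ l))"
      unfolding K_def real_sqrt_mult power_mult_distrib by (simp only: mult_ac)
    also have "(1 / real n) ^ (l + 1) * (?s ^ (l + 1) * ?s ^ l) = 1 / ?s"
    proof -
      have "(1 / real n) ^ (l + 1) = 1 / (?s ^ (l + 1) * ?s ^ (l + 1))"
      proof -
        have "real n ^ (l + 1) = ?s ^ (l + 1) * ?s ^ (l + 1)"
          by (simp only: power_mult_distrib[symmetric] real_sqrt_mult_self abs_of_nat)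
        then show ?thesis by (simp only: power_one_over)
      qed
      then show ?thesis using s(1) by simp
    qed
    finally show ?thesis by simp
  qed
  have "?main \<longlonglongrightarrow> limit_moment t l"
  proof (cases "even l")
    case False
    have "pair_matched_circuits (L n) n l = {}" for n
    proof (rule ccontr)
      assume "pair_matched_circuits (L n) n l \<noteq> {}"
      then obtain w where "w \<in> pair_matched_words l" unfolding pair_matched_circuits_eq by blast
      then show False using False card_set_pair_matched by fastforce
    qed
    then show ?thesis using False by (simp add: limit_moment_def)
  next
    case True
    then obtain m where lm: "l = 2 * m" by (auto elim: evenE)
    then have m: "1 \<le> m" using l by simp
    have main_eq: "?main n = (?N n / real n) ^ m * (\<Sum>w\<in>pair_matched_words l. word_ratio L m w n)" for n
    proof -
      \<comment> \<open>The first \<open>m\<close> factors turn the numbers of steps into ratios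
        tending to \<open>t\<close>; the other \<open>1 + m\<close> form the word ratios.\<close>
      have "(1 / real n) ^ (l + 1) = (1 / real n) ^ m * (1 / real n) ^ (1 + m)"
        by (simp only: power_add[symmetric] lm) (simp add: mult_2)
      moreover have "l div 2 = m" by (simp add: lm)
      ultimately have "?main n = (1 / real n) ^ m * ?N n ^ m * (real (card (pair_matched_circuits (L n) n l)) * (1 / real n) ^ (1 + m))"
        by (simp only: mult_ac)
      also have "real (card (pair_matched_circuits (L n) n l)) * (1 / real n) ^ (1 + m)
        = (\<Sum>w\<in>pair_matched_words l. word_ratio L m w n)"
        unfolding card_pair_matched_circuits word_ratio_def of_nat_sum sum_distrib_right
        by (simp add: power_one_over)
      also have "(1 / real n) ^ m * ?N n ^ m = (?N n / real n) ^ m"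
        by (simp add: power_divide)
      finally show ?thesis .
    qed
    have "(\<lambda>n. ?N n / real n) \<longlonglongrightarrow> t"
    proof (rule tendsto_sandwich)
      show "(\<lambda>n. t - 1 / real n) \<longlonglongrightarrow> t"
        using tendsto_diff[OF tendsto_const lim_1_over_n, of t] by simp
      show "\<forall>\<^sub>F n in sequentially. t - 1 / real n \<le> ?N n / real n"
      proof (rule eventually_sequentiallyI[of 1])
        fix n :: nat assume n: "1 \<le> n"
        have "real n * t - 1 \<le> ?N n" using t by linarith
        then have "(real n * t - 1) / real n \<le> ?N n / real n" by (rule divide_right_mono) simp
        then show "t - 1 / real n \<le> ?N n / real n" using n by (simp add: diff_divide_distrib)
      qed
      show "\<forall>\<^sub>F n in sequentially. ?N n / real n \<le> t"
      proof (rule eventually_sequentiallyI[of 1])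
        fix n :: nat assume n: "1 \<le> n"
        have "?N n \<le> real n * t" using t by simp
        then show "?N n / real n \<le> t" using n by (simp add: pos_divide_le_eq mult.commute)
      qed
    qed simp
    moreover have "word_ratio L m w \<longlonglongrightarrow> lim (word_ratio L m w)" if "w \<in> pair_matched_words l" for w
      using conv[OF m] that lm by (simp add: convergent_LIMSEQ_iff)
    ultimately have "(\<lambda>n. (?N n / real n) ^ m * (\<Sum>w\<in>pair_matched_words l. word_ratio L m w n))
      \<longlonglongrightarrow> t ^ m * (\<Sum>w\<in>pair_matched_words l. lim (word_ratio L m w))"
      by (intro tendsto_intros)
    moreover have "limit_moment t l = t ^ m * (\<Sum>w\<in>pair_matched_words l. lim (word_ratio L m w))"
      using m by (simp add: limit_moment_def lm)
    ultimately show ?thesis unfolding main_eq by simp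
  qed
  moreover have "(\<lambda>n. mean_trace n t l - ?main n) \<longlonglongrightarrow> 0"
  proof (rule Lim_null_comparison)
    show "\<forall>\<^sub>F n in sequentially. norm (mean_trace n t l - ?main n) \<le> K / sqrt (real n)"
      using err by (intro eventually_sequentiallyI[of 1]) simp
    show "(\<lambda>n. K / sqrt (real n)) \<longlonglongrightarrow> 0"
      by (rule real_tendsto_divide_at_top[OF tendsto_const
          filterlim_compose[OF sqrt_at_top filterlim_real_sequentially]])
  qed
  ultimately show ?thesis by (rule Lim_transform)
qed

lemma AE_normalized_trace_tendsto:
  assumes t: "0 \<le> t"
  shows "AE \<omega> in M. \<forall>l\<ge>1. (\<lambda>n. normalized_trace (Suc n) t l \<omega>) \<longlonglongrightarrow> limit_moment t l"
  unfolding AE_all_countable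
proof (intro allI)
  fix l :: nat
  show "AE \<omega> in M. 1 \<le> l \<longrightarrow> (\<lambda>n. normalized_trace (Suc n) t l \<omega>) \<longlonglongrightarrow> limit_moment t l"
  proof (cases "1 \<le> l")
    case True
    have mean: "(\<lambda>n. mean_trace (Suc n) t l) \<longlonglongrightarrow> limit_moment t l"
      by (rule LIMSEQ_Suc[OF expectation_normalized_trace_tendsto[OF True t]])
    from AE_normalized_trace_centered[OF True t] show ?thesis
    proof eventually_elim
      case (elim \<omega>)
      from tendsto_add[OF this mean] show ?case by simp
    qed
  qed simp
qed

text \<open>A deterministic statement at one sample point: the law comes out of the convergence and
  is not assumed to exist.\<close>

lemma limit_law_if_traces_converge:
  assumes t: "0 \<le> t"
    and tr: "\<And>l. 1 \<le> l \<Longrightarrow> (\<lambda>n. normalized_trace (Suc n) t l \<omega>) \<longlonglongrightarrow> limit_moment t l"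
  shows "\<exists>\<nu>. limit_law L t \<nu> \<and> weak_conv (\<lambda>n. esd (scaled_matrix n t \<omega>)) (cdf \<nu>)"
proof -
  have "\<exists>\<mu>. real_distribution \<mu> \<and> cdf \<mu> = esd (scaled_matrix (Suc n) t \<omega>)
    \<and> (\<forall>k. has_moment \<mu> k (normalized_trace (Suc n) t k \<omega>))" for n
    using real_symmetric_spectral_law[OF scaled_matrix_carrier[of "Suc n"] _ scaled_matrix_symmetric]
    by (simp add: trace_eq_normalized_trace[of "Suc n", simplified])
  then obtain \<mu> where \<mu>: "\<And>n. real_distribution (\<mu> n)"
    "\<And>n. cdf (\<mu> n) = esd (scaled_matrix (Suc n) t \<omega>)"
    "\<And>n k. has_moment (\<mu> n) k (normalized_trace (Suc n) t k \<omega>)" by metis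
  obtain K where K: "\<And>m. limit_moment t (2 * m) \<le> fact (2 * m) / fact m * K ^ m"
    using limit_moment_growth[OF t] by blast
  have "\<exists>\<nu>. real_distribution \<nu> \<and> (\<forall>k. has_moment \<nu> k (limit_moment t k)) \<and> weak_conv_m \<mu> \<nu>"
  proof (rule method_of_moments[OF \<mu>(1) _ _ K])
    show "integrable (\<mu> n) (\<lambda>x. x ^ k)" for n k using \<mu>(3)[of n k] by (simp add: has_moment_def)
    show "(\<lambda>n. LINT x|\<mu> n. x ^ k) \<longlonglongrightarrow> limit_moment t k" for k
    proof (cases "k = 0")
      case True
      have "(LINT x|\<mu> n. x ^ 0) = 1" for n
        using has_moment_0[OF \<mu>(1)[of n]] unfolding has_moment_def by blast
      then show ?thesis using True by (simp add: limit_moment_def)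
    next
      case False
      have "(LINT x|\<mu> n. x ^ k) = normalized_trace (Suc n) t k \<omega>" for n
        using \<mu>(3)[of n k] by (simp add: has_moment_def)
      then show ?thesis using tr[of k] False by simp
    qed
  qed
  then obtain \<nu> where \<nu>: "limit_law L t \<nu>" "weak_conv_m \<mu> \<nu>"
    unfolding limit_law_iff by blast
  have "weak_conv (\<lambda>n. esd (scaled_matrix n t \<omega>)) (cdf \<nu>)"
    unfolding weak_conv_def
  proof (intro allI impI)
    fix x assume "isCont (cdf \<nu>) x"
    then have "(\<lambda>n. esd (scaled_matrix (Suc n) t \<omega>) x) \<longlonglongrightarrow> cdf \<nu> x"
      using \<nu>(2) unfolding weak_conv_m_def weak_conv_def \<mu>(2) by blast
    then show "(\<lambda>n. esd (scaled_matrix n t \<omega>) x) \<longlonglongrightarrow> cdf \<nu> x"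
      by (rule LIMSEQ_imp_Suc)
  qed
  with \<nu>(1) show ?thesis by blast
qed

lemma limit_law_unique:
  assumes "0 \<le> t" "limit_law L t \<mu>" "limit_law L t \<nu>"
  shows "\<mu> = \<nu>"
proof -
  obtain K where "\<And>m. limit_moment t (2 * m) \<le> fact (2 * m) / fact m * K ^ m"
    using limit_moment_growth[OF assms(1)] by blast
  then show ?thesis
    using assms(2,3) unfolding limit_law_iff
    by (intro real_distribution_eq_if_moments_eq[of \<mu> \<nu> "limit_moment t" K]) auto
qed

text \<open>Existence is a probabilistic argument: an almost sure event contains a sample point, and
  the spectral distributions at this point converge to a law with the prescribed moments.\<close>

lemma ex1_limit_law:
  assumes t: "0 \<le> t"
  shows "\<exists>!\<mu>. limit_law L t \<mu>"
proof -
  obtain \<omega> where "\<forall>l\<ge>1. (\<lambda>n. normalized_trace (Suc n) t l \<omega>) \<longlonglongrightarrow> limit_moment t l"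
    using eventually_happens'[OF ae_filter_bot AE_normalized_trace_tendsto[OF t]] by blast
  then show ?thesis
    using limit_law_if_traces_converge[OF t, of \<omega>] limit_law_unique[OF t] by blast
qed

lemma AE_weak_conv_esd:
  assumes t: "0 \<le> t" and \<mu>: "limit_law L t \<mu>"
  shows "AE \<omega> in M. weak_conv (\<lambda>n. esd (scaled_matrix n t \<omega>)) (cdf \<mu>)"
  using AE_normalized_trace_tendsto[OF t]
proof eventually_elim
  case (elim \<omega>)
  then obtain \<nu> where "limit_law L t \<nu>" "weak_conv (\<lambda>n. esd (scaled_matrix n t \<omega>)) (cdf \<nu>)"
    using limit_law_if_traces_converge[OF t, of \<omega>] by blast
  then show ?case using limit_law_unique[OF t \<mu>] by blast
qed

end

end

theorem theorem3p2:
  fixes M :: "'a measure"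
    and X :: "nat list \<Rightarrow> nat \<Rightarrow> 'a \<Rightarrow> real"
    and d :: nat
    and L :: "nat \<Rightarrow> nat \<Rightarrow> nat \<Rightarrow> nat list"
  defines "B \<equiv> \<lambda>n t \<omega>. (real n powr (-1/2)) \<cdot>\<^sub>m walk_matrix X L n t \<omega>"
  assumes "prob_space M"
    and "assumption_I M X"
    and "d \<in> {1, 2}"
    and "link_function d L"
    and "symmetric_link L"
    and "property_B d L"
    and "\<forall>m\<ge>1. \<forall>w\<in>pair_matched_words (2 * m). convergent (word_ratio L m w)"
  shows "(\<forall>l\<ge>1. \<exists>C. \<forall>\<^sub>F n in sequentially. \<forall>t\<ge>0.
            prob_space.expectation M (\<lambda>\<omega>.
              (1 / real n * mat_trace (B n t \<omega> ^\<^sub>m l)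
               - prob_space.expectation M (\<lambda>\<omega>'. 1 / real n * mat_trace (B n t \<omega>' ^\<^sub>m l))) ^ 4)
            \<le> t ^ (2 * l) * (C * real n powr (-2)))
       \<and> (\<forall>t\<ge>0. (\<exists>!\<mu>. limit_law L t \<mu>) \<and>
            (\<forall>\<mu>. limit_law L t \<mu> \<longrightarrow>
               (AE \<omega> in M. weak_conv (\<lambda>n. esd (B n t \<omega>)) (cdf \<mu>))))"
proof -
  interpret prob_space M by (rule assms(2))
  interpret patterned_walks M X d L
    by unfold_locales (use assms(3-7) in auto)
  have conv: "\<And>m w. 1 \<le> m \<Longrightarrow> w \<in> pair_matched_words (2 * m) \<Longrightarrow> convergent (word_ratio L m w)"
    using assms(8) by blast
  show ?thesis
  proof (intro conjI allI impI)
    fix l :: nat assume l: "1 \<le> l"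
    obtain K where K: "\<And>n t. 1 \<le> n \<Longrightarrow> 0 \<le> t \<Longrightarrow>
        expectation (\<lambda>\<omega>. (normalized_trace n t l \<omega> - mean_trace n t l) ^ 4)
        \<le> t ^ (2 * l) * (K * real n powr (-2))"
      using normalized_trace_fourth_moment[OF l] by blast
    show "\<exists>C. \<forall>\<^sub>F n in sequentially. \<forall>t\<ge>0.
        expectation (\<lambda>\<omega>. (1 / real n * mat_trace (B n t \<omega> ^\<^sub>m l)
          - expectation (\<lambda>\<omega>'. 1 / real n * mat_trace (B n t \<omega>' ^\<^sub>m l))) ^ 4)
        \<le> t ^ (2 * l) * (C * real n powr (-2))"
      unfolding B_def
      by (intro exI[of _ K] eventually_sequentiallyI[of 1] allI impI)
        (simp only: trace_eq_normalized_trace K)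
  next
    fix t :: real assume t: "0 \<le> t"
    show "\<exists>!\<mu>. limit_law L t \<mu>" by (rule ex1_limit_law[OF conv t])
    fix \<mu> assume "limit_law L t \<mu>"
    from AE_weak_conv_esd[OF conv t this]
    show "AE \<omega> in M. weak_conv (\<lambda>n. esd (B n t \<omega>)) (cdf \<mu>)"
      unfolding B_def .
  qed
qed

end
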